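(* Let $s\in(0,1)$, $N\ge 1$, and let $\Omega\subset\mathbb{R}^N$ be a bounded domain with Lipschitz boundary. Let $f:\Omega\times\mathbb{R}\to\mathbb{R}$ be a Carathéodory function, $F(x,t)=\int_0^t f(x,\tau)\,d\tau$, such that: (a) there exist $r\in(1,\frac{N}{N-s})$ and $C>0$ with $|f(x,t)|\le C|t|^{r-1}$ for all $(x,t)\in\Omega\times\mathbb{R}$; (b) there exists $\theta>1$ with $0<\theta F(x,t)\le t f(x,t)$ for all $x\in\Omega$, $t\neq 0$; (c) $f(x,\cdot)\in C^1(\mathbb{R})$ for all $x\in\Omega$ and there exists $\Theta>1$ with $(\Theta-1)f(x,t)t<t^2f'(x,t)$ for all $x\in\Omega$, $t\ne 0$ (where $f'=\partial_t f$); (d) $r<1+\frac{N}{2(N-s)}$. Let $u_0\in W_0^{s,1}(\Omega)\cap L^2(\Omega)$. If $E(u_0)\le d$, $I(u_0)\ge 0$ and $f(x,\cdot)$ is uniformly Lipschitz for almost all $x\in\Omega$ (i.e. with a Lipschitz constant independent of $x$), then weak solutions and strong solutions of problem (P) with initial datum $u_0$ are unique.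
   Context: Let $\mathcal{C}\Omega=\mathbb{R}^N\setminus\Omega$, $Q=(\mathbb{R}^N\times\mathbb{R}^N)\setminus(\mathcal{C}\Omega\times\mathcal{C}\Omega)$, and $W_0^{s,1}(\Omega)=\{u: u\in L^1(\Omega),\ u=0 \text{ in }\mathcal{C}\Omega,\ \frac{|u(x)-u(y)|}{|x-y|^{N+s}}\in L^1(Q)\}$ with norm $\|u\|_{W_0^{s,1}(\Omega)}=\iint_Q\frac{|u(x)-u(y)|}{|x-y|^{N+s}}dxdy$. Set $1_s^*=\frac{N}{N-s}$. Functionals on $W_0^{s,1}(\Omega)$: $E(u)=\|u\|_{W_0^{s,1}(\Omega)}-\int_\Omega F(x,u)dx$, $I(u)=\|u\|_{W_0^{s,1}(\Omega)}-\int_\Omega f(x,u)u\,dx$. Nehari manifold $\mathcal{N}=\{u\in W_0^{s,1}(\Omega)\setminus\{0\}: I(u)=0\}$, and $d=\inf_{u\in\mathcal{N}}E(u)$. Problem (P): $u_t+(-\Delta)_1^s u=f(x,u)$ in $\Omega\times(0,T)$, $u=0$ in $(\mathbb{R}^N\setminus\Omega)\times(0,T)$, $u(\cdot,0)=u_0$ in $\Omega$, where $(-\Delta)^s_1$ is the fractional 1-Laplacian (formally $\mathrm{P.V.}\int_{\mathbb{R}^N}\frac{u(x)-u(y)}{|u(x)-u(y)|}\frac{dy}{|x-y|^{N+s}}$). Weak solution on $(0,T)$: a function $u\in L^\infty(0,T;W_0^{s,1}(\Omega)\cap L^2(\Omega))$ with $u_t\in L^2(0,T;L^2(\Omega))$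 such that (1) $u(\cdot,0)=u_0$ a.e. in $\Omega$; (2) there exists $\eta(\cdot,\cdot,t)\in L^\infty(\mathbb{R}^N\times\mathbb{R}^N)$, antisymmetric ($\eta(x,y,t)=-\eta(y,x,t)$ for a.e. $(x,y)$), with $\|\eta(\cdot,\cdot,t)\|_{L^\infty}\le 1$ and $\eta(x,y,t)\in\operatorname{sign}(u(x,t)-u(y,t))$ for a.e. $(x,y,t)\in\mathbb{R}^N\times\mathbb{R}^N\times[0,T]$ (multivalued sign, $\operatorname{sign}(0)=[-1,1]$), such that $\int_\Omega u_t\phi\,dx+\iint_Q\eta(x,y,t)\frac{\phi(x)-\phi(y)}{|x-y|^{N+s}}dxdy=\int_\Omega f(x,u)\phi\,dx$ for all $\phi\in W_0^{s,1}(\Omega)\cap L^2(\Omega)$ and a.e. $t\in[0,T]$; (3) $u\in C(0,T;L^\kappa(\Omega))$ for $\kappa\in[1,1_s^* )$ and $\int_0^t\|u_t(\cdot,\tau)\|_{L^2(\Omega)}^2d\tau+E(u(\cdot,t))\le E(u_0)$ for a.e. $t\in[0,T)$. Strong solution: a weak solution for which $\int_0^t\|u_t(\cdot,\tau)\|_{L^2(\Omega)}^2d\tau+E(u(\cdot,t))=E(u(\cdot,0))$ for every $[0,t]\subset[0,T)$. *)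

theory Defs
  imports "HOL-Analysis.Analysis"
begin

text \<open>
  \<open>\<real>\<^sup>N\<close> is a Euclidean space \<^typ>\<open>'a\<close> with \<open>N = DIM('a)\<close>.  Function classes are represented by functions
  on the whole of \<^typ>\<open>'a\<close>, and their equality is equality almost everywhere.
\<close>

section \<open>Domains and nonlinearities\<close>

text \<open>
  Near each boundary point, \<open>\<Omega>\<close> is the region above the graph of a Lipschitz function defined on a
  hyperplane \<open>{y. y \<bullet> e = 0}\<close>; \<open>x - (x \<bullet> e) *\<^sub>R e\<close> is the orthogonal projection of \<open>x\<close> to it.
\<close>
definition lipschitz_boundary :: "'a::euclidean_space set \<Rightarrow> bool" where
  "lipschitz_boundary \<Omega> \<longleftrightarrow>
     (\<forall>z\<in>frontier \<Omega>. \<exists>e \<gamma> L \<delta>. norm e = 1 \<and> 0 < \<delta> \<and> L-lipschitz_on {y. y \<bullet> e = 0} \<gamma> \<and>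
        \<Omega> \<inter> ball z \<delta> = {x \<in> ball z \<delta>. \<gamma> (x - (x \<bullet> e) *\<^sub>R e) < x \<bullet> e})"

definition bounded_lipschitz_domain :: "'a::euclidean_space set \<Rightarrow> bool" where
  "bounded_lipschitz_domain \<Omega> \<longleftrightarrow>
     open \<Omega> \<and> connected \<Omega> \<and> \<Omega> \<noteq> {} \<and> bounded \<Omega> \<and> lipschitz_boundary \<Omega>"

definition caratheodory :: "'a::euclidean_space set \<Rightarrow> ('a \<Rightarrow> real \<Rightarrow> real) \<Rightarrow> bool" where
  "caratheodory \<Omega> f \<longleftrightarrow>
     (\<forall>t. (\<lambda>x. f x t) \<in> borel_measurable (lebesgue_on \<Omega>)) \<and>
     (AE x in lebesgue_on \<Omega>. continuous_on UNIV (f x))"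

text \<open>The interval integral is oriented, so this is also the right primitive for \<open>t < 0\<close>.\<close>
definition primitive :: "('a \<Rightarrow> real \<Rightarrow> real) \<Rightarrow> 'a \<Rightarrow> real \<Rightarrow> real" where
  "primitive f x t = (LBINT \<tau>=0..t. f x \<tau>)"

section \<open>Function spaces\<close>

definition Lp_space :: "real \<Rightarrow> 'a::euclidean_space set \<Rightarrow> ('a \<Rightarrow> real) set" where
  "Lp_space p A = {w. w \<in> borel_measurable (lebesgue_on A) \<and>
                      integrable (lebesgue_on A) (\<lambda>x. \<bar>w x\<bar> powr p)}"

definition Lp_norm :: "real \<Rightarrow> 'a::euclidean_space set \<Rightarrow> ('a \<Rightarrow> real) \<Rightarrow> real" where
  "Lp_norm p A w = (LINT x|lebesgue_on A. \<bar>w x\<bar> powr p) powr (1 / p)"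

definition Q_set :: "'a set \<Rightarrow> ('a \<times> 'a) set" where
  "Q_set \<Omega> = UNIV - ((- \<Omega>) \<times> (- \<Omega>))"

definition kernel :: "real \<Rightarrow> 'a::euclidean_space \<Rightarrow> 'a \<Rightarrow> real" where
  "kernel s x y = norm (x - y) powr (real DIM('a) + s)"

definition W0 :: "real \<Rightarrow> 'a::euclidean_space set \<Rightarrow> ('a \<Rightarrow> real) set" where
  "W0 s \<Omega> = {u. u \<in> Lp_space 1 \<Omega> \<and> (AE x in lebesgue. x \<notin> \<Omega> \<longrightarrow> u x = 0) \<and>
     integrable (lebesgue_on (Q_set \<Omega>)) (\<lambda>(x, y). \<bar>u x - u y\<bar> / kernel s x y)}"

definition W0_norm :: "real \<Rightarrow> 'a::euclidean_space set \<Rightarrow> ('a \<Rightarrow> real) \<Rightarrow> real" where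
  "W0_norm s \<Omega> u = (LINT (x, y)|lebesgue_on (Q_set \<Omega>). \<bar>u x - u y\<bar> / kernel s x y)"

section \<open>Energy and Nehari functionals\<close>

definition energy ::
  "real \<Rightarrow> 'a::euclidean_space set \<Rightarrow> ('a \<Rightarrow> real \<Rightarrow> real) \<Rightarrow> ('a \<Rightarrow> real) \<Rightarrow> real" where
  "energy s \<Omega> f u = W0_norm s \<Omega> u - (LINT x|lebesgue_on \<Omega>. primitive f x (u x))"

definition nehari_functional ::
  "real \<Rightarrow> 'a::euclidean_space set \<Rightarrow> ('a \<Rightarrow> real \<Rightarrow> real) \<Rightarrow> ('a \<Rightarrow> real) \<Rightarrow> real" where
  "nehari_functional s \<Omega> f u = W0_norm s \<Omega> u - (LINT x|lebesgue_on \<Omega>. f x (u x) * u x)"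

definition nehari_manifold ::
  "real \<Rightarrow> 'a::euclidean_space set \<Rightarrow> ('a \<Rightarrow> real \<Rightarrow> real) \<Rightarrow> ('a \<Rightarrow> real) set" where
  "nehari_manifold s \<Omega> f =
     {u \<in> W0 s \<Omega>. \<not> (AE x in lebesgue. u x = 0) \<and> nehari_functional s \<Omega> f u = 0}"

text \<open>Extended-real valued, so that no value has to be invented for an infimum over the empty set.\<close>
definition potential_depth ::
  "real \<Rightarrow> 'a::euclidean_space set \<Rightarrow> ('a \<Rightarrow> real \<Rightarrow> real) \<Rightarrow> ereal" where
  "potential_depth s \<Omega> f = (INF u \<in> nehari_manifold s \<Omega> f. ereal (energy s \<Omega> f u))"

section \<open>Time-dependent functions\<close>

text \<open>
  An element of \<open>L\<^sup>p(0,T;X)\<close>, for the separable function spaces \<open>X\<close> used here, is represented by a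
  jointly measurable function \<open>w t x\<close>; for such \<open>X\<close> this amounts to strong measurability of
  \<open>t \<mapsto> w t\<close>.
\<close>
definition jointly_measurable ::
  "real \<Rightarrow> 'a::euclidean_space set \<Rightarrow> (real \<Rightarrow> 'a \<Rightarrow> real) \<Rightarrow> bool" where
  "jointly_measurable T A w \<longleftrightarrow>
     (\<lambda>(t, x). w t x) \<in> borel_measurable (lebesgue_on ({0<..<T} \<times> A))"

text \<open>\<open>u \<in> L\<^sup>\<infinity>(0,T; W\<^sub>0\<^sup>s\<^sup>,\<^sup>1(\<Omega>) \<inter> L\<^sup>2(\<Omega>))\<close>, the intersection carrying the sum of the two norms.\<close>
definition Linf_W0_L2 ::
  "real \<Rightarrow> 'a::euclidean_space set \<Rightarrow> real \<Rightarrow> (real \<Rightarrow> 'a \<Rightarrow> real) \<Rightarrow> bool" where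
  "Linf_W0_L2 s \<Omega> T u \<longleftrightarrow>
     jointly_measurable T UNIV u \<and>
     (AE t in lebesgue_on {0<..<T}. u t \<in> W0 s \<Omega> \<inter> Lp_space 2 \<Omega>) \<and>
     (\<exists>K. AE t in lebesgue_on {0<..<T}. W0_norm s \<Omega> (u t) + Lp_norm 2 \<Omega> (u t) \<le> K)"

definition L2_L2 :: "'a::euclidean_space set \<Rightarrow> real \<Rightarrow> (real \<Rightarrow> 'a \<Rightarrow> real) \<Rightarrow> bool" where
  "L2_L2 \<Omega> T g \<longleftrightarrow>
     jointly_measurable T \<Omega> g \<and>
     (AE t in lebesgue_on {0<..<T}. g t \<in> Lp_space 2 \<Omega>) \<and>
     integrable (lebesgue_on {0<..<T}) (\<lambda>t. (Lp_norm 2 \<Omega> (g t))\<^sup>2)"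

text \<open>\<open>u \<in> C([0,T]; L\<^sup>\<kappa>(\<Omega>))\<close>\<close>
definition continuous_Lp ::
  "real \<Rightarrow> 'a::euclidean_space set \<Rightarrow> real \<Rightarrow> (real \<Rightarrow> 'a \<Rightarrow> real) \<Rightarrow> bool" where
  "continuous_Lp \<kappa> \<Omega> T u \<longleftrightarrow>
     (\<forall>t\<in>{0..T}. u t \<in> Lp_space \<kappa> \<Omega> \<and>
        ((\<lambda>\<tau>. Lp_norm \<kappa> \<Omega> (\<lambda>x. u \<tau> x - u t x)) \<longlongrightarrow> 0) (at t within {0..T}))"

text \<open>\<open>\<psi> \<in> C\<^sub>c\<^sup>\<infinity>(0,T)\<close>\<close>
definition test_function :: "real \<Rightarrow> (real \<Rightarrow> real) \<Rightarrow> bool" where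
  "test_function T \<psi> \<longleftrightarrow>
     (\<forall>n t. (deriv ^^ n) \<psi> differentiable (at t)) \<and> closure {t. \<psi> t \<noteq> 0} \<subseteq> {0<..<T}"

text \<open>
  \<open>u\<^sub>t = g\<close> in the sense of vector-valued distributions: \<open>\<integral> \<psi>'(t) u(t) dt = - \<integral> \<psi>(t) g(t) dt\<close> in
  \<open>L\<^sup>2(\<Omega>)\<close> for all test functions \<open>\<psi>\<close> on \<open>(0,T)\<close>.  For jointly measurable representatives, these
  Bochner integrals are computed pointwise for almost every \<open>x\<close>.
\<close>
definition has_weak_time_derivative ::
  "'a::euclidean_space set \<Rightarrow> real \<Rightarrow> (real \<Rightarrow> 'a \<Rightarrow> real) \<Rightarrow> (real \<Rightarrow> 'a \<Rightarrow> real) \<Rightarrow> bool" where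
  "has_weak_time_derivative \<Omega> T u g \<longleftrightarrow>
     (\<forall>\<psi>. test_function T \<psi> \<longrightarrow>
        (AE x in lebesgue_on \<Omega>.
           (LINT t|lebesgue_on {0<..<T}. deriv \<psi> t * u t x) =
           - (LINT t|lebesgue_on {0<..<T}. \<psi> t * g t x)))"

section \<open>Weak and strong solutions\<close>

definition msign :: "real \<Rightarrow> real set" where
  "msign a = (if a > 0 then {1} else if a < 0 then {- 1} else {- 1..1})"

text \<open>
  The field \<open>\<eta>(x,y,t)\<close> (written \<open>\<eta> t x y\<close>) through which \<open>(-\<Delta>)\<^sub>1\<^sup>s u\<close> is interpreted.
\<close>
definition sign_field ::
  "real \<Rightarrow> (real \<Rightarrow> 'a::euclidean_space \<Rightarrow> real) \<Rightarrow> (real \<Rightarrow> 'a \<Rightarrow> 'a \<Rightarrow> real) \<Rightarrow> bool" where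
  "sign_field T u \<eta> \<longleftrightarrow>
     (AE t in lebesgue_on {0..T}.
        (\<lambda>(x, y). \<eta> t x y) \<in> borel_measurable lebesgue \<and>
        (AE (x, y) in lebesgue. \<bar>\<eta> t x y\<bar> \<le> 1) \<and>
        (AE (x, y) in lebesgue. \<eta> t x y = - \<eta> t y x)) \<and>
     (AE (x, y, t) in lebesgue_on (UNIV \<times> UNIV \<times> {0..T}). \<eta> t x y \<in> msign (u t x - u t y))"

text \<open>\<open>u\<close> is a weak solution of the problem on \<open>(0,T)\<close> with initial datum \<open>u0\<close> and \<open>u\<^sub>t = g\<close>.\<close>
definition weak_solution_with ::
  "real \<Rightarrow> 'a::euclidean_space set \<Rightarrow> ('a \<Rightarrow> real \<Rightarrow> real) \<Rightarrow> ('a \<Rightarrow> real) \<Rightarrow> real \<Rightarrow>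
   (real \<Rightarrow> 'a \<Rightarrow> real) \<Rightarrow> (real \<Rightarrow> 'a \<Rightarrow> real) \<Rightarrow> bool" where
  "weak_solution_with s \<Omega> f u0 T u g \<longleftrightarrow>
     Linf_W0_L2 s \<Omega> T u \<and> L2_L2 \<Omega> T g \<and> has_weak_time_derivative \<Omega> T u g \<and>
     (AE x in lebesgue_on \<Omega>. u 0 x = u0 x) \<and>
     (\<exists>\<eta>. sign_field T u \<eta> \<and>
        (\<forall>\<phi> \<in> W0 s \<Omega> \<inter> Lp_space 2 \<Omega>. AE t in lebesgue_on {0..T}.
           (LINT x|lebesgue_on \<Omega>. g t x * \<phi> x) +
           (LINT (x, y)|lebesgue_on (Q_set \<Omega>). \<eta> t x y * ((\<phi> x - \<phi> y) / kernel s x y)) =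
           (LINT x|lebesgue_on \<Omega>. f x (u t x) * \<phi> x))) \<and>
     (\<forall>\<kappa>. 1 \<le> \<kappa> \<and> \<kappa> < real DIM('a) / (real DIM('a) - s) \<longrightarrow> continuous_Lp \<kappa> \<Omega> T u) \<and>
     (AE t in lebesgue_on {0..<T}.
        (LINT \<tau>|lebesgue_on {0..t}. (Lp_norm 2 \<Omega> (g \<tau>))\<^sup>2) + energy s \<Omega> f (u t) \<le> energy s \<Omega> f u0)"

definition weak_solution ::
  "real \<Rightarrow> 'a::euclidean_space set \<Rightarrow> ('a \<Rightarrow> real \<Rightarrow> real) \<Rightarrow> ('a \<Rightarrow> real) \<Rightarrow> real \<Rightarrow>
   (real \<Rightarrow> 'a \<Rightarrow> real) \<Rightarrow> bool" where
  "weak_solution s \<Omega> f u0 T u \<longleftrightarrow> (\<exists>g. weak_solution_with s \<Omega> f u0 T u g)"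

text \<open>
  The requirement \<open>u t \<in> W0 s \<Omega>\<close> for every \<open>t\<close> gives \<open>energy s \<Omega> f (u t)\<close> its meaning: the energy is
  a functional on \<open>W0 s \<Omega>\<close>, and a weak solution is known to lie there only for almost every \<open>t\<close>.
\<close>
definition strong_solution ::
  "real \<Rightarrow> 'a::euclidean_space set \<Rightarrow> ('a \<Rightarrow> real \<Rightarrow> real) \<Rightarrow> ('a \<Rightarrow> real) \<Rightarrow> real \<Rightarrow>
   (real \<Rightarrow> 'a \<Rightarrow> real) \<Rightarrow> bool" where
  "strong_solution s \<Omega> f u0 T u \<longleftrightarrow>
     (\<exists>g. weak_solution_with s \<Omega> f u0 T u g \<and>
        (\<forall>t\<in>{0..<T}. u t \<in> W0 s \<Omega> \<and>
           (LINT \<tau>|lebesgue_on {0..t}. (Lp_norm 2 \<Omega> (g \<tau>))\<^sup>2) + energy s \<Omega> f (u t) =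
           energy s \<Omega> f (u 0)))"

end

theory Submission
  imports Defs
begin

text \<open>
  Testing the equations of two solutions \<open>u\<close>, \<open>v\<close> with \<open>w = u - v\<close> at time \<open>t\<close>, the nonlocal terms
  contribute \<open>(\<eta> - \<xi>) (w(x) - w(y)) \<ge> 0\<close> because the multivalued sign is monotone, and the Lipschitz
  condition bounds the right-hand side by \<open>L \<parallel>w\<parallel>\<^sup>2\<close>.  Hence \<open>\<parallel>w(t)\<parallel>\<^sup>2 \<le> 2 L \<integral>\<^sub>0\<^sup>t \<parallel>w\<parallel>\<^sup>2\<close>, and \<open>w = 0\<close> by
  Gronwall.  Two points need care.  The exceptional null set of times in the weak formulation depends
  on the test function; as \<open>W0 \<inter> L\<^sup>2\<close> is separable, a common null set can be chosen.  The energy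
  identity for \<open>\<parallel>w(t)\<parallel>\<^sup>2\<close> is obtained by writing \<open>w(t,x) = \<integral>\<^sub>0\<^sup>t w\<^sub>t(\<tau>,x) d\<tau>\<close> for every \<open>t\<close> and almost
  every \<open>x\<close>, which follows from the scalar du Bois-Reymond lemma applied to \<open>t \<mapsto> \<integral> w(t,x) \<phi>(x) dx\<close>,
  continuous since \<open>w \<in> C([0,T]; L\<^sup>1)\<close>.
\<close>

section \<open>Smooth step functions\<close>

text \<open>The du Bois-Reymond lemma cannot be applied for fixed x: the null set of points in
  \<open>has_weak_time_derivative\<close> depends on the test function, and t \<mapsto> w(t,x) need
  not be continuous. Pairing with a bounded \<phi> removes both obstacles, since \<phi> may be
  chosen after t; the sign of the difference of the two sides turns equality of pairings into
  equality almost everywhere. The test function w(t) changes with t, which is why a common null set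
  of times is needed. Separability is inherited from L^1: \<phi> is sent to its difference quotient
  and its signed square, and the weak form is continuous in the resulting distances. The energy
  identity is the square of an indefinite integral for almost every x, split along the diagonal by
  Fubini, so that no differentiability of the L^2 norm in time is used. Fubini concerns products of
  \<open>lborel\<close>, while the definitions speak of the completed measure; hence u and its time
  derivative are first replaced by Borel functions of (t,x). Finally f(x,0) = 0, read off the growth
  bound, and the Lipschitz condition keep f(x,u) in L^2.\<close>

primrec differentiable_upto :: "nat \<Rightarrow> (real \<Rightarrow> real) \<Rightarrow> bool" where
  "differentiable_upto 0 f \<longleftrightarrow> True"
| "differentiable_upto (Suc n) f \<longleftrightarrow>
     (\<exists>f'. (\<forall>x. (f has_real_derivative f' x) (at x)) \<and> differentiable_upto n f')"

lemma differentiable_upto_SucI: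
  "(\<And>x. (f has_real_derivative f' x) (at x)) \<Longrightarrow> differentiable_upto n f' \<Longrightarrow>
    differentiable_upto (Suc n) f"
  by auto

lemma differentiable_upto_SucD: "differentiable_upto (Suc n) f \<Longrightarrow> differentiable_upto n f"
  by (induction n arbitrary: f) auto

lemma differentiable_upto_const: "differentiable_upto n (\<lambda>x. c)"
proof (induction n arbitrary: c)
  case (Suc n)
  show ?case by (rule differentiable_upto_SucI[OF _ Suc[of 0]]) simp
qed simp

lemma differentiable_upto_add:
  assumes "differentiable_upto n f" "differentiable_upto n g"
  shows "differentiable_upto n (\<lambda>x. f x + g x)"
  using assms
proof (induction n arbitrary: f g)
  case (Suc n)
  then obtain f' g' where
    "\<forall>x. (f has_real_derivative f' x) (at x)" "differentiable_upto n f'"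
    "\<forall>x. (g has_real_derivative g' x) (at x)" "differentiable_upto n g'" by auto
  then show ?case using Suc.IH[of f' g']
    by (auto intro!: exI[of _ "\<lambda>x. f' x + g' x"] derivative_eq_intros)
qed simp

lemma differentiable_upto_mult:
  assumes "differentiable_upto n f" "differentiable_upto n g"
  shows "differentiable_upto n (\<lambda>x. f x * g x)"
  using assms
proof (induction n arbitrary: f g)
  case (Suc n)
  then obtain f' g' where
    d: "\<forall>x. (f has_real_derivative f' x) (at x)" "differentiable_upto n f'"
    "\<forall>x. (g has_real_derivative g' x) (at x)" "differentiable_upto n g'" by auto
  \<comment> \<open>Each Leibniz term keeps one factor undifferentiated;
    \<open>differentiable_upto_SucD\<close> lowers the order of that factor to n.\<close>
  have "differentiable_upto n (\<lambda>x. f' x * g x + f x * g' x)"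
    using Suc.IH d Suc.prems differentiable_upto_SucD differentiable_upto_add by presburger
  then show ?case using d
    by (auto intro!: exI[of _ "\<lambda>x. f' x * g x + f x * g' x"] derivative_eq_intros)
qed simp

lemma differentiable_upto_affine:
  assumes "differentiable_upto n f"
  shows "differentiable_upto n (\<lambda>x. f (a + b * x))"
  using assms
proof (induction n arbitrary: f)
  case (Suc n)
  then obtain f' where
    d: "\<forall>x. (f has_real_derivative f' x) (at x)" "differentiable_upto n f'" by auto
  have "differentiable_upto n (\<lambda>x. b * f' (a + b * x))"
    by (intro differentiable_upto_mult differentiable_upto_const Suc.IH d)
  moreover have "((\<lambda>x. f (a + b * x)) has_real_derivative b * f' (a + b * x)) (at x)" for x
    by (rule DERIV_cong[OF DERIV_chain2[OF d(1)[rule_format]]]) (auto intro!: derivative_eq_intros)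
  ultimately show ?case by (rule differentiable_upto_SucI[rotated])
qed simp

text \<open>The existential witnesses in \<open>differentiable_upto\<close> make sums, products and
  affine substitutions plain inductions, with no formula for iterated \<open>deriv\<close>.
  Uniqueness of the derivative identifies the witness with \<open>deriv g\<close>, which gives the
  form that \<open>test_function\<close> asks for.\<close>

lemma iterated_deriv_differentiable:
  assumes "\<And>n. differentiable_upto n f"
  shows "(deriv ^^ n) f differentiable (at t)"
proof -
  have deriv: "differentiable_upto m (deriv g)" if "differentiable_upto (Suc m) g" for m g
  proof -
    from that obtain g' where g': "\<forall>x. (g has_real_derivative g' x) (at x)" "differentiable_upto m g'"
      by auto
    then have "deriv g = g'" by (auto simp: DERIV_imp_deriv)
    with g' show ?thesis by simp
  qed
  then have "differentiable_upto m ((deriv ^^ n) f)" for m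
    using assms by (induction n arbitrary: m) (simp_all add: deriv del: differentiable_upto.simps)
  from this[of "Suc 0"] show ?thesis by (auto simp: real_differentiable_def)
qed

text \<open>The powers of 1/x are carried along because the family is closed under differentiation:
  the derivative of member k combines members k + 2 and k + 1. Smoothness of e^(-1/x) then follows
  by induction on the order, for all k at once.\<close>

definition flat_exp :: "nat \<Rightarrow> real \<Rightarrow> real" where
  "flat_exp k x = (if x > 0 then (1 / x) ^ k * exp (- (1 / x)) else 0)"

lemma tendsto_flat_exp_0: "(flat_exp k \<longlongrightarrow> 0) (at 0)"
proof (rule filterlim_split_at)
  have "\<forall>\<^sub>F x in at_left 0. flat_exp k x = 0"
    by (auto simp: eventually_at_filter flat_exp_def)
  then show "(flat_exp k \<longlongrightarrow> 0) (at_left 0)" by (simp add: tendsto_eventually)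
  have "((\<lambda>x. inverse x ^ k / exp (inverse x)) \<longlongrightarrow> (0::real)) (at_right 0)"
    by (rule filterlim_compose[OF tendsto_power_div_exp_0 filterlim_inverse_at_top_right])
  moreover have "\<forall>\<^sub>F x in at_right 0. inverse x ^ k / exp (inverse x) = flat_exp k x"
    by (auto simp: eventually_at_filter flat_exp_def exp_minus divide_simps)
  ultimately show "(flat_exp k \<longlongrightarrow> 0) (at_right 0)" by (rule Lim_transform_eventually)
qed

lemma DERIV_flat_exp:
  "(flat_exp k has_real_derivative (flat_exp (k + 2) x - real k * flat_exp (k + 1) x)) (at x)"
proof -
  consider "x < 0" | "x = 0" | "x > 0" by linarith
  then show ?thesis
  proof cases
    case 1
    have "((\<lambda>x. 0) has_real_derivative 0) (at x)" by simp
    then have "(flat_exp k has_real_derivative 0) (at x)"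
      by (rule has_field_derivative_transform_within_open[where S = "{..<0}"])
        (use 1 in \<open>auto simp: flat_exp_def\<close>)
    with 1 show ?thesis by (simp add: flat_exp_def)
  next
    case 2
    \<comment> \<open>As \<open>flat_exp k 0 = 0\<close>, the difference quotient at 0 is itself a
      member of the family, and its limit is already known.\<close>
    have "flat_exp k h / h = flat_exp (Suc k) h" for h
      by (simp add: flat_exp_def)
    moreover have "flat_exp j 0 = 0" for j by (simp add: flat_exp_def)
    ultimately show ?thesis
      using tendsto_flat_exp_0[of "Suc k"] 2 by (simp add: DERIV_def)
  next
    case 3
    have h: "((\<lambda>x. 1 / x) has_real_derivative - ((1 / x) ^ 2)) (at x)"
      using 3 by (auto intro!: derivative_eq_intros simp: power2_eq_square)
    have "((\<lambda>x. (1 / x) ^ k * exp (- (1 / x))) has_real_derivative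
        (1 / x) ^ (k + 2) * exp (- (1 / x)) - real k * ((1 / x) ^ (k + 1) * exp (- (1 / x)))) (at x)"
      by (rule DERIV_cong[OF DERIV_mult[OF DERIV_power[OF h] DERIV_fun_exp[OF DERIV_minus[OF h]]]])
        (cases k; simp add: algebra_simps power2_eq_square)
    then have "(flat_exp k has_real_derivative
        (1 / x) ^ (k + 2) * exp (- (1 / x)) - real k * ((1 / x) ^ (k + 1) * exp (- (1 / x)))) (at x)"
      by (rule has_field_derivative_transform_within_open[where S = "{0<..}"])
        (use 3 in \<open>auto simp: flat_exp_def\<close>)
    with 3 show ?thesis by (simp add: flat_exp_def)
  qed
qed

lemma differentiable_upto_flat_exp: "differentiable_upto n (flat_exp k)"
proof (induction n arbitrary: k)
  case (Suc n)
  have "differentiable_upto n (\<lambda>x. flat_exp (k + 2) x + (- real k) * flat_exp (k + 1) x)"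
    by (intro differentiable_upto_add differentiable_upto_mult differentiable_upto_const Suc.IH)
  moreover have "(flat_exp k has_real_derivative
      (flat_exp (k + 2) x + (- real k) * flat_exp (k + 1) x)) (at x)" for x
    using DERIV_flat_exp[of k x] by simp
  ultimately show ?case by (rule differentiable_upto_SucI[rotated])
qed simp

text \<open>On (-1,1) this is exp(-2 / (1 - x^2)), the standard mollifier without normalisation. The
  product form reduces smoothness to affine substitution and the product rule.\<close>

definition bump :: "real \<Rightarrow> real" where
  "bump x = flat_exp 0 (1 + x) * flat_exp 0 (1 - x)"

lemma bump_nonneg: "0 \<le> bump x"
  and bump_eq_0: "1 \<le> \<bar>x\<bar> \<Longrightarrow> bump x = 0"
  and bump_pos: "\<bar>x\<bar> < 1 \<Longrightarrow> 0 < bump x"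
  by (auto simp: bump_def flat_exp_def abs_if split: if_splits)

lemma bump_le_1: "bump x \<le> 1"
proof -
  have "flat_exp 0 y \<le> 1" "0 \<le> flat_exp 0 y" for y by (auto simp: flat_exp_def)
  then show ?thesis unfolding bump_def by (metis mult_le_one)
qed

lemma differentiable_upto_bump: "differentiable_upto n bump"
proof -
  have "differentiable_upto n (\<lambda>x. flat_exp 0 (1 + 1 * x) * flat_exp 0 (1 + (- 1) * x))"
    by (intro differentiable_upto_mult differentiable_upto_affine differentiable_upto_flat_exp)
  then show ?thesis by (simp add: bump_def[abs_def])
qed

lemma continuous_on_bump: "continuous_on S bump"
proof -
  obtain b' where "\<forall>x. (bump has_real_derivative b' x) (at x)"
    using differentiable_upto_bump[of 1] by auto
  then show ?thesis
    by (metis DERIV_isCont continuous_at_imp_continuous_on)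
qed

text \<open>The antiderivative of \<open>bump\<close> vanishes before its support and is constant
  after it. Its height, the mass of \<open>bump\<close>, is not normalised; it reappears as the
  constant c in \<open>weak_derivative_imp_integral\<close>.\<close>

lemma smooth_step_exists:
  obtains R where "\<And>n. differentiable_upto n R" "\<And>x. (R has_real_derivative bump x) (at x)"
    "\<And>x. x \<le> -1 \<Longrightarrow> R x = 0" "\<And>x. 1 \<le> x \<Longrightarrow> R x = integral {-1..1} bump"
    "\<And>x. 0 \<le> R x" "\<And>x. R x \<le> integral {-1..1} bump" "0 < integral {-1..1} bump"
proof -
  have intg: "bump integrable_on {a..b}" for a b
    by (intro integrable_continuous_real continuous_on_bump)
  define R where "R x = integral {-1..x} bump" for x
  have z1: "R x = 0" if "x \<le> -1" for x
    using that by (cases "x = -1") (auto simp: R_def)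
  have z2: "R x = integral {-1..1} bump" if "1 \<le> x" for x
  proof -
    have "R x = integral {-1..1} bump + integral {1..x} bump"
      unfolding R_def by (rule Henstock_Kurzweil_Integration.integral_combine[symmetric])
        (use that intg in auto)
    moreover have "integral {1..x} bump = integral {1..x} (\<lambda>_. 0)"
      by (rule Henstock_Kurzweil_Integration.integral_cong) (auto simp: bump_eq_0)
    ultimately show ?thesis by simp
  qed
  have DR: "(R has_real_derivative bump x) (at x)" for x
  proof (cases "x < -1")
    case True
    have "((\<lambda>x. 0) has_real_derivative 0) (at x)" by simp
    then have "(R has_real_derivative 0) (at x)"
      by (rule has_field_derivative_transform_within_open[where S = "{..<-1}"])
        (use True z1 in auto)
    with True show ?thesis by (simp add: bump_eq_0)
  next
    case False
    \<comment> \<open>Starting at -2 rather than -1 puts every x \<ge> -1 in the interior of the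
      interval, so that the derivative within it is a two-sided one.\<close>
    have "((\<lambda>x. integral {-2..x} bump) has_real_derivative bump x) (at x within {-2..x+1})"
      by (rule integral_has_real_derivative) (use False in \<open>auto intro: continuous_on_bump\<close>)
    then have "((\<lambda>x. integral {-2..x} bump) has_real_derivative bump x) (at x)"
      using False by (simp add: at_within_Icc_at)
    moreover have "integral {-2..y} bump = R y" for y
    proof (cases "y \<le> -1")
      case True
      have "integral {-2..y} bump = integral {-2..y} (\<lambda>_. 0)"
        by (rule Henstock_Kurzweil_Integration.integral_cong) (use True in \<open>auto simp: bump_eq_0\<close>)
      with z1 True show ?thesis by simp
    next
      case False
      have "integral {-2..y} bump = integral {-2..-1} bump + R y"
        unfolding R_def by (rule Henstock_Kurzweil_Integration.integral_combine[symmetric])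
          (use False intg in auto)
      moreover have "integral {-2..-1} bump = integral {-2..-1::real} (\<lambda>_. 0)"
        by (rule Henstock_Kurzweil_Integration.integral_cong) (auto simp: bump_eq_0)
      ultimately show ?thesis by simp
    qed
    ultimately show ?thesis by simp
  qed
  have mono: "R x \<le> R y" if "x \<le> y" for x y
    by (rule DERIV_nonneg_imp_nondecreasing[OF that]) (use DR bump_nonneg in blast)
  have "R (-1) < R 1"
  proof -
    have "R 0 < R 1"
    proof -
      obtain z where "0 < z" "z < 1" "R 1 - R 0 = (1 - 0) * bump z"
        using MVT2[of 0 1 R bump] DR by auto
      with bump_pos[of z] show ?thesis by auto
    qed
    with mono[of "-1" 0] show ?thesis by simp
  qed
  then have pos: "0 < integral {-1..1} bump" using z1 z2 by simp
  have "differentiable_upto n R" for n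
    using DR differentiable_upto_bump by (cases n) auto
  moreover have "0 \<le> R x" for x
    using mono[of "-1" x] z1[of x] z1[of "-1"] by (cases "x \<le> -1") auto
  moreover have "R x \<le> integral {-1..1} bump" for x
    using mono[of x 1] z2[of x] z2[of 1] by (cases "x \<ge> 1") auto
  ultimately show ?thesis using that[of R] DR z1 z2 pos by blast
qed

section \<open>Approximate identities and the du Bois-Reymond lemma\<close>

lemma rescaled_bump_tendsto:
  fixes m :: "real \<Rightarrow> real"
  assumes m: "m \<in> borel_measurable borel" and bd: "\<And>t. \<bar>m t\<bar> \<le> B" and cont: "isCont m a"
  shows "(\<lambda>j. LBINT t. real (Suc j) * bump ((t - a) * real (Suc j)) * m t) \<longlonglongrightarrow>
    integral {-1..1} bump * m a"
proof -
  have bm[measurable]: "bump \<in> borel_measurable borel"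
    by (intro borel_measurable_continuous_onI continuous_on_bump)
  have bi: "set_integrable lborel {-1..1} bump"
    unfolding set_integrable_def
    by (rule borel_integrable_compact) (auto intro: continuous_on_bump)
  have ind: "indicator {-1..1} x *\<^sub>R bump x = bump x" for x
    using bump_eq_0[of x] by (cases "\<bar>x\<bar> \<le> 1") (auto simp: indicator_def)
  have int: "integrable lborel bump" and val: "(LBINT x. bump x) = integral {-1..1} bump"
    using bi set_borel_integral_eq_integral(2)[OF bi]
    by (simp_all only: set_integrable_def set_lebesgue_integral_def ind)
  \<comment> \<open>Substituting t = a + y / (j + 1) moves the scaling from \<open>bump\<close> into
    m. The Jacobian absorbs the factor j + 1, so the dominating function \<open>bump y * B\<close>
    is free of j.\<close>
  have sub: "(LBINT t. real (Suc j) * bump ((t - a) * real (Suc j)) * m t) =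
      (LBINT y. bump y * m (a + (1 / real (Suc j)) * y))" for j
    by (subst lborel_integral_real_affine[of "1 / real (Suc j)" _ a])
      (simp_all flip: Bochner_Integration.integral_mult_right_zero
       add: Bochner_Integration.integral_mult_right_zero field_simps del: of_nat_Suc)
  note m[measurable]
  have "(\<lambda>j. LBINT y. bump y * m (a + (1 / real (Suc j)) * y)) \<longlonglongrightarrow> (LBINT y. bump y * m a)"
  proof (rule integral_dominated_convergence[where w = "\<lambda>y. bump y * B"])
    show "AE y in lborel. (\<lambda>j. bump y * m (a + (1 / real (Suc j)) * y)) \<longlonglongrightarrow> bump y * m a"
    proof (rule AE_I2, intro tendsto_intros isCont_tendsto_compose[OF cont])
      fix y :: real
      have "(\<lambda>j. a + inverse (real (Suc j)) * y) \<longlonglongrightarrow> a + 0 * y"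
        by (intro tendsto_intros LIMSEQ_inverse_real_of_nat)
      then show "(\<lambda>j. a + 1 / real (Suc j) * y) \<longlonglongrightarrow> a" by (simp add: inverse_eq_divide)
    qed
    show "AE y in lborel. norm (bump y * m (a + (1 / real (Suc j)) * y)) \<le> bump y * B" for j
      using bd bump_nonneg by (auto simp: abs_mult intro!: mult_left_mono)
  qed (use int in auto)
  then show ?thesis unfolding sub using val by (simp del: of_nat_Suc)
qed

text \<open>Smoothed indicators of (a,b) serve as test functions: their derivatives are approximate
  identities at a and b with opposite signs, so the weak identity tends to m a - m b = - \<integral>
  n over (a,b). Hence m minus the primitive of n is constant inside, and continuity reaches the
  endpoints.\<close>

lemma weak_derivative_imp_integral:
  fixes m n :: "real \<Rightarrow> real"
  assumes cont: "continuous_on {0..T} m" and n: "integrable lborel n"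
    and weak: "\<And>\<psi>. test_function T \<psi> \<Longrightarrow>
      (LBINT t:{0<..<T}. deriv \<psi> t * m t) = - (LBINT t:{0<..<T}. \<psi> t * n t)"
    and t: "t \<in> {0..T}"
  shows "m t = m 0 + (LBINT \<tau>:{0..t}. n \<tau>)"
proof -
  obtain R where R: "\<And>n. differentiable_upto n R" "\<And>x. (R has_real_derivative bump x) (at x)"
    "\<And>x. x \<le> -1 \<Longrightarrow> R x = 0" "\<And>x. 1 \<le> x \<Longrightarrow> R x = integral {-1..1} bump"
    "\<And>x. 0 \<le> R x" "\<And>x. R x \<le> integral {-1..1} bump" "0 < integral {-1..1} bump"
    using smooth_step_exists by blast
  define c where "c = integral {-1..1} bump"
  have c: "c > 0" using R(7) by (simp add: c_def)
  note [measurable] = borel_measurable_integrable[OF n]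
  have [measurable]: "R \<in> borel_measurable borel"
    by (intro borel_measurable_continuous_onI continuous_at_imp_continuous_on ballI DERIV_isCont[OF R(2)])
  have [measurable]: "bump \<in> borel_measurable borel"
    by (intro borel_measurable_continuous_onI continuous_on_bump)
  have "bounded (m ` {0..T})" by (intro compact_imp_bounded compact_continuous_image cont) auto
  then obtain B where B: "\<And>t. t \<in> {0..T} \<Longrightarrow> \<bar>m t\<bar> \<le> B"
    unfolding bounded_iff by (metis image_eqI real_norm_def)
  \<comment> \<open>\<open>rescaled_bump_tendsto\<close> works on the whole line; cutting m off
    outside (0,T) keeps it bounded and Borel, and continuous at interior points.\<close>
  define mt where "mt t = indicator {0<..<T} t *\<^sub>R m t" for t
  have mt_meas: "mt \<in> borel_measurable borel"
    unfolding mt_def[abs_def]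
    by (intro borel_measurable_continuous_on_indicator continuous_on_subset[OF cont]) auto
  have inter: "m b - m a = (LBINT t:{a<..<b}. n t)" if ab: "0 < a" "a < b" "b < T" for a b
  proof -
    have mb: "\<bar>mt t\<bar> \<le> B" for t using B[of t] B[of a] ab
      by (auto simp: mt_def indicator_def)
    have mc: "isCont mt x" if "0 < x" "x < T" for x
    proof -
      have "isCont m x" using cont that continuous_on_interior by fastforce
      moreover have "\<forall>\<^sub>F y in nhds x. m y = mt y"
        using that by (auto simp: eventually_nhds mt_def intro!: exI[of _ "{0<..<T}"])
      ultimately show ?thesis using isCont_cong by blast
    qed
    \<comment> \<open>Two steps with transition layers of half-width 1 / (j + 1), centred at a and
      b; dividing by the mass c gives a plateau of height 1 between them.\<close>
    define \<psi> where "\<psi> j t = (R ((t - a) * real (Suc j)) - R ((t - b) * real (Suc j))) / c" for j t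
    have d\<psi>: "(\<psi> j has_real_derivative (real (Suc j) * bump ((t - a) * real (Suc j)) -
        real (Suc j) * bump ((t - b) * real (Suc j))) / c) (at t)" for j t
      unfolding \<psi>_def using c
      by (auto intro!: derivative_eq_intros DERIV_chain2[OF R(2)] simp del: of_nat_Suc)
    have smooth: "differentiable_upto k (\<psi> j)" for k j
    proof -
      have "differentiable_upto k (\<lambda>t. (1 / c) * (R (- a * real (Suc j) + real (Suc j) * t) +
          (- 1) * R (- b * real (Suc j) + real (Suc j) * t)))"
        by (intro differentiable_upto_mult differentiable_upto_const differentiable_upto_add
            differentiable_upto_affine R)
      then show ?thesis by (simp add: \<psi>_def[abs_def] algebra_simps diff_divide_distrib)
    qed
    have supp: "\<psi> j t = 0" if "t \<notin> {a - 1 / real (Suc j)..b + 1 / real (Suc j)}" for j t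
    proof -
      have "t < a - 1 / real (Suc j) \<or> b + 1 / real (Suc j) < t" using that by auto
      then show ?thesis
      proof
        assume "t < a - 1 / real (Suc j)"
        then have "(t - a) * real (Suc j) \<le> -1"
          by (simp add: field_simps del: of_nat_Suc)
        moreover have "(t - b) * real (Suc j) \<le> (t - a) * real (Suc j)"
          using ab by (intro mult_right_mono) auto
        ultimately have "R ((t - a) * real (Suc j)) = 0" "R ((t - b) * real (Suc j)) = 0"
          by (intro R(3); linarith)+
        then show ?thesis by (simp only: \<psi>_def) simp
      next
        assume "b + 1 / real (Suc j) < t"
        then have "(t - b) * real (Suc j) \<ge> 1"
          by (simp add: field_simps del: of_nat_Suc)
        moreover have "(t - b) * real (Suc j) \<le> (t - a) * real (Suc j)"
          using ab by (intro mult_right_mono) auto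
        ultimately have "R ((t - a) * real (Suc j)) = c" "R ((t - b) * real (Suc j)) = c"
          unfolding c_def by (intro R(4); linarith)+
        then show ?thesis by (simp only: \<psi>_def) simp
      qed
    qed
    have "(\<lambda>j. 1 / real (Suc j)) \<longlonglongrightarrow> 0"
      using LIMSEQ_inverse_real_of_nat by (simp add: inverse_eq_divide)
    \<comment> \<open>Since a and T - b are positive, both layers eventually lie inside (0,T). Only
      those j give test functions, which is enough for the limit.\<close>
    then have "\<forall>\<^sub>F j in sequentially. 1 / real (Suc j) < min a (T - b)"
      by (rule order_tendstoD) (use ab in auto)
    then have test: "\<forall>\<^sub>F j in sequentially. test_function T (\<psi> j)"
    proof eventually_elim
      case (elim j)
      have "closure {t. \<psi> j t \<noteq> 0} \<subseteq> {a - 1 / real (Suc j)..b + 1 / real (Suc j)}"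
        by (rule closure_minimal) (use supp in blast)+
      also have "\<dots> \<subseteq> {0<..<T}" using elim by auto
      finally show ?case
        using iterated_deriv_differentiable[OF smooth] by (auto simp: test_function_def)
    qed
    define A where "A x j = (LBINT t. real (Suc j) * bump ((t - x) * real (Suc j)) * mt t)" for x j
    have lim: "A x \<longlonglongrightarrow> c * mt x" if "0 < x" "x < T" for x
      unfolding A_def[abs_def] c_def using rescaled_bump_tendsto[OF mt_meas mb mc[OF that]] .
    have mti: "integrable lborel (\<lambda>t. real (Suc j) * bump ((t - x) * real (Suc j)) * mt t)" for x j
    proof (rule Bochner_Integration.integrable_bound)
      show "integrable lborel (\<lambda>t. real (Suc j) * B * indicator {x-1..x+1} t)" by simp
      show "AE t in lborel. norm (real (Suc j) * bump ((t - x) * real (Suc j)) * mt t) \<le>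
        norm (real (Suc j) * B * indicator {x-1..x+1} t)"
      proof (rule AE_I2)
        fix t
        have "bump ((t - x) * real (Suc j)) * \<bar>mt t\<bar> \<le> 1 * B * indicator {x-1..x+1} t"
        proof (cases "t \<in> {x-1..x+1}")
          case True
          then show ?thesis using mult_mono[OF bump_le_1 mb zero_le_one abs_ge_zero] by simp
        next
          case False
          then have "1 * 1 \<le> \<bar>t - x\<bar> * \<bar>real (Suc j)\<bar>" by (intro mult_mono) auto
          then have "1 \<le> \<bar>(t - x) * real (Suc j)\<bar>" by (simp only: abs_mult)
          then show ?thesis using False by (simp add: bump_eq_0)
        qed
        then have "real (Suc j) * (bump ((t - x) * real (Suc j)) * \<bar>mt t\<bar>) \<le>
           real (Suc j) * (1 * B * indicator {x-1..x+1} t)" by (rule mult_left_mono) simp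
        moreover have "0 \<le> B" using mb[of 0] by linarith
        ultimately show "norm (real (Suc j) * bump ((t - x) * real (Suc j)) * mt t) \<le>
          norm (real (Suc j) * B * indicator {x-1..x+1} t)"
          using bump_nonneg by (simp add: abs_mult mult.assoc del: of_nat_Suc)
      qed
    qed (use mt_meas in measurable)
    have lhs: "(LBINT t:{0<..<T}. deriv (\<psi> j) t * m t) = (A a j - A b j) / c" for j
    proof -
      have "indicator {0<..<T} t *\<^sub>R (deriv (\<psi> j) t * m t) =
         (real (Suc j) * bump ((t - a) * real (Suc j)) * mt t -
          real (Suc j) * bump ((t - b) * real (Suc j)) * mt t) / c" for t
        by (simp add: DERIV_imp_deriv[OF d\<psi>] mt_def diff_divide_distrib algebra_simps)
      then show ?thesis
        unfolding set_lebesgue_integral_def A_def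
        using mti[of j a] mti[of j b]
        by (simp only: Bochner_Integration.integral_diff Bochner_Integration.integral_divide_zero)
    qed
    have "(\<lambda>j. (A a j - A b j) / c) \<longlonglongrightarrow> (c * mt a - c * mt b) / c"
      using R(7) ab by (intro tendsto_intros lim) (auto simp: c_def)
    moreover have "(c * mt a - c * mt b) / c = m a - m b" using c ab by (simp add: mt_def field_simps)
    ultimately have l1: "(\<lambda>j. LBINT t:{0<..<T}. deriv (\<psi> j) t * m t) \<longlonglongrightarrow> m a - m b"
      by (simp only: lhs)
    have l2: "(\<lambda>j. LBINT t:{0<..<T}. \<psi> j t * n t) \<longlonglongrightarrow> (LBINT t:{a<..<b}. n t)"
      unfolding set_lebesgue_integral_def
    proof (rule integral_dominated_convergence[where w = "\<lambda>t. \<bar>n t\<bar>"])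
      \<comment> \<open>At the jumps a and b the limit of \<open>\<psi> j\<close> may differ from
        the indicator.\<close>
      have "AE t in lborel. t \<noteq> a \<and> t \<noteq> b"
        using AE_lborel_singleton[of a] AE_lborel_singleton[of b] by auto
      then show "AE t in lborel. (\<lambda>j. indicator {0<..<T} t *\<^sub>R (\<psi> j t * n t)) \<longlonglongrightarrow>
          indicator {a<..<b} t *\<^sub>R n t"
      proof eventually_elim
        case (elim t)
        note ne = elim
        have ev: "\<forall>\<^sub>F j in sequentially. 1 / real (Suc j) < min \<bar>t - a\<bar> \<bar>t - b\<bar>"
          using \<open>(\<lambda>j. 1 / real (Suc j)) \<longlonglongrightarrow> 0\<close> by (rule order_tendstoD) (use elim in auto)
        have "\<forall>\<^sub>F j in sequentially. \<psi> j t = indicator {a<..<b} t"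
          using ev
        proof eventually_elim
          case (elim j)
          have val: "R ((t - x) * real (Suc j)) = (if x < t then c else 0)"
            if "1 / real (Suc j) < \<bar>t - x\<bar>" for x
          proof (cases "x < t")
            case True
            then have "1 \<le> (t - x) * real (Suc j)" using that
              by (simp add: field_simps del: of_nat_Suc)
            then show ?thesis using True R(4) by (simp add: c_def)
          next
            case False
            then have "(t - x) * real (Suc j) \<le> -1" using that
              by (simp add: field_simps del: of_nat_Suc)
            then show ?thesis using False R(3) by simp
          qed
          show ?case using val[of a] val[of b] elim ne ab R(7)
            by (auto simp: \<psi>_def indicator_def c_def)
        qed
        then have "\<forall>\<^sub>F j in sequentially. indicator {0<..<T} t *\<^sub>R (\<psi> j t * n t) =
          indicator {a<..<b} t *\<^sub>R n t"
          by eventually_elim (use ab in \<open>auto simp: indicator_def\<close>)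
        then show ?case by (rule tendsto_eventually)
      qed
      fix j
      show "AE t in lborel. norm (indicator {0<..<T} t *\<^sub>R (\<psi> j t * n t)) \<le> \<bar>n t\<bar>"
      proof (rule AE_I2)
        fix t
        have "\<bar>R ((t - a) * real (Suc j)) - R ((t - b) * real (Suc j))\<bar> \<le> c"
          using R(5,6)[of "(t - a) * real (Suc j)"] R(5,6)[of "(t - b) * real (Suc j)"]
          by (simp add: c_def)
        then have "\<bar>\<psi> j t\<bar> \<le> 1" using R(7) by (simp add: \<psi>_def c_def)
        then have "\<bar>\<psi> j t\<bar> * \<bar>n t\<bar> \<le> 1 * \<bar>n t\<bar>" by (intro mult_right_mono) auto
        then show "norm (indicator {0<..<T} t *\<^sub>R (\<psi> j t * n t)) \<le> \<bar>n t\<bar>"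
          by (auto simp: indicator_def abs_mult)
      qed
    qed (use n in \<open>auto simp: \<psi>_def\<close>)
    have "\<forall>\<^sub>F j in sequentially. (LBINT t:{0<..<T}. deriv (\<psi> j) t * m t) =
       - (LBINT t:{0<..<T}. \<psi> j t * n t)"
      using test by eventually_elim (rule weak)
    from Lim_transform_eventually[OF l1 this] tendsto_minus[OF l2]
    have "m a - m b = - (LBINT t:{a<..<b}. n t)" by (rule LIMSEQ_unique)
    then show ?thesis by simp
  qed
  have z0: "(LBINT \<tau>:{0}. n \<tau>) = 0"
    unfolding set_lebesgue_integral_def
    by (rule integral_eq_zero_AE) (use AE_lborel_singleton[of 0] in eventually_elim, auto)
  define M where "M t = m t - (LBINT \<tau>:{0..t}. n \<tau>)" for t
  have sn: "set_integrable lborel S n" if "S \<in> sets borel" for S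
    using integrable_mult_indicator[OF _ n] that by (simp add: set_integrable_def)
  have "continuous_on {0..T} (\<lambda>x. LBINT \<tau>:{0..x}. n \<tau>)"
    using indefinite_integral_continuous_1[of n 0 T] set_borel_integral_eq_integral[OF sn]
    by (simp cong: continuous_on_cong)
  then have Mc: "continuous_on {0..T} M" unfolding M_def by (intro continuous_on_diff cont)
  show ?thesis
  proof (cases "T > 0")
    case False
    with t have "t = 0" by simp
    then show ?thesis by (simp add: z0)
  next
    case True
    \<comment> \<open>T / 2 is only a reference point: \<open>inter\<close> compares two interior
      points, and the closure argument that follows adds 0 and T.\<close>
    have Mconst: "M x = M (T / 2)" if "x \<in> {0<..<T}" for x
    proof -
      have MM: "M a = M b" if ab: "0 < a" "a < b" "b < T" for a b
      proof -
        have "(LBINT \<tau>:{0..b}. n \<tau>) = (LBINT \<tau>:{0..a} \<union> {a<..<b}. n \<tau>)"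
          unfolding set_lebesgue_integral_def
        proof (rule integral_cong_AE)
          show "AE x in lborel. indicator {0..b} x *\<^sub>R n x = indicator ({0..a} \<union> {a<..<b}) x *\<^sub>R n x"
            using AE_lborel_singleton[of b] by eventually_elim (use ab in \<open>auto simp: indicator_def\<close>)
        qed auto
        also have "\<dots> = (LBINT \<tau>:{0..a}. n \<tau>) + (LBINT \<tau>:{a<..<b}. n \<tau>)"
          by (rule set_integral_Un) (auto intro: sn)
        finally show ?thesis using inter[OF ab] by (simp add: M_def)
      qed
      show ?thesis
      proof (cases x "T / 2" rule: linorder_cases)
        case less
        with that True show ?thesis by (intro MM) auto
      next
        case greater
        with that True show ?thesis by (intro MM[symmetric]) auto
      qed (simp only:)
    qed
    have Mc: "M x = M (T / 2)" if "x \<in> {0..T}" for x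
    proof (rule continuous_constant_on_closure[where f = M and S = "{0<..<T}"])
      show "continuous_on (closure {0<..<T}) M" using Mc True by simp
      show "x \<in> closure {0<..<T}" using that True by simp
    qed (fact Mconst)
    from Mc[OF t] Mc[of 0] True have "M t = M 0" by simp
    then show ?thesis by (simp add: M_def z0)
  qed
qed

section \<open>Separability\<close>

text \<open>Outer regularity gives an open U slightly larger than A. By Lindelof U is a countable
  union of basis sets, and the finite partial unions tend to U in L^1 by dominated convergence.
  Finite unions matter because a countable basis has only countably many of them.\<close>

lemma lebesgue_indicator_approx:
  fixes \<B> :: "'a::euclidean_space set set" and e :: real
  assumes \<B>: "topological_basis \<B>" and A: "A \<in> sets lebesgue" "emeasure lebesgue A < \<infinity>"
    and e: "0 < e"
  obtains F where "finite F" "F \<subseteq> \<B>" "\<Union>F \<in> lmeasurable"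
    "(LINT x|lebesgue. \<bar>indicator A x - indicator (\<Union>F) x\<bar>) < e"
proof -
  have Am: "A \<in> lmeasurable" using A by (simp add: fmeasurable_def)
  obtain U where U: "open U" "A \<subseteq> U" "U - A \<in> lmeasurable" "emeasure lebesgue (U - A) < ennreal (e/2)"
    using sets_lebesgue_outer_open[OF A(1), of "e/2"] e by auto
  have "U = A \<union> (U - A)" using U by auto
  then have Um: "U \<in> lmeasurable" using Am U(3) by (metis fmeasurable.Un)
  obtain B' where B': "B' \<subseteq> \<B>" "U = \<Union>B'"
    using \<B> U(1) unfolding topological_basis_def by metis
  obtain B'' where B'': "countable B''" "B'' \<subseteq> B'" "\<Union>B'' = U"
  proof -
    have "\<And>S. S \<in> B' \<Longrightarrow> open S" using B' \<B> topological_basis_open by blast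
    then show ?thesis using Lindelof[of B'] B' that by metis
  qed
  have ob: "open S" if "S \<in> \<B>" for S using \<B> topological_basis_open that by blast
  \<comment> \<open>\<open>from_nat_into\<close> needs a nonempty set, so {} is inserted; V discards
    it again because {} may not belong to the basis.\<close>
  define b where "b = from_nat_into (insert {} B'')"
  have rb: "range b = insert {} B''" unfolding b_def using B'' by (intro range_from_nat_into) auto
  define V where "V n = \<Union>(b ` {..n} - {{}})" for n
  have Vsub: "b ` {..n} - {{}} \<subseteq> \<B>" for n
  proof -
    have "b i \<in> insert {} B''" for i using rb by blast
    then show ?thesis using B' B'' by blast
  qed
  have Vo: "open (V n)" for n unfolding V_def using Vsub[of n] ob by (intro open_Union) blast
  have VU: "V n \<subseteq> U" for n
  proof -
    have "b i \<in> insert {} B''" for i using rb by blast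
    then show ?thesis using B'' unfolding V_def by blast
  qed
  have Vm: "V n \<in> lmeasurable" for n
    by (rule fmeasurableI2[OF Um VU]) (use Vo in auto)
  have "(\<lambda>n. LINT x|lebesgue. \<bar>indicator U x - indicator (V n) x :: real\<bar>) \<longlonglongrightarrow> (LINT x::'a|lebesgue. (0::real))"
  proof (rule integral_dominated_convergence[where w = "indicator U"])
    show "integrable lebesgue (indicator U :: 'a \<Rightarrow> real)"
      using Um by (simp add: lmeasurable_iff_integrable)
    show "AE x in lebesgue. (\<lambda>n. \<bar>indicator U x - indicator (V n) x :: real\<bar>) \<longlonglongrightarrow> 0"
    proof (rule AE_I2)
      fix x
      have "\<forall>\<^sub>F n in sequentially. \<bar>indicator U x - indicator (V n) x :: real\<bar> = 0"
      proof (cases "x \<in> U")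
        case True
        then obtain S where "S \<in> B''" "x \<in> S" using B'' by blast
        then obtain i where "b i = S" using rb by (metis insertCI rangeE)
        then have "x \<in> V n" if "i \<le> n" for n using \<open>x \<in> S\<close> that unfolding V_def by blast
        then show ?thesis using True by (intro eventually_sequentiallyI[of i]) simp
      next
        case False
        then have "x \<notin> V n" for n using VU by blast
        then show ?thesis using False by simp
      qed
      then show "(\<lambda>n. \<bar>indicator U x - indicator (V n) x :: real\<bar>) \<longlonglongrightarrow> 0" by (rule tendsto_eventually)
    qed
    show "AE x in lebesgue. norm \<bar>indicator U x - indicator (V n) x :: real\<bar> \<le> indicator U x" for n
      using VU[of n] by (intro AE_I2) (auto simp: indicator_def)
  qed (use Um Vm in \<open>auto intro!: borel_measurable_indicator borel_measurable_diff borel_measurable_abs\<close>)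
  then have "\<forall>\<^sub>F n in sequentially. (LINT x|lebesgue. \<bar>indicator U x - indicator (V n) x :: real\<bar>) < e/2"
    by (rule order_tendstoD) (use e in simp)
  then obtain n where n: "(LINT x|lebesgue. \<bar>indicator U x - indicator (V n) x :: real\<bar>) < e/2"
    by (meson eventually_happens sequentially_bot)
  have iA: "integrable lebesgue (indicator A :: 'a \<Rightarrow> real)"
    and iU: "integrable lebesgue (indicator U :: 'a \<Rightarrow> real)"
    and iV: "integrable lebesgue (indicator (V n) :: 'a \<Rightarrow> real)"
    using Am Um Vm by (simp_all add: lmeasurable_iff_integrable)
  have "(LINT x|lebesgue. \<bar>indicator A x - indicator (V n) x :: real\<bar>) \<le>
      (LINT x|lebesgue. indicator (U - A) x + \<bar>indicator U x - indicator (V n) x :: real\<bar>)"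
  proof (rule integral_mono)
    show "\<bar>indicator A x - indicator (V n) x :: real\<bar> \<le>
        indicator (U - A) x + \<bar>indicator U x - indicator (V n) x :: real\<bar>" for x
      using U(2) by (auto simp: indicator_def)
  qed (use iA iU iV U(3)[unfolded lmeasurable_iff_integrable] in auto)
  also have "\<dots> = measure lebesgue (U - A) + (LINT x|lebesgue. \<bar>indicator U x - indicator (V n) x :: real\<bar>)"
    using iU iV U(3)[unfolded lmeasurable_iff_integrable]
    by (subst Bochner_Integration.integral_add) auto
  also have "measure lebesgue (U - A) < e/2"
    using U(3,4) by (simp add: emeasure_eq_measure2 ennreal_less_iff)
  finally have "(LINT x|lebesgue. \<bar>indicator A x - indicator (V n) x :: real\<bar>) < e" using n by simp
  then show ?thesis
    using that[of "b ` {..n} - {{}}"] Vsub[of n] Vm[of n] by (simp add: V_def)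
qed

text \<open>Rational combinations of indicators of finite unions of basis sets are countably many,
  and \<open>integrable_induct\<close> spreads their density from indicators to sums and dominated
  limits. Coding the combinations by lists makes countability immediate and turns addition into
  concatenation.\<close>

lemma separable_L1_lebesgue:
  obtains D :: "('a::euclidean_space \<Rightarrow> real) set"
  where "countable D" "\<And>d. d \<in> D \<Longrightarrow> integrable lebesgue d"
    "\<And>h e. integrable lebesgue h \<Longrightarrow> 0 < e \<Longrightarrow> \<exists>d\<in>D. (LINT x|lebesgue. \<bar>h x - d x\<bar>) < e"
proof -
  obtain \<B> :: "'a set set" where \<B>: "countable \<B>" "topological_basis \<B>"
    using ex_countable_basis by blast
  define \<V> where "\<V> = Union ` {F. finite F \<and> F \<subseteq> \<B>} \<inter> lmeasurable"
  have cV: "countable \<V>" unfolding \<V>_def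
    using countable_Collect_finite_subset[OF \<B>(1)] by (intro countable_Int1 countable_image)
  define comb :: "(real \<times> 'a set) list \<Rightarrow> 'a \<Rightarrow> real"
    where "comb xs x = (\<Sum>(q, V)\<leftarrow>xs. q * indicator V x)" for xs x
  define D where "D = comb ` lists (\<rat> \<times> \<V>)"
  have cD: "countable D"
    unfolding D_def using cV countable_rat by (intro countable_image countable_lists countable_SIGMA) auto
  have Vi: "integrable lebesgue (indicator V :: 'a \<Rightarrow> real)" if "V \<in> \<V>" for V
    using that by (simp add: \<V>_def lmeasurable_iff_integrable)
  have Di: "integrable lebesgue d" if "d \<in> D" for d
  proof -
    have "\<exists>xs. d = comb xs \<and> xs \<in> lists (\<rat> \<times> \<V>)"
      using that unfolding D_def by (metis imageE)
    then obtain xs where xs: "d = comb xs" "xs \<in> lists (\<rat> \<times> \<V>)" by metis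
    from xs(2) have "integrable lebesgue (comb xs)"
    proof induction
      case Nil
      show ?case by (simp add: comb_def[abs_def])
    next
      case (Cons a xs)
      have "comb (a # xs) = (\<lambda>x. fst a * indicator (snd a) x + comb xs x)"
        by (simp add: comb_def fun_eq_iff case_prod_beta)
      moreover have "integrable lebesgue (indicator (snd a) :: 'a \<Rightarrow> real)"
        using Cons.hyps by (intro Vi) auto
      ultimately show ?case using Cons.IH by simp
    qed
    with xs show ?thesis by simp
  qed
  have Dadd: "(\<lambda>x. d x + d' x) \<in> D" if "d \<in> D" "d' \<in> D" for d d'
  proof -
    have "\<exists>xs. d = comb xs \<and> xs \<in> lists (\<rat> \<times> \<V>)"
      using that(1) unfolding D_def by (metis imageE)
    then obtain xs where xs: "d = comb xs" "xs \<in> lists (\<rat> \<times> \<V>)" by metis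
    have "\<exists>ys. d' = comb ys \<and> ys \<in> lists (\<rat> \<times> \<V>)"
      using that(2) unfolding D_def by (metis imageE)
    then obtain ys where ys: "d' = comb ys" "ys \<in> lists (\<rat> \<times> \<V>)" by metis
    have "(\<lambda>x. d x + d' x) = comb (xs @ ys)" by (simp add: comb_def xs ys fun_eq_iff)
    moreover have "xs @ ys \<in> lists (\<rat> \<times> \<V>)" using xs(2) ys(2) by (simp only: append_in_lists_conv)
    ultimately show ?thesis unfolding D_def by (rule image_eqI)
  qed
  have "\<forall>e>0. \<exists>d\<in>D. (LINT x|lebesgue. \<bar>h x - d x\<bar>) < e" if "integrable lebesgue h" for h
    using that
  proof (induction rule: integrable_induct)
    case (base A c)
    show ?case
    proof (intro allI impI)
      fix e :: real assume e: "0 < e"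
      obtain F where F: "finite F" "F \<subseteq> \<B>" "\<Union>F \<in> lmeasurable"
        "(LINT x|lebesgue. \<bar>indicator A x - indicator (\<Union>F) x\<bar>) < e / (2 * (\<bar>c\<bar> + 1))"
        using lebesgue_indicator_approx[OF \<B>(2) base, of "e / (2 * (\<bar>c\<bar> + 1))"] e by auto
      define V where "V = \<Union>F"
      have V: "V \<in> \<V>" using F by (auto simp: V_def \<V>_def)
      define \<mu> where "\<mu> = measure lebesgue V"
      \<comment> \<open>Two errors of at most e/2: replacing A by V costs |c| times the L^1 distance
        of the indicators, replacing c by q costs |c - q| times the measure of V. The added 1 in
        both denominators avoids division by zero.\<close>
      obtain q where q: "q \<in> \<rat>" "c < q" "q < c + e / (2 * (\<mu> + 1))"
        using Rats_dense_in_real[of c "c + e / (2 * (\<mu> + 1))"] e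
        by (auto simp: \<mu>_def add_nonneg_pos)
      have iA: "integrable lebesgue (indicator A :: 'a \<Rightarrow> real)" using base by simp
      note iV = Vi[OF V]
      define d where "d = comb [(q, V)]"
      have dD: "d \<in> D" unfolding d_def D_def using q V by (intro imageI) (simp only: in_lists_conv_set, simp)
      have dx: "d x = q * indicator V x" for x by (simp add: d_def comb_def)
      have "(LINT x|lebesgue. \<bar>indicator A x *\<^sub>R c - d x\<bar>) \<le>
        (LINT x|lebesgue. \<bar>c\<bar> * \<bar>indicator A x - indicator V x\<bar> + \<bar>c - q\<bar> * indicator V x)"
      proof (rule integral_mono)
        show "integrable lebesgue (\<lambda>x. \<bar>indicator A x *\<^sub>R c - d x\<bar>)"
          unfolding dx using iA iV by (intro integrable_abs Bochner_Integration.integrable_diff) auto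
        show "integrable lebesgue (\<lambda>x. \<bar>c\<bar> * \<bar>indicator A x - indicator V x\<bar> + \<bar>c - q\<bar> * indicator V x)"
          using iA iV by auto
        show "\<bar>indicator A x *\<^sub>R c - d x\<bar> \<le> \<bar>c\<bar> * \<bar>indicator A x - indicator V x\<bar> + \<bar>c - q\<bar> * indicator V x" for x
          by (auto simp: indicator_def dx)
      qed
      also have "\<dots> = \<bar>c\<bar> * (LINT x|lebesgue. \<bar>indicator A x - indicator V x\<bar>) + \<bar>c - q\<bar> * \<mu>"
        using iA iV by (subst Bochner_Integration.integral_add) (auto simp: \<mu>_def)
      also have "\<dots> < e"
      proof -
        have "\<bar>c\<bar> * (LINT x|lebesgue. \<bar>indicator A x - indicator V x\<bar>) \<le> \<bar>c\<bar> * (e / (2 * (\<bar>c\<bar> + 1)))"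
          using F by (intro mult_left_mono) (auto simp: V_def)
        also have "\<dots> < e / 2" using e by (simp add: field_simps add_pos_nonneg)
        finally have 1: "\<bar>c\<bar> * (LINT x|lebesgue. \<bar>indicator A x - indicator V x\<bar>) < e / 2" .
        have \<mu>: "0 \<le> \<mu>" by (simp add: \<mu>_def)
        have "\<bar>c - q\<bar> * \<mu> \<le> (e / (2 * (\<mu> + 1))) * \<mu>" using q \<mu> by (intro mult_right_mono) auto
        also have "\<dots> \<le> e / 2" using e \<mu> by (simp add: field_simps)
        finally show ?thesis using 1 by simp
      qed
      finally show "\<exists>d\<in>D. (LINT x|lebesgue. \<bar>indicator A x *\<^sub>R c - d x\<bar>) < e" using dD by blast
    qed
  next
    case (add f g)
    show ?case
    proof (intro allI impI)
      fix e :: real assume "0 < e"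
      then obtain d d' where d: "d \<in> D" "(LINT x|lebesgue. \<bar>f x - d x\<bar>) < e/2"
        "d' \<in> D" "(LINT x|lebesgue. \<bar>g x - d' x\<bar>) < e/2"
        using add.IH by (metis half_gt_zero)
      note i = add.hyps Di[OF d(1)] Di[OF d(3)]
      have "(LINT x|lebesgue. \<bar>(f x + g x) - (d x + d' x)\<bar>) \<le>
          (LINT x|lebesgue. \<bar>f x - d x\<bar> + \<bar>g x - d' x\<bar>)"
        using i by (intro integral_mono) auto
      also have "\<dots> = (LINT x|lebesgue. \<bar>f x - d x\<bar>) + (LINT x|lebesgue. \<bar>g x - d' x\<bar>)"
        using i by (intro Bochner_Integration.integral_add) auto
      finally show "\<exists>d\<in>D. (LINT x|lebesgue. \<bar>(f x + g x) - d x\<bar>) < e"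
        using d Dadd by (intro bexI[of _ "\<lambda>x. d x + d' x"]) auto
    qed
  next
    case (lim f s)
    show ?case
    proof (intro allI impI)
      fix e :: real assume e: "0 < e"
      have fi: "integrable lebesgue f" and si: "integrable lebesgue (s i)" for i
        by (fact lim.hyps)+
      have "(\<lambda>i. LINT x|lebesgue. \<bar>f x - s i x\<bar>) \<longlonglongrightarrow> (LINT x::'a|lebesgue. (0::real))"
      \<comment> \<open>\<open>integrable_induct\<close> supplies approximants bounded by 2 |f|; the
        distance to f adds one more |f|.\<close>
      proof (rule integral_dominated_convergence[where w = "\<lambda>x. 3 * \<bar>f x\<bar>"])
        show "AE x in lebesgue. (\<lambda>i. \<bar>f x - s i x\<bar>) \<longlonglongrightarrow> 0"
        proof (rule AE_I2)
          fix x
          have "(\<lambda>i. s i x) \<longlonglongrightarrow> f x" by (rule lim.hyps) simp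
          then have "(\<lambda>i. \<bar>f x - s i x\<bar>) \<longlonglongrightarrow> \<bar>f x - f x\<bar>" by (intro tendsto_intros)
          then show "(\<lambda>i. \<bar>f x - s i x\<bar>) \<longlonglongrightarrow> 0" by simp
        qed
        fix i show "AE x in lebesgue. norm \<bar>f x - s i x\<bar> \<le> 3 * \<bar>f x\<bar>"
        proof (rule AE_I2)
          fix x
          have "norm (s i x) \<le> 2 * norm (f x)" by (rule lim.hyps) simp
          then show "norm \<bar>f x - s i x\<bar> \<le> 3 * \<bar>f x\<bar>" by simp
        qed
      qed (use fi si in auto)
      then have "\<forall>\<^sub>F i in sequentially. (LINT x|lebesgue. \<bar>f x - s i x\<bar>) < e/2"
        by (rule order_tendstoD) (use e in simp)
      then obtain i where i: "(LINT x|lebesgue. \<bar>f x - s i x\<bar>) < e/2"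
        by (meson eventually_happens sequentially_bot)
      obtain d where d: "d \<in> D" "(LINT x|lebesgue. \<bar>s i x - d x\<bar>) < e/2"
        using lim.IH[of i] half_gt_zero[OF e] by blast
      note ii = fi si[of i] Di[OF d(1)]
      have "(LINT x|lebesgue. \<bar>f x - d x\<bar>) \<le> (LINT x|lebesgue. \<bar>f x - s i x\<bar> + \<bar>s i x - d x\<bar>)"
        using ii by (intro integral_mono) auto
      also have "\<dots> = (LINT x|lebesgue. \<bar>f x - s i x\<bar>) + (LINT x|lebesgue. \<bar>s i x - d x\<bar>)"
        using ii by (intro Bochner_Integration.integral_add) auto
      finally show "\<exists>d\<in>D. (LINT x|lebesgue. \<bar>f x - d x\<bar>) < e" using d i by (intro bexI[of _ d]) auto
    qed
  qed
  then show ?thesis by (intro that[of D] cD Di) blast+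
qed

text \<open>The maps p and q send S into a product of two separable L^1 spaces, but the dense set
  has to lie in S itself. For every pair of dense centres and every radius 1 / (n + 1), one member
  of S within that radius is selected whenever there is one.\<close>

lemma L1_pair_separable_subset:
  fixes p :: "'b \<Rightarrow> 'a::euclidean_space \<Rightarrow> real" and q :: "'b \<Rightarrow> 'c::euclidean_space \<Rightarrow> real"
  assumes p: "\<And>\<phi>. \<phi> \<in> S \<Longrightarrow> integrable lebesgue (p \<phi>)"
    and q: "\<And>\<phi>. \<phi> \<in> S \<Longrightarrow> integrable lebesgue (q \<phi>)"
  obtains D where "countable D" "D \<subseteq> S"
    "\<And>\<phi> e. \<phi> \<in> S \<Longrightarrow> 0 < e \<Longrightarrow> \<exists>d\<in>D. (LINT x|lebesgue. \<bar>p \<phi> x - p d x\<bar>) < e \<and>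
       (LINT x|lebesgue. \<bar>q \<phi> x - q d x\<bar>) < e"
proof -
  obtain D1 :: "('a \<Rightarrow> real) set" where D1: "countable D1" "\<And>d. d \<in> D1 \<Longrightarrow> integrable lebesgue d"
    "\<And>h e. integrable lebesgue h \<Longrightarrow> 0 < e \<Longrightarrow> \<exists>d\<in>D1. (LINT x|lebesgue. \<bar>h x - d x\<bar>) < e"
    using separable_L1_lebesgue by blast
  obtain D2 :: "('c \<Rightarrow> real) set" where D2: "countable D2" "\<And>d. d \<in> D2 \<Longrightarrow> integrable lebesgue d"
    "\<And>h e. integrable lebesgue h \<Longrightarrow> 0 < e \<Longrightarrow> \<exists>d\<in>D2. (LINT x|lebesgue. \<bar>h x - d x\<bar>) < e"
    using separable_L1_lebesgue by blast
  define near where "near a b n \<phi> \<longleftrightarrow> \<phi> \<in> S \<and> (LINT x|lebesgue. \<bar>p \<phi> x - a x\<bar>) < 1 / real (Suc n) \<and>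
    (LINT x|lebesgue. \<bar>q \<phi> x - b x\<bar>) < 1 / real (Suc n)" for a b n \<phi>
  define D where "D = (\<lambda>(a, b, n). SOME \<phi>. near a b n \<phi>) `
    {(a, b, n). a \<in> D1 \<and> b \<in> D2 \<and> (\<exists>\<phi>. near a b n \<phi>)}"
  have "countable (D1 \<times> D2 \<times> (UNIV :: nat set))" using D1 D2 by auto
  then have cD: "countable D" unfolding D_def
    by (intro countable_image, elim countable_subset[rotated]) auto
  have DS: "D \<subseteq> S"
  proof
    fix d assume "d \<in> D"
    then obtain a b n where "\<exists>\<phi>. near a b n \<phi>" "d = (SOME \<phi>. near a b n \<phi>)" by (auto simp: D_def)
    then have "near a b n d" by (metis someI_ex)
    then show "d \<in> S" by (simp add: near_def)
  qed
  have tri: "(LINT x|lebesgue. \<bar>h x - k x\<bar>) < e"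
    if "integrable lebesgue h" "integrable lebesgue k" "integrable lebesgue a"
      "(LINT x|lebesgue. \<bar>h x - a x\<bar>) < e/2" "(LINT x|lebesgue. \<bar>k x - a x\<bar>) < e/2"
    for h k a :: "'d::euclidean_space \<Rightarrow> real" and e
  proof -
    have "(LINT x|lebesgue. \<bar>h x - k x\<bar>) \<le> (LINT x|lebesgue. \<bar>h x - a x\<bar> + \<bar>k x - a x\<bar>)"
      using that by (intro integral_mono) auto
    also have "\<dots> = (LINT x|lebesgue. \<bar>h x - a x\<bar>) + (LINT x|lebesgue. \<bar>k x - a x\<bar>)"
      using that by (intro Bochner_Integration.integral_add) auto
    finally show ?thesis using that by simp
  qed
  have "\<exists>d\<in>D. (LINT x|lebesgue. \<bar>p \<phi> x - p d x\<bar>) < e \<and> (LINT x|lebesgue. \<bar>q \<phi> x - q d x\<bar>) < e"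
    if "\<phi> \<in> S" "0 < e" for \<phi> e
  proof -
    \<comment> \<open>Both \<phi> and the selected d lie within 1 / (n + 1) of the same centres, so
      the triangle inequality asks for e/2.\<close>
    obtain n where n: "1 / real (Suc n) < e/2" using \<open>0 < e\<close>
      by (metis half_gt_zero nat_approx_posE)
    have n0: "0 < 1 / real (Suc n)" by simp
    obtain a b where ab: "a \<in> D1" "(LINT x|lebesgue. \<bar>p \<phi> x - a x\<bar>) < 1 / real (Suc n)"
      "b \<in> D2" "(LINT x|lebesgue. \<bar>q \<phi> x - b x\<bar>) < 1 / real (Suc n)"
      using D1(3)[OF p[OF \<open>\<phi> \<in> S\<close>] n0] D2(3)[OF q[OF \<open>\<phi> \<in> S\<close>] n0] by blast
    then have nn: "near a b n \<phi>" using that by (simp add: near_def)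
    define d where "d = (SOME \<phi>. near a b n \<phi>)"
    have d: "near a b n d" unfolding d_def using nn by (rule someI)
    have "d \<in> D" unfolding D_def d_def using ab nn by (intro image_eqI[where x = "(a, b, n)"]) auto
    moreover have "d \<in> S" using d by (simp add: near_def)
    moreover have "(LINT x|lebesgue. \<bar>p \<phi> x - p d x\<bar>) < e"
    proof (rule tri[of _ _ a])
      show "(LINT x|lebesgue. \<bar>p d x - a x\<bar>) < e / 2" "(LINT x|lebesgue. \<bar>p \<phi> x - a x\<bar>) < e / 2"
        using d ab n unfolding near_def by linarith+
    qed (use p D1(2) ab that \<open>d \<in> S\<close> in blast)+
    moreover have "(LINT x|lebesgue. \<bar>q \<phi> x - q d x\<bar>) < e"
    proof (rule tri[of _ _ b])
      show "(LINT x|lebesgue. \<bar>q d x - b x\<bar>) < e / 2" "(LINT x|lebesgue. \<bar>q \<phi> x - b x\<bar>) < e / 2"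
        using d ab n unfolding near_def by linarith+
    qed (use q D2(2) ab that \<open>d \<in> S\<close> in blast)+
    ultimately show ?thesis by blast
  qed
  then show ?thesis using that cD DS by blast
qed

section \<open>Borel representatives\<close>

lemma AE_lborel_sections:
  fixes P :: "'a::euclidean_space \<times> 'b::euclidean_space \<Rightarrow> bool"
  assumes "AE p in lborel. P p"
  shows "AE x in lborel. AE y in lborel. P (x, y)" "AE y in lborel. AE x in lborel. P (x, y)"
proof -
  have P: "AE p in (lborel :: 'a measure) \<Otimes>\<^sub>M (lborel :: 'b measure). P p"
    using assms unfolding lborel_prod .
  then show "AE x in lborel. AE y in lborel. P (x, y)" by (rule lborel_pair.AE_pair)
  have "(lborel :: 'a measure) \<Otimes>\<^sub>M (lborel :: 'b measure) =
      distr ((lborel :: 'b measure) \<Otimes>\<^sub>M (lborel :: 'a measure)) (lborel \<Otimes>\<^sub>M lborel) (\<lambda>(x, y). (y, x))"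
    by (rule lborel_pair.distr_pair_swap)
  from subst[where P = "\<lambda>M. AE p in M. P p", OF this P]
  have "AE p in distr ((lborel :: 'b measure) \<Otimes>\<^sub>M (lborel :: 'a measure)) (lborel \<Otimes>\<^sub>M lborel)
      (\<lambda>(x, y). (y, x)). P p" .
  then have "AE p in (lborel :: 'b measure) \<Otimes>\<^sub>M (lborel :: 'a measure). P (case p of (y, x) \<Rightarrow> (x, y))"
    by (rule AE_distrD[OF measurable_pair_swap'])
  from lborel_pair.AE_pair[OF this] show "AE y in lborel. AE x in lborel. P (x, y)" by simp
qed

lemma AE_lborel_pairI:
  fixes P :: "'a::euclidean_space \<times> 'b::euclidean_space \<Rightarrow> bool"
  assumes "AE y in lborel. AE x in lborel. P (x, y)" "Measurable.pred borel P"
  shows "AE p in lborel. P p"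
proof -
  have m: "{p \<in> space ((lborel :: 'a measure) \<Otimes>\<^sub>M (lborel :: 'b measure)). P p} \<in>
      sets ((lborel :: 'a measure) \<Otimes>\<^sub>M (lborel :: 'b measure))"
    using assms(2) unfolding lborel_prod by (simp add: pred_def)
  have "AE x in lborel. AE y in lborel. P (x, y)"
    using lborel_pair.AE_commute[of "\<lambda>x y. P (x, y)"] m assms(1) by simp
  then have "AE p in (lborel :: 'a measure) \<Otimes>\<^sub>M (lborel :: 'b measure). P p"
    by (rule lborel_pair.AE_pair_measure[OF m])
  then show ?thesis unfolding lborel_prod .
qed

text \<open>The product nests as x, then (y,t), so t is split off by taking sections twice.
  Recombining x and y by \<open>AE_lborel_pairI\<close> needs a measurable predicate; therefore P is
  first replaced by membership in the complement of a Borel null set.\<close>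

lemma AE_lborel_triple:
  fixes P :: "'a::euclidean_space \<times> 'b::euclidean_space \<times> 'c::euclidean_space \<Rightarrow> bool"
  assumes "AE p in lborel. P p"
  shows "AE t in lborel. AE q in lborel. P (fst q, snd q, t)"
proof -
  obtain N where N: "\<And>p. p \<in> space lborel - N \<Longrightarrow> P p" "N \<in> null_sets lborel"
    by (rule AE_E3[OF assms]) (rule that)
  have Nb[measurable]: "N \<in> sets borel" using N(2) by auto
  have "AE p in lborel. p \<notin> N" using N(2) by (rule AE_not_in)
  then have "AE y in lborel. AE x in lborel. (x, y) \<notin> N" by (rule AE_lborel_sections)
  then have "AE t in lborel. AE y in lborel. AE x in lborel. (x, y, t) \<notin> N" by (rule AE_lborel_sections)
  then show ?thesis
  proof eventually_elim
    case (elim t)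
    have "AE q in lborel. (fst q, snd q, t) \<notin> N"
    proof (rule AE_lborel_pairI)
      show "AE y in lborel. AE x in lborel. (fst (x, y), snd (x, y), t) \<notin> N" using elim by simp
      have "(\<lambda>q :: 'a \<times> 'b. (fst q, snd q, t)) \<in> borel_measurable borel"
        by (intro borel_measurable_continuous_onI continuous_intros)
      then show "Measurable.pred borel (\<lambda>q. (fst q, snd q, t) \<notin> N)"
        by (rule measurable_compose[where g = "\<lambda>p. p \<notin> N"]) measurable
    qed
    then show ?case by eventually_elim (use N(1) in simp)
  qed
qed

section \<open>Transfer from the completed measure to Borel functions\<close>

lemma AE_lebesgue_on_iff:
  assumes "S \<in> sets borel"
  shows "(AE x in lebesgue_on S. P x) \<longleftrightarrow> (AE x in lborel. x \<in> S \<longrightarrow> P x)"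
  by (subst AE_restrict_space_iff) (use assms in \<open>auto simp: AE_completion_iff\<close>)

context
  fixes f h :: "'a::euclidean_space \<Rightarrow> real" and S
  assumes S: "S \<in> sets borel" and h[measurable]: "h \<in> borel_measurable borel"
    and eq: "AE x in lborel. x \<in> S \<longrightarrow> f x = h x"
begin

lemma lebesgue_on_AE_eq_borel_measurable: "f \<in> borel_measurable (lebesgue_on S)"
proof -
  have "(\<lambda>x. indicator S x *\<^sub>R h x) \<in> borel_measurable lebesgue"
    by (intro measurable_completion) (use S h in simp)
  moreover have "AE x in lebesgue. indicator S x *\<^sub>R h x = indicator S x *\<^sub>R f x"
    using eq by (subst AE_completion_iff, eventually_elim) (auto simp: indicator_def)
  ultimately have "(\<lambda>x. indicator S x *\<^sub>R f x) \<in> borel_measurable lebesgue"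
    by (rule borel_measurable_AE)
  then show ?thesis using S by (subst borel_measurable_restrict_space_iff) auto
qed

lemma integrable_lebesgue_on_AE_eq:
  "integrable (lebesgue_on S) f \<longleftrightarrow> integrable lborel (\<lambda>x. indicator S x * h x)"
proof -
  have "integrable (lebesgue_on S) f \<longleftrightarrow> integrable (lebesgue_on S) h"
  proof (rule integrable_cong_AE[OF lebesgue_on_AE_eq_borel_measurable])
    show "h \<in> borel_measurable (lebesgue_on S)"
      by (intro measurable_restrict_space1 measurable_completion) simp
    show "AE x in lebesgue_on S. f x = h x" using eq S by (simp add: AE_lebesgue_on_iff)
  qed
  also have "\<dots> \<longleftrightarrow> integrable lborel (\<lambda>x. indicator S x *\<^sub>R h x)"
    using S by (subst integrable_restrict_space) (auto intro!: integrable_completion)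
  finally show ?thesis by simp
qed

lemma integral_lebesgue_on_AE_eq:
  "integral\<^sup>L (lebesgue_on S) f = (LBINT x. indicator S x * h x)"
proof -
  have "integral\<^sup>L (lebesgue_on S) f = integral\<^sup>L (lebesgue_on S) h"
  proof (rule integral_cong_AE[OF lebesgue_on_AE_eq_borel_measurable])
    show "h \<in> borel_measurable (lebesgue_on S)"
      by (intro measurable_restrict_space1 measurable_completion) simp
    show "AE x in lebesgue_on S. f x = h x" using eq S by (simp add: AE_lebesgue_on_iff)
  qed
  also have "\<dots> = (LBINT x. indicator S x *\<^sub>R h x)"
    using S by (subst integral_restrict_space) (auto intro!: integral_completion)
  finally show ?thesis by simp
qed

end

lemma lebesgue_on_borel_representative:
  fixes f :: "'a::euclidean_space \<Rightarrow> real"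
  assumes S: "S \<in> sets borel" and f: "f \<in> borel_measurable (lebesgue_on S)"
  obtains h where "h \<in> borel_measurable borel" "\<And>x. x \<notin> S \<Longrightarrow> h x = 0"
    "AE x in lborel. x \<in> S \<longrightarrow> f x = h x"
proof -
  have "(\<lambda>x. indicator S x *\<^sub>R f x) \<in> borel_measurable lebesgue"
    using f S by (subst (asm) borel_measurable_restrict_space_iff) auto
  then obtain h where h[measurable]: "h \<in> borel_measurable lborel"
    and e: "AE x in lborel. indicator S x *\<^sub>R f x = h x"
    using completion_ex_borel_measurable_real by blast
  show ?thesis
  proof (rule that[of "\<lambda>x. indicator S x * h x"])
    show "(\<lambda>x. indicator S x * h x) \<in> borel_measurable borel" using S h by measurable
    show "AE x in lborel. x \<in> S \<longrightarrow> f x = indicator S x * h x"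
      using e by eventually_elim auto
  qed simp
qed

text \<open>
  The representative is Borel measurable because the Fubini theorems concern the product measure,
  not its completion.
\<close>
definition L2_representative ::
  "'a::euclidean_space set \<Rightarrow> real \<Rightarrow> (real \<Rightarrow> 'a \<Rightarrow> real) \<Rightarrow> (real \<times> 'a \<Rightarrow> real) \<Rightarrow> bool" where
  "L2_representative \<Omega> T w G \<longleftrightarrow>
     G \<in> borel_measurable borel \<and> (\<forall>p. p \<notin> {0<..<T} \<times> \<Omega> \<longrightarrow> G p = 0) \<and>
     integrable lborel (\<lambda>p. (G p)\<^sup>2) \<and>
     (AE p in lborel. p \<in> {0<..<T} \<times> \<Omega> \<longrightarrow> w (fst p) (snd p) = G p)"

lemma powr_2_abs: "\<bar>x\<bar> powr 2 = x\<^sup>2" for x :: real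
  by (cases "x = 0") (simp_all add: powr_numeral)

text \<open>Joint measurability and an integrable bound h on the squared norms of the slices give
  joint square integrability by Tonelli. The set A is kept separate from \<Omega> because u is given
  on the whole space and its time derivative on \<Omega>.\<close>

lemma L2_representative_exists:
  assumes \<Omega>: "open \<Omega>" "open A" "\<Omega> \<subseteq> A" and w: "jointly_measurable T A w"
    and L2: "AE t in lebesgue_on {0<..<T}. w t \<in> Lp_space 2 \<Omega> \<and> (Lp_norm 2 \<Omega> (w t))\<^sup>2 \<le> h t"
    and h: "integrable (lebesgue_on {0<..<T}) h"
  obtains G where "L2_representative \<Omega> T w G"
proof -
  have [measurable]: "\<Omega> \<in> sets borel" "A \<in> sets borel" using \<Omega> by auto
  have bor: "{0<..<T} \<times> \<Omega> \<in> sets borel" "{0<..<T} \<times> A \<in> sets borel"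
    using \<Omega> by (blast intro: borel_open open_Times open_greaterThanLessThan)+
  obtain G0 where G0[measurable]: "G0 \<in> borel_measurable borel"
    and G0w: "AE p in lborel. p \<in> {0<..<T} \<times> A \<longrightarrow> (\<lambda>(t, x). w t x) p = G0 p"
    by (rule lebesgue_on_borel_representative[OF bor(2) w[unfolded jointly_measurable_def]]) blast
  define G where "G p = indicator ({0<..<T} \<times> \<Omega>) p * G0 p" for p
  have Gm[measurable]: "G \<in> borel_measurable borel" unfolding G_def using bor by measurable
  have Gm': "G \<in> borel_measurable (lborel \<Otimes>\<^sub>M lborel)" unfolding lborel_prod by simp
  have G0': "G p = 0" if "p \<notin> {0<..<T} \<times> \<Omega>" for p using that by (simp add: G_def)
  have Gw: "AE p in lborel. p \<in> {0<..<T} \<times> \<Omega> \<longrightarrow> w (fst p) (snd p) = G p"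
    using G0w by eventually_elim (use \<Omega>(3) in \<open>auto simp: G_def\<close>)
  have sec: "AE t in lborel. t \<in> {0<..<T} \<longrightarrow> w t \<in> Lp_space 2 \<Omega> \<and> (Lp_norm 2 \<Omega> (w t))\<^sup>2 \<le> h t"
    by (rule iffD1[OF AE_lebesgue_on_iff L2]) simp
  have key: "AE t in lborel. integrable lborel (\<lambda>x. (G (t, x))\<^sup>2) \<and>
      norm (LBINT x. norm ((G (t, x))\<^sup>2)) \<le> indicator {0<..<T} t * h t"
    using sec AE_lborel_sections(1)[OF Gw]
  proof eventually_elim
    case (elim t)
    show ?case
    proof (cases "t \<in> {0<..<T}")
      case True
      have e: "AE x in lborel. x \<in> \<Omega> \<longrightarrow> \<bar>w t x\<bar> powr 2 = (G (t, x))\<^sup>2"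
        using elim(2) by eventually_elim (use True in \<open>auto simp: powr_2_abs\<close>)
      have ind: "indicator \<Omega> x * (G (t, x))\<^sup>2 = (G (t, x))\<^sup>2" for x
        using G0'[of "(t, x)"] by (cases "x \<in> \<Omega>") auto
      have m: "(\<lambda>x. (G (t, x))\<^sup>2) \<in> borel_measurable borel" by measurable
      have w2: "w t \<in> Lp_space 2 \<Omega>" "(Lp_norm 2 \<Omega> (w t))\<^sup>2 \<le> h t" using elim True by auto
      have i: "integrable lborel (\<lambda>x. (G (t, x))\<^sup>2)"
        using w2(1) integrable_lebesgue_on_AE_eq[OF _ m e] by (simp add: Lp_space_def ind)
      have "(Lp_norm 2 \<Omega> (w t))\<^sup>2 = (LBINT x. (G (t, x))\<^sup>2)"
        unfolding Lp_norm_def using integral_lebesgue_on_AE_eq[OF _ m e]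
        by (simp add: ind powr_half_sqrt)
      with i w2 True show ?thesis by simp
    next
      case False
      then have "G (t, x) = 0" for x using G0'[of "(t, x)"] False by auto
      moreover have "indicator {0<..<T} t = (0 :: real)" using False by (rule indicator_simps(2))
      ultimately show ?thesis by simp
    qed
  qed
  \<comment> \<open>The bound h is known to be measurable only for the completed measure; a Borel
    copy can dominate in \<open>lborel\<close>.\<close>
  obtain h' where h'[measurable]: "h' \<in> borel_measurable borel"
    and hh': "AE x in lborel. x \<in> {0<..<T} \<longrightarrow> h x = h' x"
    by (rule lebesgue_on_borel_representative[OF _ borel_measurable_integrable[OF h]]) (simp, blast)
  have ih': "integrable lborel (\<lambda>t. indicator {0<..<T} t * h' t)"
    using h integrable_lebesgue_on_AE_eq[OF _ h'(1) hh'] by simp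
  have mm: "(\<lambda>t. LBINT x. norm ((G (t, x))\<^sup>2)) \<in> borel_measurable lborel"
    using Gm' by measurable
  have "integrable (lborel \<Otimes>\<^sub>M lborel) (\<lambda>p. (G p)\<^sup>2)"
  proof (rule lborel_pair.Fubini_integrable)
    show "integrable lborel (\<lambda>t. LBINT x. norm ((G (t, x))\<^sup>2))"
    proof (rule Bochner_Integration.integrable_bound[OF ih' mm])
      show "AE t in lborel. norm (LBINT x. norm ((G (t, x))\<^sup>2)) \<le> norm (indicator {0<..<T} t * h' t)"
        using key hh' by eventually_elim (auto simp: indicator_def)
    qed
    show "AE t in lborel. integrable lborel (\<lambda>x. (G (t, x))\<^sup>2)" using key by eventually_elim simp
  qed (rule borel_measurable_power[OF Gm'])
  then have "L2_representative \<Omega> T w G"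
    unfolding L2_representative_def lborel_prod
    by (intro conjI allI impI Gm Gw G0')
  then show ?thesis by (rule that)
qed

text \<open>On the bounded set (0,T) \<times> \<Omega> the constant 1 is integrable, and |a| \<le> 1
  + a^2.\<close>

lemma L2_representative_integrable:
  assumes G: "L2_representative \<Omega> T w G" and \<Omega>: "open \<Omega>" "bounded \<Omega>"
  shows "integrable lborel G"
proof (rule Bochner_Integration.integrable_bound)
  let ?S = "{0<..<T} \<times> \<Omega>"
  have "bounded ?S" using \<Omega> by (intro bounded_Times) auto
  then have "emeasure lborel ?S < \<infinity>" by (rule emeasure_bounded_finite)
  moreover have "?S \<in> sets borel" using \<Omega> by (auto intro!: borel_open open_Times)
  ultimately show "integrable lborel (\<lambda>p. indicator ?S p + (G p)\<^sup>2)"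
    using G by (auto simp: L2_representative_def)
  have "\<bar>a\<bar> \<le> 1 + a\<^sup>2" for a :: real
  proof -
    have "0 \<le> (\<bar>a\<bar> - 1)\<^sup>2 + 1 + a\<^sup>2" by simp
    then show ?thesis by (simp add: power2_eq_square algebra_simps)
  qed
  then have le: "\<bar>G p\<bar> \<le> \<bar>1 + (G p)\<^sup>2\<bar>" for p by (rule order_trans) simp
  have "G p = 0" if "p \<notin> ?S" for p using G that unfolding L2_representative_def by blast
  then have "norm (G p) \<le> norm (indicator ?S p + (G p)\<^sup>2)" for p
    using le[of p] by (cases "p \<in> ?S") (simp_all only: indicator_simps real_norm_def, simp)
  then show "AE p in lborel. norm (G p) \<le> norm (indicator ?S p + (G p)\<^sup>2)" by (intro AE_I2)
  show "G \<in> borel_measurable lborel" using G by (simp add: L2_representative_def)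
qed

section \<open>Weak time derivatives\<close>

lemma test_function_borel_bounded:
  assumes "test_function T \<psi>"
  shows "\<psi> \<in> borel_measurable borel" "deriv \<psi> \<in> borel_measurable borel"
    "\<exists>B. \<forall>t. \<bar>\<psi> t\<bar> \<le> B \<and> \<bar>deriv \<psi> t\<bar> \<le> B"
proof -
  have d: "(deriv ^^ n) \<psi> differentiable (at t)" for n t
    using assms by (simp add: test_function_def)
  have c: "continuous_on S ((deriv ^^ n) \<psi>)" for n S
    by (intro continuous_at_imp_continuous_on ballI differentiable_imp_continuous_within d)
  have c0: "continuous_on S \<psi>" and c1: "continuous_on S (deriv \<psi>)" for S
    using c[of S 0] c[of S 1] by simp_all
  show "\<psi> \<in> borel_measurable borel" "deriv \<psi> \<in> borel_measurable borel"
    by (intro borel_measurable_continuous_onI c0 c1)+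
  have z: "\<psi> t = 0" "deriv \<psi> t = 0" if "t \<notin> {0<..<T}" for t
  proof -
    \<comment> \<open>The support K is closed, so a point outside (0,T) has a whole neighbourhood on
      which \<open>\<psi>\<close> is 0; this gives the derivative as well.\<close>
    define K where "K = closure {t. \<psi> t \<noteq> 0}"
    have K: "K \<subseteq> {0<..<T}" using assms unfolding test_function_def K_def by blast
    have zK: "\<psi> x = 0" if "x \<notin> K" for x
      using closure_subset[of "{t. \<psi> t \<noteq> 0}"] that unfolding K_def by auto
    have t: "t \<in> - K" using that K by auto
    show "\<psi> t = 0" using t zK by simp
    have "open (- K)" unfolding K_def by (rule open_Compl) simp
    then have "(\<psi> has_real_derivative 0) (at t)"
      using zK by (intro has_field_derivative_transform_within_open[OF DERIV_const _ t]) simp_all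
    then show "deriv \<psi> t = 0" by (rule DERIV_imp_deriv)
  qed
  have "\<exists>B. \<forall>t\<in>{0..T}. \<bar>h t\<bar> \<le> B" if "continuous_on {0..T} h" for h :: "real \<Rightarrow> real"
  proof -
    have "bounded (h ` {0..T})" by (intro compact_imp_bounded compact_continuous_image that) auto
    then show ?thesis unfolding bounded_iff by (metis image_eqI real_norm_def)
  qed
  from this[OF c0] this[OF c1] obtain B1 B2
    where B: "\<And>t. t \<in> {0..T} \<Longrightarrow> \<bar>\<psi> t\<bar> \<le> B1" "\<And>t. t \<in> {0..T} \<Longrightarrow> \<bar>deriv \<psi> t\<bar> \<le> B2" by blast
  have "\<bar>\<psi> t\<bar> \<le> max 0 (max B1 B2) \<and> \<bar>deriv \<psi> t\<bar> \<le> max 0 (max B1 B2)" for t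
  proof (cases "t \<in> {0<..<T}")
    case True
    with B[of t] show ?thesis by auto
  next
    case False
    with z show ?thesis by simp
  qed
  then show "\<exists>B. \<forall>t. \<bar>\<psi> t\<bar> \<le> B \<and> \<bar>deriv \<psi> t\<bar> \<le> B" by blast
qed

text \<open>Bounded weights keep the integrand below A B |H|, so Fubini applies. With a cut-off test
  function, its derivative, or the indicator of {0..t} as a, this exchanges pairing in space with
  integration in time.\<close>

lemma integral_mult_section_swap:
  fixes H :: "real \<times> 'a::euclidean_space \<Rightarrow> real"
  assumes H: "integrable lborel H"
    and a: "a \<in> borel_measurable borel" "\<And>t. \<bar>a t\<bar> \<le> A"
    and b: "b \<in> borel_measurable borel" "\<And>x. \<bar>b x\<bar> \<le> B"
  shows "(LBINT t. a t * (LBINT x. H (t, x) * b x)) = (LBINT x. (LBINT t. a t * H (t, x)) * b x)"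
    "integrable lborel (\<lambda>t. a t * (LBINT x. H (t, x) * b x))"
proof -
  note [measurable] = a(1) b(1)
  have Hm[measurable]: "H \<in> borel_measurable (lborel \<Otimes>\<^sub>M lborel)"
    using borel_measurable_integrable[OF H] unfolding lborel_prod .
  have i: "integrable (lborel \<Otimes>\<^sub>M lborel) (\<lambda>(t, x). a t * H (t, x) * b x)"
  proof (rule Bochner_Integration.integrable_bound)
    show "integrable (lborel \<Otimes>\<^sub>M lborel) (\<lambda>p. A * B * \<bar>H p\<bar>)"
      using H unfolding lborel_prod by simp
    have A: "0 \<le> A" "0 \<le> B" using a(2)[of 0] b(2)[of 0] by linarith+
    have "\<bar>a t * H (t, x) * b x\<bar> \<le> A * B * \<bar>H (t, x)\<bar>" for t x
    proof -
      have "\<bar>a t\<bar> * \<bar>b x\<bar> * \<bar>H (t, x)\<bar> \<le> A * B * \<bar>H (t, x)\<bar>"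
        using a(2)[of t] b(2)[of x] A by (intro mult_right_mono mult_mono) auto
      then show ?thesis by (simp add: abs_mult mult.commute mult.left_commute)
    qed
    then show "AE p in lborel \<Otimes>\<^sub>M lborel. norm (case p of (t, x) \<Rightarrow> a t * H (t, x) * b x) \<le>
        norm (A * B * \<bar>H p\<bar>)"
      using A by (intro AE_I2) (auto simp: abs_mult)
  qed simp
  have "(LBINT t. LBINT x. a t * H (t, x) * b x) = (LBINT x. LBINT t. a t * H (t, x) * b x)"
    using lborel_pair.Fubini_integral[OF i] by simp
  moreover have "(LBINT x. a t * H (t, x) * b x) = a t * (LBINT x. H (t, x) * b x)" for t
    by (simp add: mult.assoc)
  ultimately show "(LBINT t. a t * (LBINT x. H (t, x) * b x)) = (LBINT x. (LBINT t. a t * H (t, x)) * b x)"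
    by simp
  show "integrable lborel (\<lambda>t. a t * (LBINT x. H (t, x) * b x))"
    using lborel_pair.integrable_fst[OF i] by (simp add: mult.assoc)
qed

text \<open>The pairing m(\<tau>) of u(\<tau>) with a fixed bounded \<phi> is continuous by L^1
  continuity, and its weak derivative n is the pairing with G. The scalar lemma then evaluates m(t)
  - m(0), and a good choice of \<phi> recovers the pointwise statement.\<close>

lemma weak_time_derivative_imp_integral:
  fixes \<Omega> :: "'a::euclidean_space set"
  assumes \<Omega>: "open \<Omega>" "bounded \<Omega>"
    and cont: "continuous_Lp 1 \<Omega> T u"
    and weak: "has_weak_time_derivative \<Omega> T u g"
    and U: "L2_representative \<Omega> T u U" and G: "L2_representative \<Omega> T g G"
    and t: "t \<in> {0..T}"
  shows "AE x in lborel. x \<in> \<Omega> \<longrightarrow> u t x - u 0 x = (LBINT \<tau>:{0..t}. G (\<tau>, x))"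
proof -
  have Ob[measurable]: "\<Omega> \<in> sets borel" using \<Omega> by simp
  note iU = L2_representative_integrable[OF U \<Omega>] and iG = L2_representative_integrable[OF G \<Omega>]
  have [measurable]: "U \<in> borel_measurable (lborel \<Otimes>\<^sub>M lborel)" "G \<in> borel_measurable (lborel \<Otimes>\<^sub>M lborel)"
    using U G unfolding L2_representative_def lborel_prod by auto
  have U0: "U p = 0" "G p = 0" if "p \<notin> {0<..<T} \<times> \<Omega>" for p
    using U G that unfolding L2_representative_def by blast+
  have eqU: "AE p in lborel. p \<in> {0<..<T} \<times> \<Omega> \<longrightarrow> u (fst p) (snd p) = U p"
    and eqG: "AE p in lborel. p \<in> {0<..<T} \<times> \<Omega> \<longrightarrow> g (fst p) (snd p) = G p"
    using U G unfolding L2_representative_def by blast+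
  have ut: "u \<tau> \<in> borel_measurable (lebesgue_on \<Omega>)" "integrable (lebesgue_on \<Omega>) (u \<tau>)"
    if "\<tau> \<in> {0..T}" for \<tau>
  proof -
    have *: "u \<tau> \<in> borel_measurable (lebesgue_on \<Omega>) \<and> integrable (lebesgue_on \<Omega>) (\<lambda>x. \<bar>u \<tau> x\<bar> powr 1)"
      using cont that by (auto simp: continuous_Lp_def Lp_space_def)
    then show "u \<tau> \<in> borel_measurable (lebesgue_on \<Omega>)" by simp
    show "integrable (lebesgue_on \<Omega>) (u \<tau>)"
      using * by (intro integrable_abs_cancel[of _ "u \<tau>"]) auto
  qed
  have t0: "0 \<in> {0..T}" using t by simp
  \<comment> \<open>U determines u(\<tau>) only for almost every \<tau>. The increment at the given
    t needs a representative of its own, available because \<open>continuous_Lp\<close> puts u(t) in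
    L^1 for every t.\<close>
  obtain d where d[measurable]: "d \<in> borel_measurable borel" and d0: "\<And>x. x \<notin> \<Omega> \<Longrightarrow> d x = 0"
    and ud: "AE x in lborel. x \<in> \<Omega> \<longrightarrow> u t x - u 0 x = d x"
    by (rule lebesgue_on_borel_representative[OF Ob borel_measurable_diff[OF ut(1)[OF t] ut(1)[OF t0]]])
      blast
  define W where "W x = (LBINT \<tau>:{0..t}. G (\<tau>, x))" for x
  have [measurable]: "W \<in> borel_measurable borel"
    unfolding W_def set_lebesgue_integral_def by measurable
  have W0: "W x = 0" if "x \<notin> \<Omega>" for x
    using U0(2) that by (simp add: W_def set_lebesgue_integral_def)
  \<comment> \<open>This \<phi> depends on t but not on the running time \<tau>; multiplied by d - W
    it gives |d - W|.\<close>
  define \<phi> where "\<phi> x = sgn (d x - W x)" for x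
  have \<phi>[measurable]: "\<phi> \<in> borel_measurable borel" unfolding \<phi>_def by measurable
  have \<phi>1: "\<bar>\<phi> x\<bar> \<le> 1" for x by (simp add: \<phi>_def abs_sgn_eq)
  have \<phi>0: "\<phi> x = 0" if "x \<notin> \<Omega>" for x using that d0 W0 by (simp add: \<phi>_def)
  have \<phi>L: "\<phi> \<in> borel_measurable (lebesgue_on \<Omega>)"
    by (intro measurable_restrict_space1 measurable_completion) simp
  have mult_int: "integrable (lebesgue_on \<Omega>) (\<lambda>x. v x * \<phi> x)" if "integrable (lebesgue_on \<Omega>) v" for v
  proof (rule Bochner_Integration.integrable_bound[OF that])
    show "(\<lambda>x. v x * \<phi> x) \<in> borel_measurable (lebesgue_on \<Omega>)"
      using borel_measurable_integrable[OF that] \<phi>L by measurable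
    show "AE x in lebesgue_on \<Omega>. norm (v x * \<phi> x) \<le> norm (v x)"
      using \<phi>1 by (intro AE_I2) (simp add: abs_mult mult_left_le)
  qed
  define m where "m \<tau> = (LINT x|lebesgue_on \<Omega>. u \<tau> x * \<phi> x)" for \<tau>
  define n where "n \<tau> = (LBINT x. G (\<tau>, x) * \<phi> x)" for \<tau>
  have mcont: "continuous_on {0..T} m"
    unfolding continuous_on
  proof
    fix a assume a: "a \<in> {0..T}"
    have "((\<lambda>\<tau>. Lp_norm 1 \<Omega> (\<lambda>x. u \<tau> x - u a x)) \<longlongrightarrow> 0) (at a within {0..T})"
      using cont a by (auto simp: continuous_Lp_def)
    moreover have "\<forall>\<^sub>F \<tau> in at a within {0..T}. norm (m \<tau> - m a) \<le> Lp_norm 1 \<Omega> (\<lambda>x. u \<tau> x - u a x)"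
    proof (simp add: eventually_at_filter, intro always_eventually allI impI)
      fix \<tau> assume "0 \<le> \<tau> \<and> \<tau> \<le> T"
      then have \<tau>: "\<tau> \<in> {0..T}" by simp
      note i = ut(2)[OF \<tau>] ut(2)[OF a]
      have "m \<tau> - m a = (LINT x|lebesgue_on \<Omega>. (u \<tau> x - u a x) * \<phi> x)"
        unfolding m_def using mult_int i
        by (subst Bochner_Integration.integral_diff[symmetric]) (auto simp: left_diff_distrib)
      also have "\<bar>\<dots>\<bar> \<le> (LINT x|lebesgue_on \<Omega>. \<bar>u \<tau> x - u a x\<bar>)"
      proof (rule integral_abs_bound[THEN order_trans], rule integral_mono)
        show "integrable (lebesgue_on \<Omega>) (\<lambda>x. \<bar>(u \<tau> x - u a x) * \<phi> x\<bar>)"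
          using i by (intro integrable_abs mult_int) simp
        show "\<bar>(u \<tau> x - u a x) * \<phi> x\<bar> \<le> \<bar>u \<tau> x - u a x\<bar>" for x
          using \<phi>1 by (simp add: abs_mult mult_left_le)
      qed (use i in simp)
      also have "\<dots> = Lp_norm 1 \<Omega> (\<lambda>x. u \<tau> x - u a x)"
        by (simp add: Lp_norm_def)
      finally show "\<bar>m \<tau> - m a\<bar> \<le> Lp_norm 1 \<Omega> (\<lambda>x. u \<tau> x - u a x)" .
    qed
    ultimately have "((\<lambda>\<tau>. m \<tau> - m a) \<longlongrightarrow> 0) (at a within {0..T})" by (rule Lim_null_comparison[rotated])
    then show "(m \<longlongrightarrow> m a) (at a within {0..T})" by (rule LIM_zero_cancel)
  qed
  have nint: "integrable lborel n"
    using integral_mult_section_swap(2)[OF iG, of "\<lambda>_. 1" 1 \<phi> 1] \<phi>1 by (simp add: n_def[abs_def])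
  have mU: "AE \<tau> in lborel. \<tau> \<in> {0<..<T} \<longrightarrow> m \<tau> = (LBINT x. U (\<tau>, x) * \<phi> x)"
    using AE_lborel_sections(1)[OF eqU]
  proof eventually_elim
    case (elim \<tau>)
    show ?case
    proof
      assume \<tau>: "\<tau> \<in> {0<..<T}"
      have e: "AE x in lborel. x \<in> \<Omega> \<longrightarrow> u \<tau> x * \<phi> x = U (\<tau>, x) * \<phi> x"
        using elim by eventually_elim (use \<tau> in auto)
      have "m \<tau> = (LBINT x. indicator \<Omega> x * (U (\<tau>, x) * \<phi> x))"
        unfolding m_def by (rule integral_lebesgue_on_AE_eq[OF Ob _ e]) measurable
      also have "\<dots> = (LBINT x. U (\<tau>, x) * \<phi> x)"
        by (rule Bochner_Integration.integral_cong) (auto simp: indicator_def \<phi>0)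
      finally show "m \<tau> = (LBINT x. U (\<tau>, x) * \<phi> x)" .
    qed
  qed
  have weak_m: "(LBINT \<tau>:{0<..<T}. deriv \<psi> \<tau> * m \<tau>) = - (LBINT \<tau>:{0<..<T}. \<psi> \<tau> * n \<tau>)"
    if \<psi>: "test_function T \<psi>" for \<psi>
  proof -
    note [measurable] = test_function_borel_bounded(1,2)[OF \<psi>]
    obtain B where B: "\<And>t. \<bar>\<psi> t\<bar> \<le> B" "\<And>t. \<bar>deriv \<psi> t\<bar> \<le> B"
      using test_function_borel_bounded(3)[OF \<psi>] by blast
    have B0: "0 \<le> B" using B(1)[of 0] by linarith
    define a1 where "a1 \<tau> = indicator {0<..<T} \<tau> * deriv \<psi> \<tau>" for \<tau>
    define a2 where "a2 \<tau> = indicator {0<..<T} \<tau> * \<psi> \<tau>" for \<tau>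
    have am[measurable]: "a1 \<in> borel_measurable borel" "a2 \<in> borel_measurable borel"
      unfolding a1_def a2_def by measurable
    have aB: "\<bar>a1 \<tau>\<bar> \<le> B" "\<bar>a2 \<tau>\<bar> \<le> B" for \<tau>
      using B B0 by (auto simp: a1_def a2_def indicator_def)
    have "(LBINT \<tau>:{0<..<T}. deriv \<psi> \<tau> * m \<tau>) = (LBINT \<tau>. a1 \<tau> * (LBINT x. U (\<tau>, x) * \<phi> x))"
      unfolding set_lebesgue_integral_def
    proof (rule integral_cong_AE)
      show e: "AE \<tau> in lborel. indicator {0<..<T} \<tau> *\<^sub>R (deriv \<psi> \<tau> * m \<tau>) =
          a1 \<tau> * (LBINT x. U (\<tau>, x) * \<phi> x)"
        using mU by eventually_elim (auto simp: a1_def indicator_def)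
      have "(\<lambda>\<tau>. indicator {0<..<T} \<tau> *\<^sub>R m \<tau>) \<in> borel_measurable borel"
        by (intro borel_measurable_continuous_on_indicator continuous_on_subset[OF mcont]) auto
      then have "(\<lambda>\<tau>. deriv \<psi> \<tau> * (indicator {0<..<T} \<tau> *\<^sub>R m \<tau>)) \<in> borel_measurable borel"
        by measurable
      then show "(\<lambda>\<tau>. indicator {0<..<T} \<tau> *\<^sub>R (deriv \<psi> \<tau> * m \<tau>)) \<in> borel_measurable lborel"
        by (simp add: mult.left_commute)
    qed measurable
    also have "\<dots> = (LBINT x. (LBINT \<tau>. a1 \<tau> * U (\<tau>, x)) * \<phi> x)"
      by (rule integral_mult_section_swap(1)[OF iU am(1) aB(1) \<phi> \<phi>1])
    \<comment> \<open>For the single test function \<open>\<psi>\<close> the exceptional null set of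
      points x is harmless under the space integral.\<close>
    also have "\<dots> = (LBINT x. - (LBINT \<tau>. a2 \<tau> * G (\<tau>, x)) * \<phi> x)"
    proof (rule integral_cong_AE)
      have "AE x in lborel. x \<in> \<Omega> \<longrightarrow> (LINT t|lebesgue_on {0<..<T}. deriv \<psi> t * u t x) =
           - (LINT t|lebesgue_on {0<..<T}. \<psi> t * g t x)"
        using weak \<psi> Ob by (simp add: has_weak_time_derivative_def AE_lebesgue_on_iff)
      then show "AE x in lborel. (LBINT \<tau>. a1 \<tau> * U (\<tau>, x)) * \<phi> x = - (LBINT \<tau>. a2 \<tau> * G (\<tau>, x)) * \<phi> x"
        using AE_lborel_sections(2)[OF eqU] AE_lborel_sections(2)[OF eqG]
      proof eventually_elim
        case (elim x)
        show ?case
        proof (cases "x \<in> \<Omega>")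
          case True
          have e1: "AE \<tau> in lborel. \<tau> \<in> {0<..<T} \<longrightarrow> deriv \<psi> \<tau> * u \<tau> x = deriv \<psi> \<tau> * U (\<tau>, x)"
            using elim(2) by eventually_elim (use True in auto)
          have e2: "AE \<tau> in lborel. \<tau> \<in> {0<..<T} \<longrightarrow> \<psi> \<tau> * g \<tau> x = \<psi> \<tau> * G (\<tau>, x)"
            using elim(3) by eventually_elim (use True in auto)
          have "(LINT t|lebesgue_on {0<..<T}. deriv \<psi> t * u t x) = (LBINT \<tau>. a1 \<tau> * U (\<tau>, x))"
            by (subst integral_lebesgue_on_AE_eq[OF _ _ e1]) (auto simp: a1_def mult.assoc)
          moreover have "(LINT t|lebesgue_on {0<..<T}. \<psi> t * g t x) = (LBINT \<tau>. a2 \<tau> * G (\<tau>, x))"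
            by (subst integral_lebesgue_on_AE_eq[OF _ _ e2]) (auto simp: a2_def mult.assoc)
          ultimately show ?thesis using elim(1) True by simp
        next
          case False
          then show ?thesis by (simp add: \<phi>0)
        qed
      qed
    qed measurable
    also have "\<dots> = - (LBINT x. (LBINT \<tau>. a2 \<tau> * G (\<tau>, x)) * \<phi> x)" by simp
    also have "(LBINT x. (LBINT \<tau>. a2 \<tau> * G (\<tau>, x)) * \<phi> x) = (LBINT \<tau>. a2 \<tau> * n \<tau>)"
      unfolding n_def by (rule integral_mult_section_swap(1)[OF iG am(2) aB(2) \<phi> \<phi>1, symmetric])
    finally show ?thesis by (simp add: set_lebesgue_integral_def a2_def mult.assoc)
  qed
  have "m t = m 0 + (LBINT \<tau>:{0..t}. n \<tau>)"
    by (rule weak_derivative_imp_integral[OF mcont nint weak_m t])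
  moreover have "m t - m 0 = (LBINT x. d x * \<phi> x)"
  proof -
    have e: "AE x in lborel. x \<in> \<Omega> \<longrightarrow> (u t x - u 0 x) * \<phi> x = d x * \<phi> x"
      using ud by eventually_elim auto
    have "m t - m 0 = (LINT x|lebesgue_on \<Omega>. (u t x - u 0 x) * \<phi> x)"
      unfolding m_def using mult_int ut(2)[OF t] ut(2)[OF t0]
      by (subst Bochner_Integration.integral_diff[symmetric]) (auto simp: left_diff_distrib)
    also have "\<dots> = (LBINT x. indicator \<Omega> x * (d x * \<phi> x))"
      by (rule integral_lebesgue_on_AE_eq[OF Ob _ e]) measurable
    also have "\<dots> = (LBINT x. d x * \<phi> x)"
      by (rule Bochner_Integration.integral_cong) (auto simp: indicator_def \<phi>0)
    finally show ?thesis .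
  qed
  moreover have "(LBINT \<tau>:{0..t}. n \<tau>) = (LBINT x. W x * \<phi> x)"
    unfolding set_lebesgue_integral_def n_def W_def real_scaleR_def
    by (rule integral_mult_section_swap(1)[OF iG _ _ \<phi> \<phi>1, where A = 1]) (auto simp: indicator_def)
  ultimately have eq: "(LBINT x. d x * \<phi> x) = (LBINT x. W x * \<phi> x)" by simp
  have di: "integrable lborel d"
  proof -
    have "integrable (lebesgue_on \<Omega>) (\<lambda>x. u t x - u 0 x)" using ut(2)[OF t] ut(2)[OF t0] by simp
    then have "integrable lborel (\<lambda>x. indicator \<Omega> x * d x)"
      using integrable_lebesgue_on_AE_eq[OF Ob d ud] by simp
    moreover have "indicator \<Omega> x * d x = d x" for x using d0[of x] by (cases "x \<in> \<Omega>") auto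
    ultimately show ?thesis by simp
  qed
  have Wi: "integrable lborel W"
  proof -
    have "{0..t} \<times> (UNIV :: 'a set) \<in> sets borel" by (intro borel_closed closed_Times) auto
    then have "integrable lborel (\<lambda>p. indicator ({0..t} \<times> (UNIV :: 'a set)) p *\<^sub>R G p)"
      by (intro integrable_mult_indicator iG) simp
    moreover have "(\<lambda>p. indicator ({0..t} \<times> (UNIV :: 'a set)) p *\<^sub>R G p) =
        (\<lambda>(\<tau>, x). indicator {0..t} \<tau> * G (\<tau>, x))" by (auto simp: indicator_def)
    ultimately have "integrable (lborel \<Otimes>\<^sub>M lborel) (\<lambda>(\<tau>, x). indicator {0..t} \<tau> * G (\<tau>, x))"
      unfolding lborel_prod by simp
    from lborel_pair.integrable_snd[OF this] show ?thesis
      by (simp add: W_def[abs_def] set_lebesgue_integral_def)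
  qed
  have ib: "integrable lborel (\<lambda>x. v x * \<phi> x)" if "integrable lborel v" for v
  proof (rule Bochner_Integration.integrable_bound[OF that])
    show "(\<lambda>x. v x * \<phi> x) \<in> borel_measurable lborel"
      using borel_measurable_integrable[OF that] by measurable
    show "AE x in lborel. norm (v x * \<phi> x) \<le> norm (v x)"
      using \<phi>1 by (intro AE_I2) (simp add: abs_mult mult_left_le)
  qed
  have "(LBINT x. \<bar>d x - W x\<bar>) = (LBINT x. d x * \<phi> x - W x * \<phi> x)"
    by (simp add: \<phi>_def abs_sgn algebra_simps)
  also have "\<dots> = 0" using eq ib[OF di] ib[OF Wi] by simp
  finally have "AE x in lborel. \<bar>d x - W x\<bar> = 0"
    using di Wi by (subst (asm) integral_nonneg_eq_0_iff_AE) auto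
  then show ?thesis using ud
    by eventually_elim (auto simp: W_def)
qed

section \<open>The test space\<close>

lemma borel_null_cover:
  assumes "AE x in lborel. P x"
  obtains N where "N \<in> sets borel" "AE x in lborel. x \<notin> N" "\<And>x. x \<notin> N \<Longrightarrow> P x"
proof (rule AE_E3[OF assms])
  fix N :: "'a set" assume N: "\<And>x. x \<in> space lborel - N \<Longrightarrow> P x" "N \<in> null_sets lborel"
  have "N \<in> sets borel" using null_setsD2[OF N(2)] by simp
  moreover have "AE x in lborel. x \<notin> N" using N(2) by (rule AE_not_in)
  ultimately show thesis using N(1) by (intro that[of N]) auto
qed

text \<open>The preimage of a null set under a projection is null; a Borel cover of the exceptional
  set supplies the measurability required by \<open>AE_lborel_pairI\<close>. This lets u be replaced
  by a Borel function inside difference quotients.\<close>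

lemma AE_lborel_fst_snd:
  fixes P :: "'a::euclidean_space \<Rightarrow> bool"
  assumes "AE x in lborel. P x"
  shows "AE p in (lborel :: ('a \<times> 'b::euclidean_space) measure). P (fst p)"
    "AE p in (lborel :: ('b \<times> 'a) measure). P (snd p)"
proof -
  obtain N where N: "N \<in> sets borel" "AE x in lborel. x \<notin> N" "\<And>x. x \<notin> N \<Longrightarrow> P x"
    by (rule borel_null_cover[OF assms]) (rule that)
  have f: "fst \<in> borel_measurable (borel :: ('a \<times> 'b) measure)"
    and s: "snd \<in> borel_measurable (borel :: ('b \<times> 'a) measure)"
    by (intro borel_measurable_continuous_onI continuous_intros)+
  have "AE p in (lborel :: ('a \<times> 'b) measure). fst p \<notin> N"
  proof (rule AE_lborel_pairI)
    show "Measurable.pred borel (\<lambda>p :: 'a \<times> 'b. fst p \<notin> N)"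
      using f by (rule measurable_compose[where g = "\<lambda>x. x \<notin> N"]) (use N(1) in measurable)
  qed (use N(2) in simp)
  then show "AE p in (lborel :: ('a \<times> 'b) measure). P (fst p)"
    by eventually_elim (rule N(3))
  have "AE p in (lborel :: ('b \<times> 'a) measure). snd p \<notin> N"
  proof (rule AE_lborel_pairI)
    show "Measurable.pred borel (\<lambda>p :: 'b \<times> 'a. snd p \<notin> N)"
      using s by (rule measurable_compose[where g = "\<lambda>x. x \<notin> N"]) (use N(1) in measurable)
    show "AE y in lborel. AE x in lborel. snd (x, y) \<notin> N"
      using N(2) by eventually_elim simp
  qed
  then show "AE p in (lborel :: ('b \<times> 'a) measure). P (snd p)"
    by eventually_elim (rule N(3))
qed

lemma lebesgue_on_borel_measurable_AE:
  fixes f g :: "'a::euclidean_space \<Rightarrow> real"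
  assumes S: "S \<in> sets borel" and f: "f \<in> borel_measurable (lebesgue_on S)"
    and eq: "AE x in lborel. x \<in> S \<longrightarrow> g x = f x"
  shows "g \<in> borel_measurable (lebesgue_on S)"
proof -
  obtain h where h: "h \<in> borel_measurable borel" "AE x in lborel. x \<in> S \<longrightarrow> f x = h x"
    by (rule lebesgue_on_borel_representative[OF S f]) blast
  have "AE x in lborel. x \<in> S \<longrightarrow> g x = h x" using eq h(2) by eventually_elim simp
  then show ?thesis by (rule lebesgue_on_AE_eq_borel_measurable[OF S h(1)])
qed

text \<open>Round u down to the grid of multiples of 1 / (n + 1). Each f(.,c) with c on the grid is
  measurable, so countable gluing gives measurable approximants, and continuity of f(x,.) identifies
  their limit.\<close>

lemma superposition_measurable:
  fixes f :: "'a::euclidean_space \<Rightarrow> real \<Rightarrow> real"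
  assumes S: "S \<in> sets borel" and f: "caratheodory S f" and u: "u \<in> borel_measurable (lebesgue_on S)"
  shows "(\<lambda>x. f x (u x)) \<in> borel_measurable (lebesgue_on S)"
proof -
  define F where "F n x = f x (of_int \<lfloor>real (Suc n) * u x\<rfloor> / real (Suc n))" for n x
  have "F n \<in> borel_measurable (lebesgue_on S)" for n
  proof -
    have fl: "(\<lambda>x. \<lfloor>real (Suc n) * u x\<rfloor>) \<in> measurable (lebesgue_on S) (count_space UNIV)"
      using u by measurable
    have "(\<lambda>x. f x (of_int i / real (Suc n))) \<in> borel_measurable (lebesgue_on S)" for i
      using f by (simp add: caratheodory_def)
    from measurable_compose_countable[OF this fl] show ?thesis unfolding F_def .
  qed
  \<comment> \<open>Convergence is available only almost everywhere, but \<open>lim\<close> is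
    measurable whether or not the sequence converges.\<close>
  then have lim: "(\<lambda>x. lim (\<lambda>n. F n x)) \<in> borel_measurable (lebesgue_on S)"
    by (rule borel_measurable_lim_metric)
  have "AE x in lebesgue_on S. continuous_on UNIV (f x)" using f by (simp add: caratheodory_def)
  then have "AE x in lborel. x \<in> S \<longrightarrow> continuous_on UNIV (f x)" by (rule iffD1[OF AE_lebesgue_on_iff[OF S]])
  then have "AE x in lborel. x \<in> S \<longrightarrow> f x (u x) = lim (\<lambda>n. F n x)"
  proof eventually_elim
    case (elim x)
    show ?case
    proof
      assume "x \<in> S"
      with elim have c: "isCont (f x) (u x)" by (simp add: continuous_on_eq_continuous_at)
      have "(\<lambda>n. of_int \<lfloor>real (Suc n) * u x\<rfloor> / real (Suc n)) \<longlonglongrightarrow> u x"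
      proof (rule tendsto_sandwich[OF always_eventually always_eventually])
        show "\<forall>n. u x - inverse (real (Suc n)) \<le> of_int \<lfloor>real (Suc n) * u x\<rfloor> / real (Suc n)"
        proof
          fix n
          have "real (Suc n) * u x - 1 \<le> of_int \<lfloor>real (Suc n) * u x\<rfloor>" by linarith
          then have "(real (Suc n) * u x - 1) / real (Suc n) \<le> of_int \<lfloor>real (Suc n) * u x\<rfloor> / real (Suc n)"
            by (intro divide_right_mono) simp_all
          then show "u x - inverse (real (Suc n)) \<le> of_int \<lfloor>real (Suc n) * u x\<rfloor> / real (Suc n)"
            by (simp add: diff_divide_distrib inverse_eq_divide del: of_nat_Suc)
        qed
        show "\<forall>n. of_int \<lfloor>real (Suc n) * u x\<rfloor> / real (Suc n) \<le> u x"
        proof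
          fix n
          have "of_int \<lfloor>real (Suc n) * u x\<rfloor> \<le> real (Suc n) * u x" by linarith
          then show "of_int \<lfloor>real (Suc n) * u x\<rfloor> / real (Suc n) \<le> u x"
            by (simp add: pos_divide_le_eq mult.commute del: of_nat_Suc)
        qed
        have "(\<lambda>n. u x - inverse (real (Suc n))) \<longlonglongrightarrow> u x - 0"
          by (intro tendsto_intros LIMSEQ_inverse_real_of_nat)
        then show "(\<lambda>n. u x - inverse (real (Suc n))) \<longlonglongrightarrow> u x" by simp
      qed simp
      then have "(\<lambda>n. F n x) \<longlonglongrightarrow> f x (u x)" unfolding F_def by (rule isCont_tendsto_compose[OF c])
      then show "f x (u x) = lim (\<lambda>n. F n x)" by (rule limI[symmetric])
    qed
  qed
  then show ?thesis by (rule lebesgue_on_borel_measurable_AE[OF S lim])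
qed

section \<open>Products and differences of square-integrable functions\<close>

lemma Lp_space_2_iff:
  "w \<in> Lp_space 2 A \<longleftrightarrow> w \<in> borel_measurable (lebesgue_on A) \<and> integrable (lebesgue_on A) (\<lambda>x. (w x)\<^sup>2)"
  by (simp add: Lp_space_def powr_2_abs)

lemma Lp_space_1_iff: "w \<in> Lp_space 1 A \<longleftrightarrow> integrable (lebesgue_on A) w"
proof -
  have "integrable (lebesgue_on A) (\<lambda>x. \<bar>w x\<bar>) \<longleftrightarrow> integrable (lebesgue_on A) w"
    if "w \<in> borel_measurable (lebesgue_on A)"
    using that by (auto intro: integrable_abs_cancel integrable_abs)
  then show ?thesis by (auto simp: Lp_space_def)
qed

lemma integrable_mult_of_squares:
  fixes v w :: "'a \<Rightarrow> real"
  assumes v: "v \<in> borel_measurable M" "integrable M (\<lambda>x. (v x)\<^sup>2)"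
    and w: "w \<in> borel_measurable M" "integrable M (\<lambda>x. (w x)\<^sup>2)"
  shows "integrable M (\<lambda>x. v x * w x)"
proof (rule Bochner_Integration.integrable_bound)
  show "integrable M (\<lambda>x. (v x)\<^sup>2 + (w x)\<^sup>2)" using v w by simp
  have "\<bar>a * b\<bar> \<le> a\<^sup>2 + b\<^sup>2" for a b :: real
  proof -
    have "0 \<le> (\<bar>a\<bar> - \<bar>b\<bar>)\<^sup>2 + a\<^sup>2 + b\<^sup>2" by simp
    then show ?thesis by (simp add: power2_eq_square abs_mult algebra_simps)
  qed
  then show "AE x in M. norm (v x * w x) \<le> norm ((v x)\<^sup>2 + (w x)\<^sup>2)" by (intro AE_I2) simp
qed (use v w in measurable)

lemma integrable_square_diff:
  fixes v w :: "'a \<Rightarrow> real"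
  assumes v: "v \<in> borel_measurable M" "integrable M (\<lambda>x. (v x)\<^sup>2)"
    and w: "w \<in> borel_measurable M" "integrable M (\<lambda>x. (w x)\<^sup>2)"
  shows "integrable M (\<lambda>x. (v x - w x)\<^sup>2)"
proof -
  have "integrable M (\<lambda>x. (v x)\<^sup>2 + (w x)\<^sup>2 - 2 * (v x * w x))"
    using integrable_mult_of_squares[OF v w] v w by simp
  then show ?thesis by (simp add: power2_diff mult.assoc)
qed

lemma Lp_space_2_diff:
  "v \<in> Lp_space 2 A \<Longrightarrow> w \<in> Lp_space 2 A \<Longrightarrow> (\<lambda>x. v x - w x) \<in> Lp_space 2 A"
  by (auto simp: Lp_space_2_iff intro: integrable_square_diff borel_measurable_diff)

section \<open>Difference quotients and separability of the test space\<close>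

lemma Q_set_borel:
  fixes \<Omega> :: "'a::euclidean_space set"
  assumes "open \<Omega>"
  shows "Q_set \<Omega> \<in> sets borel"
proof -
  have "closed ((- \<Omega>) \<times> (- \<Omega>))" using assms by (intro closed_Times) (simp_all add: closed_Compl)
  then show ?thesis unfolding Q_set_def by (intro borel_open open_Diff) simp_all
qed

text \<open>Keeping the sign makes the quotient linear in u, as needed for the pairing with \<eta>
  and for the density estimates. Its modulus is the integrand of \<open>W0_norm\<close>, since
  \<open>kernel\<close> is nonnegative.\<close>

definition difference_quotient ::
  "real \<Rightarrow> ('a::euclidean_space \<Rightarrow> real) \<Rightarrow> 'a \<times> 'a \<Rightarrow> real" where
  "difference_quotient s u p = (u (fst p) - u (snd p)) / kernel s (fst p) (snd p)"

lemma abs_difference_quotient: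
  "\<bar>difference_quotient s u p\<bar> = (case p of (x, y) \<Rightarrow> \<bar>u x - u y\<bar> / kernel s x y)"
  by (simp add: difference_quotient_def kernel_def case_prod_beta abs_divide)

lemma difference_quotient_diff:
  "difference_quotient s (\<lambda>x. u x - v x) p = difference_quotient s u p - difference_quotient s v p"
  by (simp add: difference_quotient_def diff_divide_distrib)

text \<open>\<open>W0\<close> asks for integrability of the modulus, which does not by itself give
  measurability of the signed quotient. That comes from a Borel function equal to u almost
  everywhere on the whole space.\<close>

lemma W0_difference_quotient:
  fixes \<Omega> :: "'a::euclidean_space set"
  assumes \<Omega>: "open \<Omega>" and u: "u \<in> W0 s \<Omega>"
  shows "integrable (lebesgue_on (Q_set \<Omega>)) (difference_quotient s u)"
proof -
  have Ob: "\<Omega> \<in> sets borel" using \<Omega> by simp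
  have "integrable (lebesgue_on \<Omega>) u" and z: "AE x in lebesgue. x \<notin> \<Omega> \<longrightarrow> u x = 0"
    and i: "integrable (lebesgue_on (Q_set \<Omega>)) (\<lambda>p. \<bar>difference_quotient s u p\<bar>)"
    using u by (simp_all add: W0_def Lp_space_1_iff abs_difference_quotient)
  then obtain h where h[measurable]: "h \<in> borel_measurable borel" and h0: "\<And>x. x \<notin> \<Omega> \<Longrightarrow> h x = 0"
    and uh: "AE x in lborel. x \<in> \<Omega> \<longrightarrow> u x = h x"
    by (blast intro: lebesgue_on_borel_representative[OF Ob borel_measurable_integrable])
  have "AE x in lborel. x \<notin> \<Omega> \<longrightarrow> u x = 0" using z by (simp add: AE_completion_iff)
  then have e: "AE x in lborel. u x = h x"
    using uh by eventually_elim (use h0 in metis)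
  have "(\<lambda>p. difference_quotient s h p) \<in> borel_measurable borel"
    unfolding difference_quotient_def kernel_def borel_prod[symmetric] by measurable
  moreover have "AE p in lborel. p \<in> Q_set \<Omega> \<longrightarrow> difference_quotient s u p = difference_quotient s h p"
    using AE_lborel_fst_snd(1)[OF e, where 'b = 'a] AE_lborel_fst_snd(2)[OF e, where 'b = 'a]
    by eventually_elim (simp add: difference_quotient_def)
  ultimately have "difference_quotient s u \<in> borel_measurable (lebesgue_on (Q_set \<Omega>))"
    by (intro lebesgue_on_AE_eq_borel_measurable[OF Q_set_borel[OF \<Omega>]])
  then show ?thesis using i by (rule integrable_abs_cancel[rotated])
qed

lemma W0_diff:
  fixes \<Omega> :: "'a::euclidean_space set"
  assumes \<Omega>: "open \<Omega>" and u: "u \<in> W0 s \<Omega>" and v: "v \<in> W0 s \<Omega>"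
  shows "(\<lambda>x. u x - v x) \<in> W0 s \<Omega>"
proof -
  have "integrable (lebesgue_on (Q_set \<Omega>)) (\<lambda>p. \<bar>difference_quotient s (\<lambda>x. u x - v x) p\<bar>)"
    unfolding difference_quotient_diff
    using W0_difference_quotient[OF \<Omega> u] W0_difference_quotient[OF \<Omega> v] by simp
  moreover have "AE x in lebesgue. x \<notin> \<Omega> \<longrightarrow> u x = 0" "AE x in lebesgue. x \<notin> \<Omega> \<longrightarrow> v x = 0"
    using u v by (simp_all add: W0_def)
  then have "AE x in lebesgue. x \<notin> \<Omega> \<longrightarrow> u x - v x = 0" by eventually_elim simp
  ultimately show ?thesis using u v by (simp add: W0_def Lp_space_1_iff abs_difference_quotient)
qed

text \<open>For equal signs (a - b)^2 \<le> |a - b| |a + b| = |a^2 - b^2|; for opposite signs (a -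
  b)^2 \<le> 2 (a^2 + b^2), the source of the factor 2.\<close>

lemma square_diff_le_signed_squares: "(a - b)\<^sup>2 \<le> 2 * \<bar>a * \<bar>a\<bar> - b * \<bar>b\<bar>\<bar>" for a b :: real
proof -
  have *: "(a - b)\<^sup>2 \<le> 2 * \<bar>a * \<bar>a\<bar> - b * \<bar>b\<bar>\<bar>" if "b \<le> a" for a b :: real
  proof -
    consider "0 \<le> b" | "b \<le> 0" "0 \<le> a" | "a \<le> 0" using that by linarith
    then show ?thesis
    proof cases
      case 1
      \<comment> \<open>The product is exactly the gap 2 (a^2 - b^2) - (a - b)^2; case 3 is its
        mirror image under exchanging (a,b) for (-b,-a).\<close>
      have "0 \<le> (a - b) * (a + 3 * b)" using 1 that by simp
      moreover have "b * b \<le> a * a" using 1 that by (intro mult_mono) auto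
      ultimately show ?thesis using 1 that by (simp add: power2_eq_square algebra_simps)
    next
      case 2
      have "0 \<le> (a + b)\<^sup>2" by simp
      then show ?thesis using 2 by (simp add: power2_eq_square algebra_simps abs_if)
    next
      case 3
      have "0 \<le> (a - b) * (- b - 3 * a)" using 3 that by (intro mult_nonneg_nonneg) auto
      moreover have "(- a) * (- a) \<le> (- b) * (- b)" using 3 that by (intro mult_mono) auto
      ultimately show ?thesis using 3 that by (simp add: power2_eq_square algebra_simps)
    qed
  qed
  show ?thesis
  proof (cases "b \<le> a")
    case False
    then have "(b - a)\<^sup>2 \<le> 2 * \<bar>b * \<bar>b\<bar> - a * \<bar>a\<bar>\<bar>" by (intro *) simp
    then show ?thesis by (simp add: power2_commute abs_minus_commute)
  qed (rule *)
qed

text \<open>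
  Signed squares embed \<open>L\<^sup>2\<close> into \<open>L\<^sup>1\<close> with a distance controlling that of \<open>L\<^sup>2\<close>, so that separability
  of \<open>L\<^sup>1\<close> suffices.
\<close>
lemma W0_L2_separable:
  fixes \<Omega> :: "'a::euclidean_space set"
  assumes \<Omega>: "open \<Omega>"
  obtains D where "countable D" "D \<subseteq> W0 s \<Omega> \<inter> Lp_space 2 \<Omega>"
    "\<And>\<phi> e. \<phi> \<in> W0 s \<Omega> \<inter> Lp_space 2 \<Omega> \<Longrightarrow> 0 < e \<Longrightarrow>
       \<exists>d\<in>D. (LINT p|lebesgue_on (Q_set \<Omega>). \<bar>difference_quotient s (\<lambda>x. \<phi> x - d x) p\<bar>) < e \<and>
         (LINT x|lebesgue_on \<Omega>. (\<phi> x - d x)\<^sup>2) < e"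
proof -
  let ?X = "W0 s \<Omega> \<inter> Lp_space 2 \<Omega>"
  define p where "p \<phi> z = indicator (Q_set \<Omega>) z *\<^sub>R difference_quotient s \<phi> z" for \<phi> z
  define q where "q \<phi> x = indicator \<Omega> x *\<^sub>R (\<phi> x * \<bar>\<phi> x\<bar>)" for \<phi> :: "'a \<Rightarrow> real" and x
  have Ob: "\<Omega> \<inter> space lebesgue \<in> sets lebesgue" "Q_set \<Omega> \<inter> space lebesgue \<in> sets lebesgue"
    using \<Omega> Q_set_borel[OF \<Omega>] by auto
  have sqi: "integrable (lebesgue_on \<Omega>) (\<lambda>x. \<phi> x * \<bar>\<phi> x\<bar>)" if "\<phi> \<in> Lp_space 2 \<Omega>" for \<phi>
  proof -
    have [measurable]: "\<phi> \<in> borel_measurable (lebesgue_on \<Omega>)" using that by (simp add: Lp_space_2_iff)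
    have "(\<lambda>x. \<bar>\<phi> x\<bar>) \<in> borel_measurable (lebesgue_on \<Omega>)" by measurable
    then show ?thesis using that by (intro integrable_mult_of_squares) (simp_all add: Lp_space_2_iff)
  qed
  have pi: "integrable lebesgue (p \<phi>)" if "\<phi> \<in> ?X" for \<phi>
    using W0_difference_quotient[OF \<Omega>, of \<phi> s] that
    unfolding p_def by (simp add: integrable_restrict_space[OF Ob(2)])
  have qi: "integrable lebesgue (q \<phi>)" if "\<phi> \<in> ?X" for \<phi>
    using sqi[of \<phi>] that unfolding q_def by (simp add: integrable_restrict_space[OF Ob(1)])
  obtain D where D: "countable D" "D \<subseteq> ?X"
    "\<And>\<phi> e. \<phi> \<in> ?X \<Longrightarrow> 0 < e \<Longrightarrow> \<exists>d\<in>D. (LINT x|lebesgue. \<bar>p \<phi> x - p d x\<bar>) < e \<and>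
       (LINT x|lebesgue. \<bar>q \<phi> x - q d x\<bar>) < e"
    by (rule L1_pair_separable_subset[of ?X p q, OF pi qi]) (assumption, assumption, rule that)
  show ?thesis
  proof (rule that[OF D(1,2)])
    fix \<phi> and e :: real assume \<phi>: "\<phi> \<in> ?X" and e: "0 < e"
    \<comment> \<open>Asking for e/2 absorbs the factor 2 of
      \<open>square_diff_le_signed_squares\<close>.\<close>
    obtain d where d: "d \<in> D" "(LINT x|lebesgue. \<bar>p \<phi> x - p d x\<bar>) < e/2"
      "(LINT x|lebesgue. \<bar>q \<phi> x - q d x\<bar>) < e/2"
      using D(3)[OF \<phi>, of "e/2"] e by auto
    have dX: "d \<in> ?X" using d(1) D(2) by blast
    have "(LINT p|lebesgue_on (Q_set \<Omega>). \<bar>difference_quotient s (\<lambda>x. \<phi> x - d x) p\<bar>) =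
        (LINT x|lebesgue. \<bar>p \<phi> x - p d x\<bar>)"
      unfolding integral_restrict_space[OF Ob(2)]
      by (rule Bochner_Integration.integral_cong)
        (auto simp: p_def difference_quotient_diff indicator_def)
    moreover have "(LINT x|lebesgue_on \<Omega>. (\<phi> x - d x)\<^sup>2) \<le>
        (LINT x|lebesgue_on \<Omega>. 2 * \<bar>\<phi> x * \<bar>\<phi> x\<bar> - d x * \<bar>d x\<bar>\<bar>)"
      using \<phi> dX sqi[of \<phi>] sqi[of d] Lp_space_2_diff[of \<phi> \<Omega> d]
      by (intro integral_mono square_diff_le_signed_squares) (simp_all add: Lp_space_2_iff)
    moreover have "(LINT x|lebesgue_on \<Omega>. 2 * \<bar>\<phi> x * \<bar>\<phi> x\<bar> - d x * \<bar>d x\<bar>\<bar>) =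
        2 * (LINT x|lebesgue. \<bar>q \<phi> x - q d x\<bar>)"
      unfolding integral_mult_right_zero integral_restrict_space[OF Ob(1)]
      by (intro arg_cong2[where f = "(*)"] Bochner_Integration.integral_cong) (auto simp: q_def indicator_def)
    ultimately show "\<exists>d\<in>D. (LINT p|lebesgue_on (Q_set \<Omega>). \<bar>difference_quotient s (\<lambda>x. \<phi> x - d x) p\<bar>) < e \<and>
         (LINT x|lebesgue_on \<Omega>. (\<phi> x - d x)\<^sup>2) < e"
      using d e by (intro bexI[of _ d]) auto
  qed
qed

section \<open>The weak form at a fixed time\<close>

lemma integrable_bounded_mult:
  fixes h \<eta> :: "'a \<Rightarrow> real"
  assumes h: "integrable M h" and \<eta>: "\<eta> \<in> borel_measurable M" "AE x in M. \<bar>\<eta> x\<bar> \<le> 1"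
  shows "integrable M (\<lambda>x. \<eta> x * h x)" "\<bar>LINT x|M. \<eta> x * h x\<bar> \<le> (LINT x|M. \<bar>h x\<bar>)"
proof -
  have le: "AE x in M. \<bar>\<eta> x * h x\<bar> \<le> \<bar>h x\<bar>"
    using \<eta>(2) by eventually_elim (simp add: abs_mult mult_left_le_one_le)
  have m: "(\<lambda>x. \<eta> x * h x) \<in> borel_measurable M" using \<eta>(1) borel_measurable_integrable[OF h] by measurable
  show i: "integrable M (\<lambda>x. \<eta> x * h x)"
    by (rule Bochner_Integration.integrable_bound[OF h m]) (use le in simp)
  have "\<bar>LINT x|M. \<eta> x * h x\<bar> \<le> (LINT x|M. \<bar>\<eta> x * h x\<bar>)" by (rule integral_abs_bound)
  also have "\<dots> \<le> (LINT x|M. \<bar>h x\<bar>)"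
    using i h le by (intro integral_mono_AE) auto
  finally show "\<bar>LINT x|M. \<eta> x * h x\<bar> \<le> (LINT x|M. \<bar>h x\<bar>)" .
qed

text \<open>Young's inequality in place of Cauchy-Schwarz: the free \<delta> first makes the term
  with the fixed v small, and an approximation argument then makes w small relative to
  \<delta>.\<close>

lemma abs_integral_mult_le_squares:
  fixes v w :: "'a \<Rightarrow> real"
  assumes v: "v \<in> borel_measurable M" "integrable M (\<lambda>x. (v x)\<^sup>2)"
    and w: "w \<in> borel_measurable M" "integrable M (\<lambda>x. (w x)\<^sup>2)" and \<delta>: "0 < \<delta>"
  shows "\<bar>LINT x|M. v x * w x\<bar> \<le> \<delta> * (LINT x|M. (v x)\<^sup>2) + (LINT x|M. (w x)\<^sup>2) / \<delta>"
proof -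
  have "\<bar>LINT x|M. v x * w x\<bar> \<le> (LINT x|M. \<bar>v x * w x\<bar>)" by (rule integral_abs_bound)
  also have "\<dots> \<le> (LINT x|M. \<delta> * (v x)\<^sup>2 + (w x)\<^sup>2 / \<delta>)"
  proof (rule integral_mono)
    show "integrable M (\<lambda>x. \<bar>v x * w x\<bar>)" using integrable_mult_of_squares[OF v w] by (rule integrable_abs)
    show "\<bar>v x * w x\<bar> \<le> \<delta> * (v x)\<^sup>2 + (w x)\<^sup>2 / \<delta>" for x
    proof -
      have "0 \<le> (\<delta> * \<bar>v x\<bar> - \<bar>w x\<bar>)\<^sup>2 + (\<delta> * v x)\<^sup>2 + (w x)\<^sup>2" by simp
      then have "2 * (\<delta> * \<bar>v x * w x\<bar>) \<le> 2 * ((\<delta> * v x)\<^sup>2 + (w x)\<^sup>2)"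
        by (simp add: power2_eq_square algebra_simps abs_mult)
      also have "\<dots> = 2 * (\<delta> * (\<delta> * (v x)\<^sup>2 + (w x)\<^sup>2 / \<delta>))"
        using \<delta> by (simp add: power2_eq_square algebra_simps)
      finally show ?thesis using \<delta> by simp
    qed
  qed (use v w in simp)
  also have "\<dots> = \<delta> * (LINT x|M. (v x)\<^sup>2) + (LINT x|M. (w x)\<^sup>2) / \<delta>" using v w by simp
  finally show ?thesis .
qed

text \<open>The left-hand side is continuous in \<phi>: the first term for the L^2 distance because
  G is in L^2, the second for the L^1 distance of difference quotients because |\<eta>| \<le>
  1.\<close>

lemma weak_form_extends:
  fixes \<Omega> :: "'a::euclidean_space set"
  assumes D: "D \<subseteq> W0 s \<Omega> \<inter> Lp_space 2 \<Omega>" and \<Omega>: "open \<Omega>"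
    and dense: "\<And>\<phi> e. \<phi> \<in> W0 s \<Omega> \<inter> Lp_space 2 \<Omega> \<Longrightarrow> 0 < e \<Longrightarrow>
       \<exists>d\<in>D. (LINT p|lebesgue_on (Q_set \<Omega>). \<bar>difference_quotient s (\<lambda>x. \<phi> x - d x) p\<bar>) < e \<and>
         (LINT x|lebesgue_on \<Omega>. (\<phi> x - d x)\<^sup>2) < e"
    and G: "G \<in> Lp_space 2 \<Omega>"
    and \<eta>: "\<eta> \<in> borel_measurable (lebesgue_on (Q_set \<Omega>))" "AE p in lebesgue_on (Q_set \<Omega>). \<bar>\<eta> p\<bar> \<le> 1"
    and eq: "\<And>d. d \<in> D \<Longrightarrow> (LINT x|lebesgue_on \<Omega>. G x * d x) +
        (LINT p|lebesgue_on (Q_set \<Omega>). \<eta> p * difference_quotient s d p) = 0"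
    and \<phi>: "\<phi> \<in> W0 s \<Omega> \<inter> Lp_space 2 \<Omega>"
  shows "(LINT x|lebesgue_on \<Omega>. G x * \<phi> x) +
        (LINT p|lebesgue_on (Q_set \<Omega>). \<eta> p * difference_quotient s \<phi> p) = 0" (is "?A = 0")
proof -
  have "\<bar>?A\<bar> \<le> 0 + e" if e: "0 < e" for e
  proof -
    define S where "S = (LINT x|lebesgue_on \<Omega>. (G x)\<^sup>2)"
    have S0: "0 \<le> S" unfolding S_def by simp
    \<comment> \<open>The error is split as e/2 + e/4 + e/4: \<delta> takes care of the fixed mass S
      of G, with + 1 against S = 0, and \<epsilon> then pays for the term divided by \<delta> and
      for the nonlocal term.\<close>
    define \<delta> where "\<delta> = e / (2 * (S + 1))"
    have \<delta>: "0 < \<delta>" using e S0 by (simp add: \<delta>_def)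
    have \<delta>S: "\<delta> * S \<le> e / 2" using e S0 by (simp add: \<delta>_def field_simps)
    define \<epsilon> where "\<epsilon> = min (e / 4) (\<delta> * e / 4)"
    have \<epsilon>: "0 < \<epsilon>" using e \<delta> by (simp add: \<epsilon>_def)
    obtain d where d: "d \<in> D"
      and d1: "(LINT p|lebesgue_on (Q_set \<Omega>). \<bar>difference_quotient s (\<lambda>x. \<phi> x - d x) p\<bar>) < \<epsilon>"
      and d2: "(LINT x|lebesgue_on \<Omega>. (\<phi> x - d x)\<^sup>2) < \<epsilon>"
      using dense[OF \<phi> \<epsilon>] by blast
    have dX: "d \<in> W0 s \<Omega>" "d \<in> Lp_space 2 \<Omega>" using d D by auto
    have \<phi>X: "\<phi> \<in> W0 s \<Omega>" "\<phi> \<in> Lp_space 2 \<Omega>" using \<phi> by auto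
    note W = W0_difference_quotient[OF \<Omega> \<phi>X(1)] W0_difference_quotient[OF \<Omega> dX(1)]
    have L: "integrable (lebesgue_on \<Omega>) (\<lambda>x. G x * \<phi> x)" "integrable (lebesgue_on \<Omega>) (\<lambda>x. G x * d x)"
      using G \<phi>X dX by (simp_all add: Lp_space_2_iff integrable_mult_of_squares)
    note I = integrable_bounded_mult(1)[OF W(1) \<eta>] integrable_bounded_mult(1)[OF W(2) \<eta>]
    have "(LINT x|lebesgue_on \<Omega>. G x * (\<phi> x - d x)) =
        (LINT x|lebesgue_on \<Omega>. G x * \<phi> x) - (LINT x|lebesgue_on \<Omega>. G x * d x)"
      using L by (simp add: right_diff_distrib)
    moreover have "(LINT p|lebesgue_on (Q_set \<Omega>). \<eta> p * difference_quotient s (\<lambda>x. \<phi> x - d x) p) =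
        (LINT p|lebesgue_on (Q_set \<Omega>). \<eta> p * difference_quotient s \<phi> p) -
        (LINT p|lebesgue_on (Q_set \<Omega>). \<eta> p * difference_quotient s d p)"
      using I by (simp add: difference_quotient_diff right_diff_distrib)
    ultimately have "?A = (LINT x|lebesgue_on \<Omega>. G x * (\<phi> x - d x)) +
        (LINT p|lebesgue_on (Q_set \<Omega>). \<eta> p * difference_quotient s (\<lambda>x. \<phi> x - d x) p)"
      using eq[OF d] by linarith
    moreover have "\<bar>LINT x|lebesgue_on \<Omega>. G x * (\<phi> x - d x)\<bar> \<le>
        \<delta> * S + (LINT x|lebesgue_on \<Omega>. (\<phi> x - d x)\<^sup>2) / \<delta>"
      unfolding S_def using G Lp_space_2_diff[OF \<phi>X(2) dX(2)] \<delta>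
      by (intro abs_integral_mult_le_squares) (simp_all add: Lp_space_2_iff)
    moreover have "(LINT x|lebesgue_on \<Omega>. (\<phi> x - d x)\<^sup>2) / \<delta> \<le> (\<delta> * e / 4) / \<delta>"
      using d2 \<delta> by (intro divide_right_mono) (auto simp: \<epsilon>_def)
    moreover have "(\<delta> * e / 4) / \<delta> = e / 4" using \<delta> by simp
    moreover have "\<bar>LINT p|lebesgue_on (Q_set \<Omega>). \<eta> p * difference_quotient s (\<lambda>x. \<phi> x - d x) p\<bar> \<le> e / 4"
    proof -
      have "integrable (lebesgue_on (Q_set \<Omega>)) (difference_quotient s (\<lambda>x. \<phi> x - d x))"
        by (intro W0_difference_quotient \<Omega> W0_diff \<phi>X dX)
      from integrable_bounded_mult(2)[OF this \<eta>] d1 show ?thesis by (simp add: \<epsilon>_def)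
    qed
    ultimately show ?thesis using \<delta>S by linarith
  qed
  then have "\<bar>?A\<bar> \<le> 0" by (rule field_le_epsilon)
  then show ?thesis by simp
qed

lemma AE_lebesgue_on_Icc_imp_Ioo:
  fixes T :: real
  assumes "AE t in lebesgue_on {0..T}. P t"
  shows "AE t in lborel. t \<in> {0<..<T} \<longrightarrow> P t"
proof -
  have "AE t in lborel. t \<in> {0..T} \<longrightarrow> P t" by (rule iffD1[OF AE_lebesgue_on_iff assms]) simp
  then show ?thesis by eventually_elim auto
qed

text \<open>The reaction term is moved to the left so that it forms a single L^2 function with the
  time derivative, the shape that \<open>weak_form_extends\<close> handles.\<close>

definition weak_form_at ::
  "real \<Rightarrow> 'a::euclidean_space set \<Rightarrow> ('a \<Rightarrow> real \<Rightarrow> real) \<Rightarrow> ('a \<Rightarrow> real) \<Rightarrow> ('a \<Rightarrow> real) \<Rightarrow> ('a \<times> 'a \<Rightarrow> real) \<Rightarrow> bool"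
where
  "weak_form_at s \<Omega> f u g \<eta> \<longleftrightarrow>
     u \<in> W0 s \<Omega> \<inter> Lp_space 2 \<Omega> \<and> g \<in> Lp_space 2 \<Omega> \<and>
     \<eta> \<in> borel_measurable (lebesgue_on (Q_set \<Omega>)) \<and>
     (AE p in lebesgue_on (Q_set \<Omega>). \<bar>\<eta> p\<bar> \<le> 1) \<and>
     (AE p in lebesgue_on (Q_set \<Omega>). \<eta> p \<in> msign (u (fst p) - u (snd p))) \<and>
     (\<forall>\<phi> \<in> W0 s \<Omega> \<inter> Lp_space 2 \<Omega>. (LINT x|lebesgue_on \<Omega>. (g x - f x (u x)) * \<phi> x) +
        (LINT p|lebesgue_on (Q_set \<Omega>). \<eta> p * difference_quotient s \<phi> p) = 0)"

text \<open>As f(x,0) = 0, comparison with the value at 0 gives |f(x,u)| \<le> L |u| almost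
  everywhere.\<close>

lemma lipschitz_superposition_Lp_space_2:
  fixes \<Omega> :: "'a::euclidean_space set"
  assumes \<Omega>: "open \<Omega>" and f: "caratheodory \<Omega> f" and f0: "\<And>x. x \<in> \<Omega> \<Longrightarrow> f x 0 = 0"
    and lip: "AE x in lebesgue_on \<Omega>. L-lipschitz_on UNIV (f x)" and u: "u \<in> Lp_space 2 \<Omega>"
  shows "(\<lambda>x. f x (u x)) \<in> Lp_space 2 \<Omega>"
  unfolding Lp_space_2_iff
proof
  have Ob: "\<Omega> \<in> sets borel" using \<Omega> by simp
  show m: "(\<lambda>x. f x (u x)) \<in> borel_measurable (lebesgue_on \<Omega>)"
    by (rule superposition_measurable[OF Ob f]) (use u in \<open>simp add: Lp_space_2_iff\<close>)
  have le: "AE x in lebesgue_on \<Omega>. (f x (u x))\<^sup>2 \<le> L\<^sup>2 * (u x)\<^sup>2"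
    using lip AE_space
  proof eventually_elim
    case (elim x)
    have "dist (f x (u x)) (f x 0) \<le> L * dist (u x) 0" by (rule lipschitz_onD[OF elim(1)]) auto
    with elim(2) have "\<bar>f x (u x)\<bar> \<le> L * \<bar>u x\<bar>" using f0[of x] by (simp add: dist_real_def)
    also have "\<dots> \<le> \<bar>L * u x\<bar>" unfolding abs_mult by (intro mult_right_mono) simp_all
    finally have "\<bar>f x (u x)\<bar> \<le> \<bar>L * u x\<bar>" .
    then have "(f x (u x))\<^sup>2 \<le> (L * u x)\<^sup>2" by (rule abs_le_square_iff[THEN iffD1])
    then show ?case by (simp add: power_mult_distrib)
  qed
  have "integrable (lebesgue_on \<Omega>) (\<lambda>x. L\<^sup>2 * (u x)\<^sup>2)" using u by (simp add: Lp_space_2_iff)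
  then show "integrable (lebesgue_on \<Omega>) (\<lambda>x. (f x (u x))\<^sup>2)"
    by (rule Bochner_Integration.integrable_bound) (use m le in auto)
qed

text \<open>
  Unlike in the definition of weak solutions, the exceptional null set of times does not depend on the
  test function.
\<close>
lemma weak_solution_weak_form_at:
  fixes \<Omega> :: "'a::euclidean_space set"
  assumes \<Omega>: "open \<Omega>" and f: "caratheodory \<Omega> f" and f0: "\<And>x. x \<in> \<Omega> \<Longrightarrow> f x 0 = 0"
    and lip: "AE x in lebesgue_on \<Omega>. L-lipschitz_on UNIV (f x)"
    and u: "weak_solution_with s \<Omega> f u0 T u g"
  obtains \<eta> where "AE t in lborel. t \<in> {0<..<T} \<longrightarrow> weak_form_at s \<Omega> f (u t) (g t) (\<eta> t)"
proof -
  let ?X = "W0 s \<Omega> \<inter> Lp_space 2 \<Omega>"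
  note Qb = Q_set_borel[OF \<Omega>]
  obtain \<eta> where sf: "sign_field T u \<eta>" and eq: "\<And>\<phi>. \<phi> \<in> ?X \<Longrightarrow> AE t in lebesgue_on {0..T}.
           (LINT x|lebesgue_on \<Omega>. g t x * \<phi> x) +
           (LINT (x, y)|lebesgue_on (Q_set \<Omega>). \<eta> t x y * ((\<phi> x - \<phi> y) / kernel s x y)) =
           (LINT x|lebesgue_on \<Omega>. f x (u t x) * \<phi> x)"
    using u unfolding weak_solution_with_def by blast
  define \<zeta> where "\<zeta> t p = \<eta> t (fst p) (snd p)" for t p
  obtain D where D: "countable D" "D \<subseteq> ?X"
    and dense: "\<And>\<phi> e. \<phi> \<in> ?X \<Longrightarrow> 0 < e \<Longrightarrow>
       \<exists>d\<in>D. (LINT p|lebesgue_on (Q_set \<Omega>). \<bar>difference_quotient s (\<lambda>x. \<phi> x - d x) p\<bar>) < e \<and>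
         (LINT x|lebesgue_on \<Omega>. (\<phi> x - d x)\<^sup>2) < e"
    by (rule W0_L2_separable[OF \<Omega>, of s]) (rule that)
  have "AE t in lborel. t \<in> {0<..<T} \<longrightarrow> u t \<in> ?X"
    using u unfolding weak_solution_with_def Linf_W0_L2_def
    by (intro iffD1[OF AE_lebesgue_on_iff]) auto
  moreover have "AE t in lborel. t \<in> {0<..<T} \<longrightarrow> g t \<in> Lp_space 2 \<Omega>"
    using u unfolding weak_solution_with_def L2_L2_def
    by (intro iffD1[OF AE_lebesgue_on_iff]) auto
  moreover have "AE t in lborel. t \<in> {0<..<T} \<longrightarrow> \<zeta> t \<in> borel_measurable lebesgue \<and>
      (AE p in lebesgue. \<bar>\<zeta> t p\<bar> \<le> 1)"
  proof (rule AE_lebesgue_on_Icc_imp_Ioo)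
    have "AE t in lebesgue_on {0..T}.
        (\<lambda>(x, y). \<eta> t x y) \<in> borel_measurable lebesgue \<and>
        (AE (x, y) in lebesgue. \<bar>\<eta> t x y\<bar> \<le> 1) \<and>
        (AE (x, y) in lebesgue. \<eta> t x y = - \<eta> t y x)"
      using sf unfolding sign_field_def by (rule conjunct1)
    then show "AE t in lebesgue_on {0..T}. \<zeta> t \<in> borel_measurable lebesgue \<and> (AE p in lebesgue. \<bar>\<zeta> t p\<bar> \<le> 1)"
      by eventually_elim (simp add: \<zeta>_def[abs_def] case_prod_beta')
  qed
  moreover have "AE t in lborel. t \<in> {0<..<T} \<longrightarrow> (AE p in lborel. \<zeta> t p \<in> msign (u t (fst p) - u t (snd p)))"
  proof -
    have "AE (x, y, t) in lebesgue_on (UNIV \<times> UNIV \<times> {0..T}). \<eta> t x y \<in> msign (u t x - u t y)"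
      using sf unfolding sign_field_def by (rule conjunct2)
    then have "AE p in lborel. p \<in> UNIV \<times> UNIV \<times> {0..T} \<longrightarrow>
        (case p of (x, y, t) \<Rightarrow> \<eta> t x y \<in> msign (u t x - u t y))"
      by (rule iffD1[OF AE_lebesgue_on_iff, rotated]) (intro borel_closed closed_Times, auto)
    from AE_lborel_triple[OF this] show ?thesis
      by eventually_elim (auto simp: \<zeta>_def)
  qed
  moreover have "AE t in lborel. \<forall>d\<in>D. t \<in> {0<..<T} \<longrightarrow>
      (LINT x|lebesgue_on \<Omega>. g t x * d x) +
           (LINT p|lebesgue_on (Q_set \<Omega>). \<zeta> t p * difference_quotient s d p) =
           (LINT x|lebesgue_on \<Omega>. f x (u t x) * d x)"
    unfolding AE_ball_countable[OF D(1)]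
  proof
    fix d assume "d \<in> D"
    with D(2) have "d \<in> ?X" by blast
    from AE_lebesgue_on_Icc_imp_Ioo[OF eq[OF this]]
    show "AE t in lborel. t \<in> {0<..<T} \<longrightarrow>
      (LINT x|lebesgue_on \<Omega>. g t x * d x) +
           (LINT p|lebesgue_on (Q_set \<Omega>). \<zeta> t p * difference_quotient s d p) =
           (LINT x|lebesgue_on \<Omega>. f x (u t x) * d x)"
      by (simp add: \<zeta>_def difference_quotient_def case_prod_beta')
  qed
  ultimately have "AE t in lborel. t \<in> {0<..<T} \<longrightarrow> weak_form_at s \<Omega> f (u t) (g t) (\<zeta> t)"
  proof eventually_elim
    case (elim t)
    show ?case
    proof
      assume t: "t \<in> {0<..<T}"
      have ut: "u t \<in> ?X" and gt: "g t \<in> Lp_space 2 \<Omega>" and zm: "\<zeta> t \<in> borel_measurable lebesgue"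
        and z1: "AE p in lebesgue. \<bar>\<zeta> t p\<bar> \<le> 1"
        and zs: "AE p in lborel. \<zeta> t p \<in> msign (u t (fst p) - u t (snd p))"
        using elim t by blast+
      have eqD: "(LINT x|lebesgue_on \<Omega>. g t x * d x) +
           (LINT p|lebesgue_on (Q_set \<Omega>). \<zeta> t p * difference_quotient s d p) =
           (LINT x|lebesgue_on \<Omega>. f x (u t x) * d x)" if "d \<in> D" for d
        using elim(5) t that by blast
      \<comment> \<open>Square integrability of f(.,u) allows the two pairings to be merged on D and
        the merged pairing to be extended beyond D.\<close>
      have fu: "(\<lambda>x. f x (u t x)) \<in> Lp_space 2 \<Omega>"
        by (rule lipschitz_superposition_Lp_space_2[OF \<Omega> f f0 lip]) (use ut in auto)
      have zm': "\<zeta> t \<in> borel_measurable (lebesgue_on (Q_set \<Omega>))"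
        using zm by (rule measurable_restrict_space1)
      have z1': "AE p in lebesgue_on (Q_set \<Omega>). \<bar>\<zeta> t p\<bar> \<le> 1"
        unfolding AE_lebesgue_on_iff[OF Qb] using z1[unfolded AE_completion_iff] by eventually_elim simp
      have zs': "AE p in lebesgue_on (Q_set \<Omega>). \<zeta> t p \<in> msign (u t (fst p) - u t (snd p))"
        unfolding AE_lebesgue_on_iff[OF Qb] using zs by eventually_elim simp
      have "(LINT x|lebesgue_on \<Omega>. (g t x - f x (u t x)) * d x) +
           (LINT p|lebesgue_on (Q_set \<Omega>). \<zeta> t p * difference_quotient s d p) = 0" if d: "d \<in> D" for d
      proof -
        have "d \<in> Lp_space 2 \<Omega>" using d D(2) by blast
        then have "integrable (lebesgue_on \<Omega>) (\<lambda>x. g t x * d x)"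
          "integrable (lebesgue_on \<Omega>) (\<lambda>x. f x (u t x) * d x)"
          using gt fu by (simp_all add: Lp_space_2_iff integrable_mult_of_squares)
        then show ?thesis using eqD[OF d] by (simp add: left_diff_distrib)
      qed
      from weak_form_extends[OF D(2) \<Omega> dense Lp_space_2_diff[OF gt fu] zm' z1' this]
      show "weak_form_at s \<Omega> f (u t) (g t) (\<zeta> t)"
        unfolding weak_form_at_def using ut gt zm' z1' zs' by blast
    qed
  qed
  then show ?thesis by (rule that)
qed

lemma msign_monotone: "a \<in> msign p \<Longrightarrow> b \<in> msign q \<Longrightarrow> 0 \<le> (a - b) * (p - q)"
  by (auto simp: msign_def zero_le_mult_iff split: if_splits)

text \<open>This is the differential inequality for half of the squared L^2 norm of u - v, frozen at
  one time. Both equations are tested with w = u - v; each nonlocal term is integrable on its own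
  because |\<eta>|, |\<xi>| \<le> 1 and w lies in \<open>W0\<close>, so their difference can be
  formed under one integral and monotonicity applied there.\<close>

lemma weak_form_at_difference:
  fixes \<Omega> :: "'a::euclidean_space set"
  assumes \<Omega>: "open \<Omega>" and f: "caratheodory \<Omega> f" and f0: "\<And>x. x \<in> \<Omega> \<Longrightarrow> f x 0 = 0"
    and lip: "AE x in lebesgue_on \<Omega>. L-lipschitz_on UNIV (f x)"
    and u: "weak_form_at s \<Omega> f u g \<eta>" and v: "weak_form_at s \<Omega> f v h \<xi>"
  shows "(LINT x|lebesgue_on \<Omega>. (g x - h x) * (u x - v x)) \<le> L * (LINT x|lebesgue_on \<Omega>. (u x - v x)\<^sup>2)"
proof -
  define w where "w x = u x - v x" for x
  have uX: "u \<in> W0 s \<Omega>" "u \<in> Lp_space 2 \<Omega>" and vX: "v \<in> W0 s \<Omega>" "v \<in> Lp_space 2 \<Omega>"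
    and gh: "g \<in> Lp_space 2 \<Omega>" "h \<in> Lp_space 2 \<Omega>"
    using u v by (auto simp: weak_form_at_def)
  have wX: "w \<in> W0 s \<Omega>" "w \<in> Lp_space 2 \<Omega>"
    unfolding w_def using W0_diff[OF \<Omega> uX(1) vX(1)] Lp_space_2_diff[OF uX(2) vX(2)] by simp_all
  have fu: "(\<lambda>x. f x (u x)) \<in> Lp_space 2 \<Omega>" "(\<lambda>x. f x (v x)) \<in> Lp_space 2 \<Omega>"
    by (rule lipschitz_superposition_Lp_space_2[OF \<Omega> f f0 lip]; use uX vX in simp)+
  have i: "integrable (lebesgue_on \<Omega>) (\<lambda>x. k x * w x)" if "k \<in> Lp_space 2 \<Omega>" for k
    using that wX(2) by (simp add: Lp_space_2_iff integrable_mult_of_squares)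
  note W = W0_difference_quotient[OF \<Omega> wX(1)]
  have \<eta>: "\<eta> \<in> borel_measurable (lebesgue_on (Q_set \<Omega>))" "AE p in lebesgue_on (Q_set \<Omega>). \<bar>\<eta> p\<bar> \<le> 1"
    "AE p in lebesgue_on (Q_set \<Omega>). \<eta> p \<in> msign (u (fst p) - u (snd p))"
    and \<xi>: "\<xi> \<in> borel_measurable (lebesgue_on (Q_set \<Omega>))" "AE p in lebesgue_on (Q_set \<Omega>). \<bar>\<xi> p\<bar> \<le> 1"
    "AE p in lebesgue_on (Q_set \<Omega>). \<xi> p \<in> msign (v (fst p) - v (snd p))"
    using u v by (simp_all add: weak_form_at_def)
  have "(LINT x|lebesgue_on \<Omega>. (g x - f x (u x)) * w x) +
        (LINT p|lebesgue_on (Q_set \<Omega>). \<eta> p * difference_quotient s w p) = 0"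
    "(LINT x|lebesgue_on \<Omega>. (h x - f x (v x)) * w x) +
        (LINT p|lebesgue_on (Q_set \<Omega>). \<xi> p * difference_quotient s w p) = 0"
    using u v wX unfolding weak_form_at_def by blast+
  then have "(LINT x|lebesgue_on \<Omega>. g x * w x) - (LINT x|lebesgue_on \<Omega>. h x * w x) =
      (LINT x|lebesgue_on \<Omega>. f x (u x) * w x) - (LINT x|lebesgue_on \<Omega>. f x (v x) * w x) -
      ((LINT p|lebesgue_on (Q_set \<Omega>). \<eta> p * difference_quotient s w p) -
       (LINT p|lebesgue_on (Q_set \<Omega>). \<xi> p * difference_quotient s w p))"
    using i[OF gh(1)] i[OF gh(2)] i[OF fu(1)] i[OF fu(2)] by (simp add: left_diff_distrib)
  moreover have "0 \<le> (LINT p|lebesgue_on (Q_set \<Omega>). \<eta> p * difference_quotient s w p) -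
       (LINT p|lebesgue_on (Q_set \<Omega>). \<xi> p * difference_quotient s w p)"
  proof -
    have "0 \<le> (LINT p|lebesgue_on (Q_set \<Omega>). \<eta> p * difference_quotient s w p - \<xi> p * difference_quotient s w p)"
    proof (rule integral_nonneg_AE)
      show "AE p in lebesgue_on (Q_set \<Omega>). 0 \<le> \<eta> p * difference_quotient s w p - \<xi> p * difference_quotient s w p"
        using \<eta>(3) \<xi>(3)
      proof eventually_elim
        case (elim p)
        from msign_monotone[OF this]
        have "0 \<le> (\<eta> p - \<xi> p) * (w (fst p) - w (snd p))" by (simp add: w_def algebra_simps)
        then have "0 \<le> (\<eta> p - \<xi> p) * (w (fst p) - w (snd p)) / kernel s (fst p) (snd p)"
          by (simp add: kernel_def)
        then have "0 \<le> (\<eta> p - \<xi> p) * difference_quotient s w p"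
          by (simp only: difference_quotient_def times_divide_eq_right)
        then show ?case by (simp only: left_diff_distrib)
      qed
    qed
    then show ?thesis
      using integrable_bounded_mult(1)[OF W \<eta>(1,2)] integrable_bounded_mult(1)[OF W \<xi>(1,2)] by simp
  qed
  moreover have "(LINT x|lebesgue_on \<Omega>. f x (u x) * w x) - (LINT x|lebesgue_on \<Omega>. f x (v x) * w x) \<le>
      L * (LINT x|lebesgue_on \<Omega>. (w x)\<^sup>2)"
  proof -
    have "(LINT x|lebesgue_on \<Omega>. f x (u x) * w x - f x (v x) * w x) \<le> (LINT x|lebesgue_on \<Omega>. L * (w x)\<^sup>2)"
    proof (rule integral_mono_AE)
      show "AE x in lebesgue_on \<Omega>. f x (u x) * w x - f x (v x) * w x \<le> L * (w x)\<^sup>2"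
        using lip
      proof eventually_elim
        case (elim x)
        have "dist (f x (u x)) (f x (v x)) \<le> L * dist (u x) (v x)" by (rule lipschitz_onD[OF elim]) auto
        then have "\<bar>f x (u x) - f x (v x)\<bar> * \<bar>w x\<bar> \<le> (L * \<bar>w x\<bar>) * \<bar>w x\<bar>"
          by (intro mult_right_mono) (simp_all add: dist_real_def w_def)
        moreover have "(f x (u x) - f x (v x)) * w x \<le> \<bar>f x (u x) - f x (v x)\<bar> * \<bar>w x\<bar>"
          by (metis abs_ge_self abs_mult)
        ultimately show ?case by (simp add: power2_eq_square left_diff_distrib mult.assoc)
      qed
    qed (use i[OF fu(1)] i[OF fu(2)] wX(2) in \<open>simp_all add: Lp_space_2_iff\<close>)
    then show ?thesis using i[OF fu(1)] i[OF fu(2)] by simp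
  qed
  ultimately show ?thesis
    using i[OF gh(1)] i[OF gh(2)] by (simp add: left_diff_distrib w_def)
qed

section \<open>Energy identity and uniqueness\<close>

text \<open>The bound on z holds only almost everywhere, so the argument runs on the primitive Y of
  the continuous function y. From y \<le> c Y and Y' = y, the function e^(-ct) Y(t) is nonincreasing
  and starts at 0; hence Y \<le> 0, and y is squeezed between 0 and c Y.\<close>

lemma gronwall_integral_zero:
  fixes y z :: "real \<Rightarrow> real"
  assumes z: "integrable lborel z" and y: "\<And>t. t \<in> {0..T} \<Longrightarrow> y t = (LBINT \<tau>:{0..t}. z \<tau>)"
    and nonneg: "\<And>t. t \<in> {0..T} \<Longrightarrow> 0 \<le> y t" and c: "0 \<le> c"
    and le: "AE \<tau> in lborel. \<tau> \<in> {0<..<T} \<longrightarrow> z \<tau> \<le> c * y \<tau>" and t: "t \<in> {0..T}"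
  shows "y t = 0"
proof -
  have sz: "set_integrable lborel S z" if "S \<in> sets borel" for S
    using integrable_mult_indicator[OF _ z] that by (simp add: set_integrable_def)
  have "continuous_on {0..T} (\<lambda>t. integral {0..t} z)"
    by (rule indefinite_integral_continuous_1) (rule set_borel_integral_eq_integral[OF sz], simp)
  moreover have yz: "y t = integral {0..t} z" if "t \<in> {0..T}" for t
    using y[OF that] set_borel_integral_eq_integral(2)[OF sz] by simp
  have "continuous_on {0..T} y \<longleftrightarrow> continuous_on {0..T} (\<lambda>t. integral {0..t} z)"
    by (rule continuous_on_cong[OF refl yz])
  ultimately have yc: "continuous_on {0..T} y" by blast
  define Y where "Y t = integral {0..t} y" for t
  have yi: "y integrable_on {0..T}" by (rule integrable_continuous_real[OF yc])
  have Yc: "continuous_on {0..T} Y" unfolding Y_def by (rule indefinite_integral_continuous_1[OF yi])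
  have yY: "y t \<le> c * Y t" if t: "t \<in> {0..T}" for t
  proof -
    have sy: "set_integrable lborel {0..t} y"
      unfolding set_integrable_def
      by (rule borel_integrable_compact) (use t in \<open>auto intro: continuous_on_subset[OF yc]\<close>)
    have "y t = (LBINT \<tau>. indicator {0..t} \<tau> *\<^sub>R z \<tau>)" using y[OF t] by (simp add: set_lebesgue_integral_def)
    also have "\<dots> \<le> (LBINT \<tau>. c * (indicator {0..t} \<tau> *\<^sub>R y \<tau>))"
    proof (rule integral_mono_AE)
      show "integrable lborel (\<lambda>\<tau>. indicator {0..t} \<tau> *\<^sub>R z \<tau>)"
        using sz[of "{0..t}"] by (simp add: set_integrable_def)
      show "integrable lborel (\<lambda>\<tau>. c * (indicator {0..t} \<tau> *\<^sub>R y \<tau>))"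
        using sy unfolding set_integrable_def by (rule integrable_mult_right)
      \<comment> \<open>The hypothesis covers the open interval only; the endpoints 0 and T are
        removed as null sets.\<close>
      show "AE \<tau> in lborel. indicator {0..t} \<tau> *\<^sub>R z \<tau> \<le> c * (indicator {0..t} \<tau> *\<^sub>R y \<tau>)"
        using le AE_lborel_singleton[of 0] AE_lborel_singleton[of T]
        by eventually_elim (use t in \<open>auto simp: indicator_def\<close>)
    qed
    also have "\<dots> = c * (LBINT \<tau>:{0..t}. y \<tau>)" by (simp add: set_lebesgue_integral_def)
    also have "(LBINT \<tau>:{0..t}. y \<tau>) = Y t"
      unfolding Y_def by (rule set_borel_integral_eq_integral(2)[OF sy])
    finally show ?thesis .
  qed
  have "exp (- c * t) * Y t \<le> exp (- c * 0) * Y 0"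
  proof (rule DERIV_nonpos_imp_decreasing_open[where f = "\<lambda>t. exp (- c * t) * Y t"])
    show "0 \<le> t" using t by simp
    show "continuous_on {0..t} (\<lambda>t. exp (- c * t) * Y t)"
      using t by (intro continuous_intros continuous_on_subset[OF Yc]) auto
    fix x assume x: "0 < x" "x < t"
    have "(Y has_real_derivative y x) (at x within {0..T})"
      unfolding Y_def by (rule integral_has_real_derivative[OF yc]) (use x t in auto)
    then have D: "(Y has_real_derivative y x) (at x)"
      using x t by (simp add: at_within_Icc_at)
    have E: "((\<lambda>t. exp (- c * t)) has_real_derivative exp (- c * x) * (- c)) (at x)"
      by (auto intro!: derivative_eq_intros)
    have "((\<lambda>t. exp (- c * t) * Y t) has_real_derivative exp (- c * x) * (y x - c * Y x)) (at x)"
      by (rule DERIV_cong[OF DERIV_mult[OF E D]]) (simp add: algebra_simps)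
    moreover have "exp (- c * x) * (y x - c * Y x) \<le> 0"
      using yY[of x] x t by (intro mult_nonneg_nonpos) auto
    ultimately show "\<exists>D. ((\<lambda>t. exp (- c * t) * Y t) has_real_derivative D) (at x) \<and> D \<le> 0" by blast
  qed
  then have "exp (- c * t) * Y t \<le> 0" by (simp add: Y_def)
  then have "Y t \<le> 0" by (simp add: mult_le_0_iff not_le)
  then have "c * Y t \<le> 0" using c by (simp add: mult_nonneg_nonpos)
  then show ?thesis using yY[OF t] nonneg[OF t] by linarith
qed

text \<open>The square is a double integral over [0,t] \<times> [0,t]. Cut along the diagonal, its
  two triangles contribute equally by symmetry, and on the lower one the inner integral is the
  primitive at \<tau>.\<close>

lemma square_indefinite_integral:
  fixes g :: "real \<Rightarrow> real"
  assumes g: "integrable lborel g"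
  shows "(LBINT \<tau>:{0..t}. g \<tau>)\<^sup>2 = 2 * (LBINT \<tau>:{0..t}. g \<tau> * (LBINT \<sigma>:{0..\<tau>}. g \<sigma>))"
proof -
  define a where "a \<tau> = indicator {0..t} \<tau> *\<^sub>R g \<tau>" for \<tau>
  have ai: "integrable lborel a"
    unfolding a_def by (rule integrable_mult_indicator[OF _ g]) simp
  note am[measurable] = borel_measurable_integrable[OF ai]
  define b1 where "b1 \<tau> \<sigma> = (if \<sigma> \<le> \<tau> then a \<tau> * a \<sigma> else 0)" for \<tau> \<sigma>
  define b2 where "b2 \<tau> \<sigma> = (if \<tau> < \<sigma> then a \<tau> * a \<sigma> else 0)" for \<tau> \<sigma>
  have pr: "integrable (lborel \<Otimes>\<^sub>M lborel) (\<lambda>p. a (fst p) * a (snd p))"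
  proof (rule lborel_pair.Fubini_integrable)
    show "integrable lborel (\<lambda>x. LBINT y. norm (a (fst (x, y)) * a (snd (x, y))))"
      using ai by (simp add: abs_mult)
    show "AE x in lborel. integrable lborel (\<lambda>y. a (fst (x, y)) * a (snd (x, y)))"
      using ai by (intro AE_I2) simp
  qed measurable
  have "case_prod b1 \<in> borel_measurable (lborel \<Otimes>\<^sub>M lborel)"
    unfolding b1_def[abs_def] by measurable
  then have b1i: "integrable (lborel \<Otimes>\<^sub>M lborel) (case_prod b1)"
    by (rule Bochner_Integration.integrable_bound[OF pr]) (auto simp: b1_def)
  have "case_prod b2 \<in> borel_measurable (lborel \<Otimes>\<^sub>M lborel)"
    unfolding b2_def[abs_def] by measurable
  then have b2i: "integrable (lborel \<Otimes>\<^sub>M lborel) (case_prod b2)"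
    by (rule Bochner_Integration.integrable_bound[OF pr]) (auto simp: b2_def)
  have sec: "integrable lborel (b1 \<tau>)" "integrable lborel (b2 \<tau>)" for \<tau>
  proof -
    have p: "integrable lborel (\<lambda>\<sigma>. a \<tau> * a \<sigma>)" using ai by simp
    have m: "b1 \<tau> \<in> borel_measurable lborel" "b2 \<tau> \<in> borel_measurable lborel"
      unfolding b1_def[abs_def] b2_def[abs_def] by measurable
    show "integrable lborel (b1 \<tau>)" "integrable lborel (b2 \<tau>)"
      by (rule Bochner_Integration.integrable_bound[OF p m(1)], simp add: b1_def,
          rule Bochner_Integration.integrable_bound[OF p m(2)], simp add: b2_def)
  qed
  have "(LBINT \<tau>:{0..t}. g \<tau>)\<^sup>2 = (LBINT \<tau>. LBINT \<sigma>. a \<tau> * a \<sigma>)"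
  proof -
    have "(LBINT \<tau>:{0..t}. g \<tau>) = (LBINT \<tau>. a \<tau>)" by (simp only: set_lebesgue_integral_def a_def)
    then show ?thesis by (simp add: power2_eq_square)
  qed
  also have "\<dots> = (LBINT \<tau>. (LBINT \<sigma>. b1 \<tau> \<sigma>) + (LBINT \<sigma>. b2 \<tau> \<sigma>))"
  proof (rule Bochner_Integration.integral_cong)
    fix \<tau>
    have "(LBINT \<sigma>. a \<tau> * a \<sigma>) = (LBINT \<sigma>. b1 \<tau> \<sigma> + b2 \<tau> \<sigma>)"
      by (rule Bochner_Integration.integral_cong) (auto simp: b1_def b2_def)
    then show "(LBINT \<sigma>. a \<tau> * a \<sigma>) = (LBINT \<sigma>. b1 \<tau> \<sigma>) + (LBINT \<sigma>. b2 \<tau> \<sigma>)"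
      using sec[of \<tau>] by simp
  qed simp
  also have "\<dots> = (LBINT \<tau>. LBINT \<sigma>. b1 \<tau> \<sigma>) + (LBINT \<tau>. LBINT \<sigma>. b2 \<tau> \<sigma>)"
    using lborel_pair.integrable_fst[OF b1i] lborel_pair.integrable_fst[OF b2i] by simp
  also have "(LBINT \<tau>. LBINT \<sigma>. b2 \<tau> \<sigma>) = (LBINT \<sigma>. LBINT \<tau>. b2 \<tau> \<sigma>)"
    by (rule lborel_pair.Fubini_integral[OF b2i, symmetric])
  also have "\<dots> = (LBINT \<tau>. LBINT \<sigma>. b1 \<tau> \<sigma>)"
  proof (rule Bochner_Integration.integral_cong)
    fix \<tau>
    show "(LBINT \<sigma>. b2 \<sigma> \<tau>) = (LBINT \<sigma>. b1 \<tau> \<sigma>)"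
    proof (rule integral_cong_AE)
      \<comment> \<open>The diagonal belongs to b1 only, so after exchanging the variables the two
        differ at most at \<sigma> = \<tau>.\<close>
      show "AE \<sigma> in lborel. b2 \<sigma> \<tau> = b1 \<tau> \<sigma>"
        using AE_lborel_singleton[of \<tau>] by eventually_elim (auto simp: b1_def b2_def)
    qed (auto simp: b1_def b2_def)
  qed simp
  finally have "(LBINT \<tau>:{0..t}. g \<tau>)\<^sup>2 = 2 * (LBINT \<tau>. LBINT \<sigma>. b1 \<tau> \<sigma>)" by simp
  also have "(LBINT \<tau>. LBINT \<sigma>. b1 \<tau> \<sigma>) = (LBINT \<tau>:{0..t}. g \<tau> * (LBINT \<sigma>:{0..\<tau>}. g \<sigma>))"
    unfolding set_lebesgue_integral_def
  proof (rule Bochner_Integration.integral_cong)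
    fix \<tau>
    have "b1 \<tau> \<sigma> = a \<tau> * (indicator {0..\<tau>} \<sigma> *\<^sub>R g \<sigma>)" for \<sigma>
      by (auto simp: b1_def a_def indicator_def)
    then have "(LBINT \<sigma>. b1 \<tau> \<sigma>) = a \<tau> * (LBINT \<sigma>. indicator {0..\<tau>} \<sigma> *\<^sub>R g \<sigma>)" by simp
    then show "(LBINT \<sigma>. b1 \<tau> \<sigma>) =
        indicator {0..t} \<tau> *\<^sub>R (g \<tau> * (LBINT \<sigma>. indicator {0..\<tau>} \<sigma> *\<^sub>R g \<sigma>))"
      by (simp add: a_def)
  qed simp
  finally show ?thesis .
qed

text \<open>Bounding |g(\<tau>) g(\<sigma>)| by g(\<tau>)^2 + g(\<sigma>)^2 and integrating in
  \<sigma> over (0,T) gives the right-hand side. It is made of squares alone, so for g = G(.,x) it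
  is integrable in (\<tau>,x).\<close>

lemma abs_mult_indefinite_integral_le:
  fixes g :: "real \<Rightarrow> real"
  assumes g: "integrable lborel g" "integrable lborel (\<lambda>\<tau>. (g \<tau>)\<^sup>2)"
    and g0: "\<And>\<tau>. \<tau> \<notin> {0<..<T} \<Longrightarrow> g \<tau> = 0" and T: "0 \<le> T"
  shows "\<bar>g \<tau> * (LBINT \<sigma>:{0..\<tau>}. g \<sigma>)\<bar> \<le> T * (g \<tau>)\<^sup>2 + indicator {0<..<T} \<tau> * (LBINT \<sigma>. (g \<sigma>)\<^sup>2)"
proof (cases "\<tau> \<in> {0<..<T}")
  case True
  have i: "integrable lborel (\<lambda>\<sigma>. g \<tau> * (indicator {0..\<tau>} \<sigma> *\<^sub>R g \<sigma>))"
    by (intro integrable_mult_right integrable_mult_indicator g) simp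
  have "\<bar>g \<tau> * (LBINT \<sigma>:{0..\<tau>}. g \<sigma>)\<bar> = \<bar>LBINT \<sigma>. g \<tau> * (indicator {0..\<tau>} \<sigma> *\<^sub>R g \<sigma>)\<bar>"
    by (simp add: set_lebesgue_integral_def)
  also have "\<dots> \<le> (LBINT \<sigma>. \<bar>g \<tau> * (indicator {0..\<tau>} \<sigma> *\<^sub>R g \<sigma>)\<bar>)" by (rule integral_abs_bound)
  also have "\<dots> \<le> (LBINT \<sigma>. (g \<tau>)\<^sup>2 * indicator {0<..<T} \<sigma> + (g \<sigma>)\<^sup>2)"
  proof (rule integral_mono)
    show "integrable lborel (\<lambda>\<sigma>. \<bar>g \<tau> * (indicator {0..\<tau>} \<sigma> *\<^sub>R g \<sigma>)\<bar>)" using i by (rule integrable_abs)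
    show "integrable lborel (\<lambda>\<sigma>. (g \<tau>)\<^sup>2 * indicator {0<..<T} \<sigma> + (g \<sigma>)\<^sup>2)"
      using g T by (intro Bochner_Integration.integrable_add integrable_mult_right) simp_all
    fix \<sigma>
    show "\<bar>g \<tau> * (indicator {0..\<tau>} \<sigma> *\<^sub>R g \<sigma>)\<bar> \<le> (g \<tau>)\<^sup>2 * indicator {0<..<T} \<sigma> + (g \<sigma>)\<^sup>2"
    proof (cases "\<sigma> \<in> {0<..<T}")
      case True
      have "0 \<le> (\<bar>g \<tau>\<bar> - \<bar>g \<sigma>\<bar>)\<^sup>2 + (g \<tau>)\<^sup>2 + (g \<sigma>)\<^sup>2" by simp
      then have "\<bar>g \<tau> * g \<sigma>\<bar> \<le> (g \<tau>)\<^sup>2 + (g \<sigma>)\<^sup>2"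
        by (simp add: power2_eq_square algebra_simps abs_mult)
      then show ?thesis using True by (auto simp: indicator_def)
    next
      case False
      then have "g \<sigma> = 0" by (rule g0)
      then show ?thesis by simp
    qed
  qed
  also have "\<dots> = (g \<tau>)\<^sup>2 * T + (LBINT \<sigma>. (g \<sigma>)\<^sup>2)"
    using g T by (subst Bochner_Integration.integral_add) simp_all
  finally show ?thesis using True by (simp add: mult.commute)
next
  case False
  then have "g \<tau> = 0" by (rule g0)
  then show ?thesis by (simp add: indicator_def)
qed

text \<open>Integrate \<open>square_indefinite_integral\<close> over x and exchange the integrals.
  Fubini needs G W to be integrable in space-time, which
  \<open>abs_mult_indefinite_integral_le\<close> provides with the dominating function T G^2 + V on
  (0,T).\<close>

lemma square_integral_in_time:
  fixes G :: "real \<times> 'a::euclidean_space \<Rightarrow> real"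
  assumes G: "integrable lborel G" "integrable lborel (\<lambda>p. (G p)\<^sup>2)"
    and G0: "\<And>\<tau> x. \<tau> \<notin> {0<..<T} \<Longrightarrow> G (\<tau>, x) = 0" and T: "0 \<le> T"
  defines "W \<equiv> \<lambda>t x. LBINT \<tau>:{0..t}. G (\<tau>, x)"
  shows "integrable lborel (\<lambda>\<tau>. LBINT x. G (\<tau>, x) * W \<tau> x)"
    "integrable lborel (\<lambda>x. (W t x)\<^sup>2)"
    "(LBINT x. (W t x)\<^sup>2) = 2 * (LBINT \<tau>:{0..t}. LBINT x. G (\<tau>, x) * W \<tau> x)"
proof -
  have Gp: "integrable (lborel \<Otimes>\<^sub>M lborel) G" "integrable (lborel \<Otimes>\<^sub>M lborel) (\<lambda>p. (G p)\<^sup>2)"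
    using G unfolding lborel_prod .
  note Gm[measurable] = borel_measurable_integrable[OF Gp(1)]
  have [measurable]: "(\<lambda>p. W (fst p) (snd p)) \<in> borel_measurable (lborel \<Otimes>\<^sub>M lborel)"
  proof -
    \<comment> \<open>The interval of integration depends on \<tau>; writing it as a condition on
      \<sigma> and \<tau> shows joint measurability of the integrand.\<close>
    have "W \<tau> x = (LBINT \<sigma>. if 0 \<le> \<sigma> \<and> \<sigma> \<le> \<tau> then G (\<sigma>, x) else 0)" for \<tau> x
      unfolding W_def set_lebesgue_integral_def
      by (rule Bochner_Integration.integral_cong) (auto simp: indicator_def)
    then show ?thesis by simp
  qed
  have [measurable]: "W t \<in> borel_measurable lborel"
    unfolding W_def set_lebesgue_integral_def by measurable
  define V where "V x = (LBINT \<sigma>. (G (\<sigma>, x))\<^sup>2)" for x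
  have Vi: "integrable lborel V"
    unfolding V_def using lborel_pair.integrable_snd[of "\<lambda>\<sigma> x. (G (\<sigma>, x))\<^sup>2"] Gp(2)
    by (simp add: case_prod_beta')
  note [measurable] = borel_measurable_integrable[OF Vi]
  have V0: "0 \<le> V x" for x unfolding V_def by simp
  have sec: "AE x in lborel. integrable lborel (\<lambda>\<tau>. G (\<tau>, x))"
    "AE x in lborel. integrable lborel (\<lambda>\<tau>. (G (\<tau>, x))\<^sup>2)"
    using lborel_pair.AE_integrable_snd[of "\<lambda>\<tau> x. G (\<tau>, x)"] Gp(1)
      lborel_pair.AE_integrable_snd[of "\<lambda>\<tau> x. (G (\<tau>, x))\<^sup>2"] Gp(2)
    by (simp_all add: case_prod_beta')
  have tV: "integrable (lborel \<Otimes>\<^sub>M lborel) (\<lambda>p. indicator {0<..<T} (fst p) * V (snd p))"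
  proof (rule lborel_pair.Fubini_integrable)
    show "integrable lborel (\<lambda>\<tau>. LBINT x. norm (indicator {0<..<T} (fst (\<tau>, x)) * V (snd (\<tau>, x))))"
      using T by (simp add: abs_mult)
    show "AE \<tau> in lborel. integrable lborel (\<lambda>x. indicator {0<..<T} (fst (\<tau>, x)) * V (snd (\<tau>, x)))"
      using Vi by (intro AE_I2) simp
  qed measurable
  have Hi: "integrable (lborel \<Otimes>\<^sub>M lborel) (\<lambda>p. G p * W (fst p) (snd p))"
  proof (rule Bochner_Integration.integrable_bound)
    show "integrable (lborel \<Otimes>\<^sub>M lborel) (\<lambda>p. T * (G p)\<^sup>2 + indicator {0<..<T} (fst p) * V (snd p))"
      using Gp(2) tV by simp
    have "AE x in lborel. \<forall>\<tau>. \<bar>G (\<tau>, x) * W \<tau> x\<bar> \<le> T * (G (\<tau>, x))\<^sup>2 + indicator {0<..<T} \<tau> * V x"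
      using sec
    proof eventually_elim
      case (elim x)
      show ?case
        unfolding W_def V_def
        using abs_mult_indefinite_integral_le[of "\<lambda>\<tau>. G (\<tau>, x)" T, OF elim G0 T] by blast
    qed
    from AE_lborel_fst_snd(2)[OF this, where 'b = real]
    show "AE p in lborel \<Otimes>\<^sub>M lborel. norm (G p * W (fst p) (snd p)) \<le>
        norm (T * (G p)\<^sup>2 + indicator {0<..<T} (fst p) * V (snd p))"
      unfolding lborel_prod
    proof eventually_elim
      case (elim p)
      then have "\<bar>G p * W (fst p) (snd p)\<bar> \<le> T * (G p)\<^sup>2 + indicator {0<..<T} (fst p) * V (snd p)"
        by (metis prod.collapse)
      then show ?case by simp
    qed
  qed measurable
  then have Hi': "integrable (lborel \<Otimes>\<^sub>M lborel) (\<lambda>(\<tau>, x). G (\<tau>, x) * W \<tau> x)"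
    by (simp add: case_prod_beta')
  from lborel_pair.integrable_fst[OF Hi']
  show "integrable lborel (\<lambda>\<tau>. LBINT x. G (\<tau>, x) * W \<tau> x)" .
  have Hti: "integrable (lborel \<Otimes>\<^sub>M lborel) (\<lambda>(\<tau>, x). indicator {0..t} \<tau> *\<^sub>R (G (\<tau>, x) * W \<tau> x))"
    by (rule Bochner_Integration.integrable_bound[OF Hi]) (auto simp: indicator_def)
  have sq: "AE x in lborel. (W t x)\<^sup>2 = 2 * (LBINT \<tau>. indicator {0..t} \<tau> *\<^sub>R (G (\<tau>, x) * W \<tau> x))"
    using sec(1)
  proof eventually_elim
    case (elim x)
    from square_indefinite_integral[OF this, of t] show ?case
      by (simp add: W_def set_lebesgue_integral_def)
  qed
  have i: "integrable lborel (\<lambda>x. 2 * (LBINT \<tau>. indicator {0..t} \<tau> *\<^sub>R (G (\<tau>, x) * W \<tau> x)))"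
    using lborel_pair.integrable_snd[OF Hti] by simp
  show "integrable lborel (\<lambda>x. (W t x)\<^sup>2)"
    by (rule integrable_cong_AE_imp[OF i]) (use sq in \<open>auto elim: eventually_mono\<close>)
  have "(LBINT x. (W t x)\<^sup>2) = (LBINT x. 2 * (LBINT \<tau>. indicator {0..t} \<tau> *\<^sub>R (G (\<tau>, x) * W \<tau> x)))"
    by (rule integral_cong_AE) (use sq i in auto)
  also have "\<dots> = 2 * (LBINT \<tau>. LBINT x. indicator {0..t} \<tau> *\<^sub>R (G (\<tau>, x) * W \<tau> x))"
    using lborel_pair.Fubini_integral[OF Hti] by simp
  finally show "(LBINT x. (W t x)\<^sup>2) = 2 * (LBINT \<tau>:{0..t}. LBINT x. G (\<tau>, x) * W \<tau> x)"
    by (simp add: set_lebesgue_integral_def)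
qed

section \<open>Borel representatives of weak solutions and uniqueness\<close>

lemma W0_norm_nonneg: "0 \<le> W0_norm s \<Omega> u"
  unfolding W0_norm_def by (rule Bochner_Integration.integral_nonneg) (auto simp: kernel_def)

text \<open>The slice bound is the constant K^2 for u, integrable because (0,T) is bounded, and the
  squared norm itself for g. Nonnegativity of the W0 norm isolates the L^2 norm in the bound on the
  sum.\<close>

lemma weak_solution_L2_representatives:
  fixes \<Omega> :: "'a::euclidean_space set"
  assumes \<Omega>: "open \<Omega>" and u: "weak_solution_with s \<Omega> f u0 T u g"
  obtains U G where "L2_representative \<Omega> T u U" "L2_representative \<Omega> T g G"
proof -
  have lu: "Linf_W0_L2 s \<Omega> T u" and lg: "L2_L2 \<Omega> T g"
    using u by (simp_all add: weak_solution_with_def)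
  have ju: "jointly_measurable T UNIV u"
    and uX: "AE t in lebesgue_on {0<..<T}. u t \<in> W0 s \<Omega> \<inter> Lp_space 2 \<Omega>"
    using lu by (simp_all add: Linf_W0_L2_def)
  obtain K where K: "AE t in lebesgue_on {0<..<T}. W0_norm s \<Omega> (u t) + Lp_norm 2 \<Omega> (u t) \<le> K"
    using lu by (auto simp: Linf_W0_L2_def)
  have uK: "AE t in lebesgue_on {0<..<T}. u t \<in> Lp_space 2 \<Omega> \<and> (Lp_norm 2 \<Omega> (u t))\<^sup>2 \<le> K\<^sup>2"
    using uX K
  proof eventually_elim
    case (elim t)
    have "0 \<le> Lp_norm 2 \<Omega> (u t)" by (simp add: Lp_norm_def)
    moreover have "Lp_norm 2 \<Omega> (u t) \<le> K" using elim(2) W0_norm_nonneg[of s \<Omega> "u t"] by linarith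
    ultimately show ?case using elim(1) by (simp add: power_mono)
  qed
  have "integrable (lebesgue_on {0<..<T}) (\<lambda>t. K\<^sup>2)"
    using integrable_lebesgue_on_AE_eq[of "{0<..<T}" "\<lambda>t. K\<^sup>2" "\<lambda>t. K\<^sup>2"] by (cases "0 \<le> T") simp_all
  then obtain U where U: "L2_representative \<Omega> T u U"
    by (rule L2_representative_exists[OF \<Omega> open_UNIV subset_UNIV ju uK])
  have jg: "jointly_measurable T \<Omega> g" and gX: "AE t in lebesgue_on {0<..<T}. g t \<in> Lp_space 2 \<Omega>"
    and gi: "integrable (lebesgue_on {0<..<T}) (\<lambda>t. (Lp_norm 2 \<Omega> (g t))\<^sup>2)"
    using lg by (simp_all add: L2_L2_def)
  have gK: "AE t in lebesgue_on {0<..<T}. g t \<in> Lp_space 2 \<Omega> \<and> (Lp_norm 2 \<Omega> (g t))\<^sup>2 \<le> (Lp_norm 2 \<Omega> (g t))\<^sup>2"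
    using gX by simp
  obtain G where G: "L2_representative \<Omega> T g G"
    by (rule L2_representative_exists[OF \<Omega> \<Omega> subset_refl jg gK gi])
  from U G show ?thesis by (rule that)
qed

lemma weak_solution_unique:
  fixes \<Omega> :: "'a::euclidean_space set"
  assumes \<Omega>: "open \<Omega>" "bounded \<Omega>" and f: "caratheodory \<Omega> f" and f0: "\<And>x. x \<in> \<Omega> \<Longrightarrow> f x 0 = 0"
    and lip: "AE x in lebesgue_on \<Omega>. L-lipschitz_on UNIV (f x)"
    and s: "0 < s" "s < 1" and T: "0 < T"
    and u: "weak_solution_with s \<Omega> f u0 T u g" and v: "weak_solution_with s \<Omega> f u0 T v h"
    and t: "t \<in> {0..T}"
  shows "AE x in lebesgue_on \<Omega>. u t x = v t x"
proof -
  have Ob: "\<Omega> \<in> sets borel" using \<Omega> by simp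
  obtain U Gu where U: "L2_representative \<Omega> T u U" and Gu: "L2_representative \<Omega> T g Gu"
    by (rule weak_solution_L2_representatives[OF \<Omega>(1) u])
  obtain V Gv where V: "L2_representative \<Omega> T v V" and Gv: "L2_representative \<Omega> T h Gv"
    by (rule weak_solution_L2_representatives[OF \<Omega>(1) v])
  obtain \<eta> where \<eta>: "AE t in lborel. t \<in> {0<..<T} \<longrightarrow> weak_form_at s \<Omega> f (u t) (g t) (\<eta> t)"
    by (rule weak_solution_weak_form_at[OF \<Omega>(1) f f0 lip u])
  obtain \<xi> where \<xi>: "AE t in lborel. t \<in> {0<..<T} \<longrightarrow> weak_form_at s \<Omega> f (v t) (h t) (\<xi> t)"
    by (rule weak_solution_weak_form_at[OF \<Omega>(1) f f0 lip v])
  \<comment> \<open>The exponent 1 is below N / (N - s) because 0 < s < 1 \<le> N, so both solutions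
    are continuous in time with values in L^1.\<close>
  have "1 \<le> real DIM('a)" using DIM_positive[where 'a = 'a] by linarith
  then have "1 < real DIM('a) / (real DIM('a) - s)" using s by (subst less_divide_eq_1_pos) linarith+
  then have cont: "continuous_Lp 1 \<Omega> T u" "continuous_Lp 1 \<Omega> T v"
    using u v by (simp_all add: weak_solution_with_def)
  have wd: "has_weak_time_derivative \<Omega> T u g" "has_weak_time_derivative \<Omega> T v h"
    using u v by (simp_all add: weak_solution_with_def)
  have "AE x in lebesgue_on \<Omega>. u 0 x = u0 x" "AE x in lebesgue_on \<Omega>. v 0 x = u0 x"
    using u v by (simp_all add: weak_solution_with_def)
  then have init: "AE x in lborel. x \<in> \<Omega> \<longrightarrow> u 0 x = u0 x" "AE x in lborel. x \<in> \<Omega> \<longrightarrow> v 0 x = u0 x"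
    by (simp_all only: AE_lebesgue_on_iff[OF Ob])
  define G where "G p = Gu p - Gv p" for p
  note iGu = L2_representative_integrable[OF Gu \<Omega>] and iGv = L2_representative_integrable[OF Gv \<Omega>]
  have GI: "integrable lborel G" unfolding G_def using iGu iGv by simp
  have GI2: "integrable lborel (\<lambda>p. (G p)\<^sup>2)"
    unfolding G_def using Gu Gv
    by (intro integrable_square_diff) (simp_all add: L2_representative_def)
  have G0: "G p = 0" if "p \<notin> {0<..<T} \<times> \<Omega>" for p
  proof -
    have "Gu p = 0" "Gv p = 0" using Gu Gv that unfolding L2_representative_def by blast+
    then show ?thesis by (simp add: G_def)
  qed
  have G0t: "G (\<tau>, x) = 0" if "\<tau> \<notin> {0<..<T}" for \<tau> x using that by (intro G0) auto
  have [measurable]: "G \<in> borel_measurable (lborel \<Otimes>\<^sub>M lborel)"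
    using borel_measurable_integrable[OF GI] unfolding lborel_prod .
  define W where "W t x = (LBINT \<tau>:{0..t}. G (\<tau>, x))" for t x
  note en = square_integral_in_time[OF GI GI2 G0t less_imp_le[OF T], folded W_def]
  have Wm[measurable]: "W t \<in> borel_measurable borel" for t
  proof -
    have "W t \<in> borel_measurable lborel" unfolding W_def set_lebesgue_integral_def by measurable
    then show ?thesis by simp
  qed
  have W0: "W t x = 0" if "x \<notin> \<Omega>" for t x
  proof -
    have "G (\<tau>, x) = 0" for \<tau> using that by (intro G0) auto
    then show ?thesis by (simp add: W_def set_lebesgue_integral_def)
  qed
  \<comment> \<open>Unlike the slices of U and V, this is available at every t; the values at time 0
    cancel because both solutions have the initial datum u0.\<close>
  have diff: "AE x in lborel. x \<in> \<Omega> \<longrightarrow> u t x - v t x = W t x" if t: "t \<in> {0..T}" for t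
  proof -
    have secs: "AE x in lborel. integrable lborel (\<lambda>\<tau>. F (\<tau>, x))"
      if "integrable lborel F" for F :: "real \<times> 'a \<Rightarrow> real"
      using lborel_pair.AE_integrable_snd[of "\<lambda>\<tau> x. F (\<tau>, x)"] that[folded lborel_prod]
      by (simp add: case_prod_beta')
    show ?thesis
      using weak_time_derivative_imp_integral[OF \<Omega> cont(1) wd(1) U Gu t]
        weak_time_derivative_imp_integral[OF \<Omega> cont(2) wd(2) V Gv t] init secs[OF iGu] secs[OF iGv]
    proof eventually_elim
      case (elim x)
      have "W t x = (LBINT \<tau>:{0..t}. Gu (\<tau>, x)) - (LBINT \<tau>:{0..t}. Gv (\<tau>, x))"
        unfolding W_def G_def
      proof (rule set_integral_diff(2))
        show "set_integrable lborel {0..t} (\<lambda>\<tau>. Gu (\<tau>, x))" "set_integrable lborel {0..t} (\<lambda>\<tau>. Gv (\<tau>, x))"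
          unfolding set_integrable_def by (intro integrable_mult_indicator elim(5,6); simp)+
      qed
      then show ?case using elim(1-4) by auto
    qed
  qed
  define y where "y t = (LBINT x. (W t x)\<^sup>2)" for t
  define z where "z \<tau> = 2 * (LBINT x. G (\<tau>, x) * W \<tau> x)" for \<tau>
  have eqG: "AE p in lborel. p \<in> {0<..<T} \<times> \<Omega> \<longrightarrow> g (fst p) (snd p) - h (fst p) (snd p) = G p"
  proof -
    have "AE p in lborel. p \<in> {0<..<T} \<times> \<Omega> \<longrightarrow> g (fst p) (snd p) = Gu p"
      "AE p in lborel. p \<in> {0<..<T} \<times> \<Omega> \<longrightarrow> h (fst p) (snd p) = Gv p"
      using Gu Gv unfolding L2_representative_def by blast+
    then show ?thesis by eventually_elim (simp add: G_def)
  qed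
  \<comment> \<open>The factor 2 is that of the energy identity. Gronwall asks for a nonnegative
    constant, and the sign of L is recorded only inside an almost-everywhere statement; hence
    |L|.\<close>
  have zy: "AE \<tau> in lborel. \<tau> \<in> {0<..<T} \<longrightarrow> z \<tau> \<le> (2 * \<bar>L\<bar>) * y \<tau>"
    using \<eta> \<xi> AE_lborel_sections(1)[OF eqG]
  proof eventually_elim
    case (elim \<tau>)
    show ?case
    proof
      assume \<tau>: "\<tau> \<in> {0<..<T}"
      then have d: "AE x in lborel. x \<in> \<Omega> \<longrightarrow> u \<tau> x - v \<tau> x = W \<tau> x" by (intro diff) auto
      have "AE x in lborel. x \<in> \<Omega> \<longrightarrow> (g \<tau> x - h \<tau> x) * (u \<tau> x - v \<tau> x) = G (\<tau>, x) * W \<tau> x"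
        using d elim(3) by eventually_elim (use \<tau> in auto)
      then have "(LINT x|lebesgue_on \<Omega>. (g \<tau> x - h \<tau> x) * (u \<tau> x - v \<tau> x)) =
          (LBINT x. indicator \<Omega> x * (G (\<tau>, x) * W \<tau> x))"
        by (rule integral_lebesgue_on_AE_eq[OF Ob, rotated]) measurable
      also have "\<dots> = (LBINT x. G (\<tau>, x) * W \<tau> x)"
        by (rule Bochner_Integration.integral_cong) (auto simp: indicator_def W0)
      finally have 1: "z \<tau> = 2 * (LINT x|lebesgue_on \<Omega>. (g \<tau> x - h \<tau> x) * (u \<tau> x - v \<tau> x))"
        by (simp add: z_def)
      have "AE x in lborel. x \<in> \<Omega> \<longrightarrow> (u \<tau> x - v \<tau> x)\<^sup>2 = (W \<tau> x)\<^sup>2"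
        using d by eventually_elim auto
      then have "(LINT x|lebesgue_on \<Omega>. (u \<tau> x - v \<tau> x)\<^sup>2) = (LBINT x. indicator \<Omega> x * (W \<tau> x)\<^sup>2)"
        by (rule integral_lebesgue_on_AE_eq[OF Ob, rotated]) measurable
      also have "\<dots> = y \<tau>"
        unfolding y_def by (rule Bochner_Integration.integral_cong) (auto simp: indicator_def W0)
      finally have 2: "(LINT x|lebesgue_on \<Omega>. (u \<tau> x - v \<tau> x)\<^sup>2) = y \<tau>" .
      have wf: "weak_form_at s \<Omega> f (u \<tau>) (g \<tau>) (\<eta> \<tau>)" "weak_form_at s \<Omega> f (v \<tau>) (h \<tau>) (\<xi> \<tau>)"
        using elim(1,2) \<tau> by blast+
      have "(LINT x|lebesgue_on \<Omega>. (g \<tau> x - h \<tau> x) * (u \<tau> x - v \<tau> x)) \<le> L * y \<tau>"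
        unfolding 2[symmetric] by (rule weak_form_at_difference[OF \<Omega>(1) f f0 lip wf])
      also have "\<dots> \<le> \<bar>L\<bar> * y \<tau>" by (intro mult_right_mono) (simp_all add: y_def)
      finally show "z \<tau> \<le> (2 * \<bar>L\<bar>) * y \<tau>" using 1 by simp
    qed
  qed
  have "y t = 0"
  proof (rule gronwall_integral_zero[OF _ _ _ _ zy t])
    show "integrable lborel z" unfolding z_def using en(1) by simp
    show "y t = (LBINT \<tau>:{0..t}. z \<tau>)" for t
      unfolding y_def z_def set_integral_mult_right by (rule en(3))
    show "0 \<le> y t" for t by (simp add: y_def)
  qed simp
  then have "AE x in lborel. (W t x)\<^sup>2 = 0"
    unfolding y_def using en(2)[of t] by (subst (asm) integral_nonneg_eq_0_iff_AE) auto
  then have "AE x in lborel. x \<in> \<Omega> \<longrightarrow> u t x = v t x"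
    using diff[OF t] by eventually_elim auto
  then show ?thesis by (simp only: AE_lebesgue_on_iff[OF Ob])
qed

theorem corollary2p9:
  fixes \<Omega> :: "'a::euclidean_space set" and s r :: real
    and f :: "'a \<Rightarrow> real \<Rightarrow> real" and u0 :: "'a \<Rightarrow> real"
  assumes s: "0 < s" "s < 1"
    and \<Omega>: "bounded_lipschitz_domain \<Omega>"
    and carath: "caratheodory \<Omega> f"
    and r: "1 < r" "r < real DIM('a) / (real DIM('a) - s)"
    and growth: "\<exists>C>0. \<forall>x\<in>\<Omega>. \<forall>t. \<bar>f x t\<bar> \<le> C * \<bar>t\<bar> powr (r - 1)"
    and superlinear: "\<exists>\<theta>>1. \<forall>x\<in>\<Omega>. \<forall>t. t \<noteq> 0 \<longrightarrow>
           0 < \<theta> * primitive f x t \<and> \<theta> * primitive f x t \<le> t * f x t"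
    and C1: "\<forall>x\<in>\<Omega>. f x C1_differentiable_on UNIV"
    and deriv_growth: "\<exists>\<Theta>>1. \<forall>x\<in>\<Omega>. \<forall>t. t \<noteq> 0 \<longrightarrow>
           (\<Theta> - 1) * f x t * t < t\<^sup>2 * deriv (f x) t"
    and r': "r < 1 + real DIM('a) / (2 * (real DIM('a) - s))"
    and u0: "u0 \<in> W0 s \<Omega> \<inter> Lp_space 2 \<Omega>"
    and energy_le: "ereal (energy s \<Omega> f u0) \<le> potential_depth s \<Omega> f"
    and nehari_nonneg: "0 \<le> nehari_functional s \<Omega> f u0"
    and lipschitz: "\<exists>L. AE x in lebesgue_on \<Omega>. L-lipschitz_on UNIV (f x)"
  shows "(\<forall>T>0. \<forall>u v. weak_solution s \<Omega> f u0 T u \<and> weak_solution s \<Omega> f u0 T v \<longrightarrow>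
             (\<forall>t\<in>{0..T}. AE x in lebesgue_on \<Omega>. u t x = v t x)) \<and>
         (\<forall>T>0. \<forall>u v. strong_solution s \<Omega> f u0 T u \<and> strong_solution s \<Omega> f u0 T v \<longrightarrow>
             (\<forall>t\<in>{0..T}. AE x in lebesgue_on \<Omega>. u t x = v t x))"
proof -
  have \<Omega>': "open \<Omega>" "bounded \<Omega>" using \<Omega> by (auto simp: bounded_lipschitz_domain_def)
  \<comment> \<open>At t = 0 the right-hand side of the growth bound is 0.\<close>
  have f0: "f x 0 = 0" if "x \<in> \<Omega>" for x
  proof -
    obtain C where "\<forall>x\<in>\<Omega>. \<forall>t. \<bar>f x t\<bar> \<le> C * \<bar>t\<bar> powr (r - 1)" using growth by blast
    from spec[OF bspec[OF this that], of 0] show ?thesis by simp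
  qed
  obtain L where lip: "AE x in lebesgue_on \<Omega>. L-lipschitz_on UNIV (f x)" using lipschitz by blast
  \<comment> \<open>The derivatives g and h of the two solutions are independent variables. A strong
    solution supplies its own \<open>weak_solution_with\<close>, so this fact settles both
    conjuncts.\<close>
  have "AE x in lebesgue_on \<Omega>. u t x = v t x"
    if "0 < T" "weak_solution_with s \<Omega> f u0 T u g" "weak_solution_with s \<Omega> f u0 T v h" "t \<in> {0..T}"
    for T u v g h t
    by (rule weak_solution_unique[OF \<Omega>' carath f0 lip s that])
  then show ?thesis unfolding weak_solution_def strong_solution_def by blast
qed

end
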